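(* Let $f,g\in\mathrm{Lip}(\Omega)$, where $g$ is not co-boundary to a constant (that is, there are no $v\in \mathrm{C}(\Omega)$ and $c_0\in\mathbb{R}$ with $g=v-v\circ T+c_0$). For $t\in\mathbb{R}$ put $\beta(t):=P(f+tg)-P(f)$. Let $u$ be either a simple function $u=\sum_{j=1}^k a_j 1_{A_j}$ or a function $u\in \mathrm{C}(\mathbb{R})$. Then $$\lim_{n\to\infty}\int_\Omega u\Bigl(\frac{1}{\sqrt n}\sum_{j=0}^{n-1}\bigl(g\circ T^j-\beta'(0)\bigr)\Bigr)\,d\mu_f=\int_{\mathbb{R}}u(t)\,d\phi_{0,\beta''(0)}(t),$$ where $\phi_{0,\beta''(0)}$ is the Gaussian distribution on $\mathbb{R}$ with mean $0$ and variance $\sigma^2=\beta''(0)$.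
   Context: Let $(M,d_M)$ be a compact metric space with $\mathrm{diam}(M)=1$, $\Omega:=M^{\mathbb{N}}$ with metric $d(x,y)=\sum_{n\ge1}2^{-n}d_M(x_n,y_n)$, and $T:\Omega\to\Omega$ the shift $T((x_n)_{n\ge1})=(x_{n+1})_{n\ge1}$. $\mathrm{C}(\Omega)$ and $\mathrm{Lip}(\Omega)$ are the spaces of real continuous and real Lipschitz functions on $\Omega$, and $\mathrm{C}(\mathbb{R})$ is the space of real continuous functions on $\mathbb{R}$. Fix a Borel probability $\nu$ on $M$ with support $M$ (the a priori measure). For $f\in\mathrm{Lip}(\Omega)$ the Ruelle operator is $\mathcal{L}_f(w)(x)=\int_M e^{f(ax)}w(ax)\,d\nu(a)$, where $ax=(a,x_1,x_2,\dots)$. By the Ruelle-Perron-Frobenius (RPF) theorem there are $\lambda_f>0$, a strictly positive $w_f\in\mathrm{Lip}(\Omega)$ and a Borel probability $\rho_f$ on $\Omega$ with $\mathcal{L}_f w_f=\lambda_f w_f$, $\mathcal{L}_f^*\rho_f=\lambda_f\rho_f$. The pressure is $P(f):=\log\lambda_f$; the map $t\mapsto P(f+tg)$ is analytic. The normalization of $f$ is $N(f)=f+\log w_f-\log(w_f\circ T)-\log\lambda_f$, which satisfies $\mathcal{L}_{N(f)}1=1$. The Lipschitz-Gibbs probability $\mu_f$ is the unique Borel probability with $\mathcal{L}_{N(f)}^*\mu_f=\mu_f$; it is $T$-invariant. The Gaussian distribution with mean $\alpha$ and variance $\sigma^2>0$ is $d\phi_{\alpha,\sigma^2}(t)=\frac{1}{\sqrt{2\pi\sigma^2}}e^{-(t-\alpha)^2/(2\sigma^2)}dt$.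 A simple function is a finite linear combination of indicator functions $1_{A_j}$ of sets $A_j\subset\mathbb{R}$.
   Formalization: The sets A_j are taken Borel with Lebesgue-null boundary, and continuous u are required to satisfy u(t)=O(exp(εt²)) for every ε>0, since for arbitrary sets or arbitrary continuous u the claim is false or the Gaussian integral diverges; β''(0)>0 is also proved. *)

theory Defs
  imports "HOL-Probability.Probability"
begin

text \<open>
  The compact metric space \<open>M\<close> is the universe of a type of class \<^class>\<open>metric_space\<close>.
  Points of \<open>\<Omega> = M\<^sup>\<nat>\<close> are functions \<open>nat \<Rightarrow> 'a\<close>, indexed from \<open>0\<close>, so the
  coordinate \<open>x\<^sub>n\<close> with \<open>n \<ge> 1\<close> is \<open>x (n - 1)\<close>. The topology and the Borel sets of \<open>\<Omega>\<close>
  are those of the library's product topology, which \<open>seq_dist\<close> metrizes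
  (\<open>open_iff_seq_dist\<close> below). The metric that the library puts on a countable product is
  not this one, hence the explicit \<open>seq_dist\<close> in the definition of Lipschitz functions.
\<close>

definition seq_dist :: "(nat \<Rightarrow> 'a::metric_space) \<Rightarrow> (nat \<Rightarrow> 'a) \<Rightarrow> real" where
  "seq_dist x y = (\<Sum>n. (1/2) ^ Suc n * dist (x n) (y n))"

lemma seq_dist_term_le:
  fixes x y :: "nat \<Rightarrow> 'a::metric_space"
  assumes "compact (UNIV :: 'a set)" and "diameter (UNIV :: 'a set) = 1"
  shows "norm ((1/2) ^ Suc n * dist (x n) (y n)) \<le> (1/2::real) ^ Suc n"
proof -
  have "dist (x n) (y n) \<le> 1"
    using diameter_bounded_bound[OF compact_imp_bounded[OF assms(1)], of "x n" "y n"] assms(2)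
    by simp
  then show ?thesis
    by (simp add: mult_left_le)
qed

lemma summable_seq_dist:
  fixes x y :: "nat \<Rightarrow> 'a::metric_space"
  assumes "compact (UNIV :: 'a set)" and "diameter (UNIV :: 'a set) = 1"
  shows "summable (\<lambda>n. (1/2) ^ Suc n * dist (x n) (y n))"
  by (rule summable_comparison_test'[where N = 0 and g = "\<lambda>n. (1/2) ^ Suc n"])
     (use seq_dist_term_le[OF assms] in auto)

lemma continuous_seq_dist:
  fixes x :: "nat \<Rightarrow> 'a::metric_space"
  assumes "compact (UNIV :: 'a set)" and "diameter (UNIV :: 'a set) = 1"
  shows "continuous_on UNIV (seq_dist x)"
proof -
  have lim: "uniform_limit UNIV (\<lambda>n y. \<Sum>i<n. (1/2) ^ Suc i * dist (x i) (y i))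
      (\<lambda>y. \<Sum>i. (1/2) ^ Suc i * dist (x i) (y i)) sequentially"
    by (rule Weierstrass_m_test[where M = "\<lambda>n. (1/2) ^ Suc n"])
       (use seq_dist_term_le[OF assms] in auto)
  have "continuous_on UNIV (\<lambda>y. \<Sum>i. (1/2) ^ Suc i * dist (x i) (y i))"
    by (rule uniform_limit_theorem[OF _ lim])
       (auto intro!: always_eventually continuous_intros continuous_on_product_coordinates)
  then show ?thesis
    by (simp add: seq_dist_def[abs_def])
qed

lemma open_iff_seq_dist:
  fixes U :: "(nat \<Rightarrow> 'a::metric_space) set"
  assumes "compact (UNIV :: 'a set)" and "diameter (UNIV :: 'a set) = 1"
  shows "open U \<longleftrightarrow> (\<forall>x\<in>U. \<exists>e>0. \<forall>y. seq_dist x y < e \<longrightarrow> y \<in> U)"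
proof
  assume "open U"
  show "\<forall>x\<in>U. \<exists>e>0. \<forall>y. seq_dist x y < e \<longrightarrow> y \<in> U"
  proof
    fix x assume "x \<in> U"
    from product_topology_open_contains_basis[OF \<open>open U\<close>[unfolded open_fun_def] this]
    obtain X where X: "x \<in> (\<Pi>\<^sub>E i\<in>UNIV. X i)" "\<And>i. open (X i)"
      "finite {i. X i \<noteq> UNIV}" "(\<Pi>\<^sub>E i\<in>UNIV. X i) \<subseteq> U"
      by (auto simp: topspace_euclidean)
    let ?I = "{i. X i \<noteq> UNIV}"
    have "\<forall>i. \<exists>r>0. ball (x i) r \<subseteq> X i"
      using X(1,2) by (meson PiE_mem UNIV_I open_contains_ball)
    then obtain r where r: "\<And>i. r i > 0" "\<And>i. ball (x i) (r i) \<subseteq> X i"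
      by metis
    define e where "e = Min (insert 1 ((\<lambda>i. (1/2) ^ Suc i * r i) ` ?I))"
    have "e > 0"
      unfolding e_def using X(3) r(1) by (subst Min_gr_iff) auto
    moreover have "y \<in> U" if "seq_dist x y < e" for y
    proof -
      have "y i \<in> X i" for i
      proof (cases "i \<in> ?I")
        case True
        then have "e \<le> (1/2) ^ Suc i * r i"
          unfolding e_def using X(3) by (intro Min_le) auto
        moreover have "(1/2) ^ Suc i * dist (x i) (y i) \<le> seq_dist x y"
          unfolding seq_dist_def
          using sum_le_suminf[OF summable_seq_dist[OF assms], of "{i}" x y] by auto
        ultimately have "(1/2) ^ Suc i * dist (x i) (y i) < (1/2) ^ Suc i * r i"
          using that by linarith
        then have "dist (x i) (y i) < r i"
          by (simp add: divide_simps)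
        then show ?thesis
          using r(2)[of i] by auto
      qed auto
      then show ?thesis
        using X(4) by auto
    qed
    ultimately show "\<exists>e>0. \<forall>y. seq_dist x y < e \<longrightarrow> y \<in> U"
      by blast
  qed
next
  assume *: "\<forall>x\<in>U. \<exists>e>0. \<forall>y. seq_dist x y < e \<longrightarrow> y \<in> U"
  show "open U"
  proof (subst open_subopen, rule ballI)
    fix x assume "x \<in> U"
    with * obtain e where e: "e > 0" "\<And>y. seq_dist x y < e \<Longrightarrow> y \<in> U"
      by blast
    have "open {y. seq_dist x y < e}"
      by (intro open_Collect_less continuous_seq_dist[OF assms] continuous_on_const)
    moreover have "seq_dist x x < e"
      using e(1) by (simp add: seq_dist_def)
    ultimately show "\<exists>V. open V \<and> x \<in> V \<and> V \<subseteq> U"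
      using e(2) by blast
  qed
qed

definition Lip :: "((nat \<Rightarrow> 'a::metric_space) \<Rightarrow> real) set" where
  "Lip = {f. \<exists>K. \<forall>x y. \<bar>f x - f y\<bar> \<le> K * seq_dist x y}"

definition seq_shift :: "(nat \<Rightarrow> 'a) \<Rightarrow> (nat \<Rightarrow> 'a)" where
  "seq_shift x = (\<lambda>n. x (Suc n))"

definition prepend :: "'a \<Rightarrow> (nat \<Rightarrow> 'a) \<Rightarrow> (nat \<Rightarrow> 'a)" where
  "prepend a x = case_nat a x"

definition a_priori_measure :: "'a::metric_space measure \<Rightarrow> bool" where
  "a_priori_measure \<nu> \<longleftrightarrow> prob_space \<nu> \<and> sets \<nu> = sets borel \<and>
     (\<forall>U. open U \<and> U \<noteq> {} \<longrightarrow> measure \<nu> U > 0)"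

definition ruelle_op ::
  "'a::metric_space measure \<Rightarrow> ((nat \<Rightarrow> 'a) \<Rightarrow> real) \<Rightarrow> ((nat \<Rightarrow> 'a) \<Rightarrow> real) \<Rightarrow> (nat \<Rightarrow> 'a) \<Rightarrow> real"
  where
  "ruelle_op \<nu> f w x = (LINT a|\<nu>. exp (f (prepend a x)) * w (prepend a x))"

text \<open>\<open>dual_eigenprob \<nu> f c \<rho>\<close>: \<open>\<rho>\<close> is a Borel probability on \<open>\<Omega>\<close> whose image under the
  dual of the Ruelle operator of \<open>f\<close> on \<open>C(\<Omega>)\<close> is \<open>c \<rho>\<close>.\<close>

definition dual_eigenprob ::
  "'a::metric_space measure \<Rightarrow> ((nat \<Rightarrow> 'a) \<Rightarrow> real) \<Rightarrow> real \<Rightarrow> (nat \<Rightarrow> 'a) measure \<Rightarrow> bool"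
  where
  "dual_eigenprob \<nu> f c \<rho> \<longleftrightarrow> prob_space \<rho> \<and> sets \<rho> = sets borel \<and>
     (\<forall>w. continuous_on UNIV w \<longrightarrow> (LINT x|\<rho>. ruelle_op \<nu> f w x) = c * (LINT x|\<rho>. w x))"

definition rpf_data ::
  "'a::metric_space measure \<Rightarrow> ((nat \<Rightarrow> 'a) \<Rightarrow> real) \<Rightarrow> real \<Rightarrow> ((nat \<Rightarrow> 'a) \<Rightarrow> real)
    \<Rightarrow> (nat \<Rightarrow> 'a) measure \<Rightarrow> bool"
  where
  "rpf_data \<nu> f c w \<rho> \<longleftrightarrow> c > 0 \<and> w \<in> Lip \<and> (\<forall>x. w x > 0) \<and>
     (\<forall>x. ruelle_op \<nu> f w x = c * w x) \<and> dual_eigenprob \<nu> f c \<rho>"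

definition rpf_eigenvalue :: "'a::metric_space measure \<Rightarrow> ((nat \<Rightarrow> 'a) \<Rightarrow> real) \<Rightarrow> real" where
  "rpf_eigenvalue \<nu> f = (THE c. \<exists>w \<rho>. rpf_data \<nu> f c w \<rho>)"

text \<open>The eigenfunction is unique only up to a positive factor, which cancels in
  \<open>normalization\<close>.\<close>

definition rpf_eigenfunction ::
  "'a::metric_space measure \<Rightarrow> ((nat \<Rightarrow> 'a) \<Rightarrow> real) \<Rightarrow> (nat \<Rightarrow> 'a) \<Rightarrow> real" where
  "rpf_eigenfunction \<nu> f = (SOME w. \<exists>\<rho>. rpf_data \<nu> f (rpf_eigenvalue \<nu> f) w \<rho>)"

definition pressure :: "'a::metric_space measure \<Rightarrow> ((nat \<Rightarrow> 'a) \<Rightarrow> real) \<Rightarrow> real" where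
  "pressure \<nu> f = ln (rpf_eigenvalue \<nu> f)"

definition normalization ::
  "'a::metric_space measure \<Rightarrow> ((nat \<Rightarrow> 'a) \<Rightarrow> real) \<Rightarrow> (nat \<Rightarrow> 'a) \<Rightarrow> real" where
  "normalization \<nu> f x = f x + ln (rpf_eigenfunction \<nu> f x)
     - ln (rpf_eigenfunction \<nu> f (seq_shift x)) - ln (rpf_eigenvalue \<nu> f)"

definition gibbs_measure ::
  "'a::metric_space measure \<Rightarrow> ((nat \<Rightarrow> 'a) \<Rightarrow> real) \<Rightarrow> (nat \<Rightarrow> 'a) measure" where
  "gibbs_measure \<nu> f = (THE \<mu>. dual_eigenprob \<nu> (normalization \<nu> f) 1 \<mu>)"

definition coboundary_to_constant :: "((nat \<Rightarrow> 'a::metric_space) \<Rightarrow> real) \<Rightarrow> bool" where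
  "coboundary_to_constant g \<longleftrightarrow>
     (\<exists>v c0. continuous_on UNIV v \<and> (\<forall>x. g x = v x - v (seq_shift x) + c0))"

text \<open>Convergence in distribution can be tested on \<open>indicator A\<close> only if the boundary of \<open>A\<close>
  is null for the limit law: if \<open>M\<close> has two points and \<open>g x = h (x 0)\<close>, then the normalized
  Birkhoff sums of \<open>g\<close>, over all \<open>n\<close>, lie in one countable set, which is null for the Gaussian.
  Hence the condition on \<open>A j\<close>, which holds for every interval.\<close>

definition simple_test_function :: "(real \<Rightarrow> real) \<Rightarrow> bool" where
  "simple_test_function u \<longleftrightarrow> (\<exists>(k::nat) a A.
     (\<forall>j\<in>{1..k}. A j \<in> sets borel \<and> negligible (frontier (A j))) \<and>
     u = (\<lambda>t. \<Sum>j=1..k. a j * indicator (A j) t))"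

text \<open>For \<open>u\<close> growing like \<open>exp (\<epsilon> t\<^sup>2)\<close> the Gaussian integral diverges once the variance is
  at least \<open>1 / (2 \<epsilon>)\<close>, so continuous \<open>u\<close> are taken with growth below every such rate. All
  bounded functions, polynomials and exponentials are included.\<close>

definition continuous_test_function :: "(real \<Rightarrow> real) \<Rightarrow> bool" where
  "continuous_test_function u \<longleftrightarrow> continuous_on UNIV u \<and>
     (\<forall>\<epsilon>>0. \<exists>C. \<forall>t. \<bar>u t\<bar> \<le> C * exp (\<epsilon> * t\<^sup>2))"

end

theory Submission
  imports Defs
begin

text \<open>
  Normalizing \<open>f\<close> turns its Ruelle operator into a Markov operator \<open>L\<close>, which contracts a cone of
  functions of bounded logarithmic variation; hence \<open>L\<^sup>n p\<close> converges to a constant exponentially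
  fast for Lipschitz \<open>p\<close>. Solving \<open>h - L h = p - \<integral>p d\<mu>\<close> twice gives \<open>g = \<alpha> + \<psi> - k + k \<circ> T\<close> with
  \<open>L \<psi> = 0\<close>, and \<open>q\<close> with \<open>q - L q = L (\<psi>\<^sup>2) - \<sigma>\<^sup>2\<close>, where \<open>\<sigma>\<^sup>2 = \<integral>\<psi>\<^sup>2 d\<mu>\<close>. Then
  \<open>L (e\<^bsup>z\<psi>\<^esup> (1 + z\<^sup>2 q / 2)) = (1 + z\<^sup>2 \<sigma>\<^sup>2 / 2) (1 + z\<^sup>2 q / 2) + O(z\<^sup>3)\<close>, an approximate eigenvalue equation.
  For real \<open>z\<close>, integrated against the eigenmeasure of \<open>f + z g\<close>, it yields
  \<open>\<beta>(z) = \<alpha> z + \<sigma>\<^sup>2 z\<^sup>2 / 2 + O(z\<^sup>3)\<close>; as the pressure lies above its tangents (Jensen), this expansion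
  can be differentiated. For \<open>z = i s / \<surd>n\<close> it is iterated \<open>n\<close> times to give the limit of the
  characteristic functions. Unbounded test functions are controlled by the sub-Gaussian bound
  \<open>\<integral>e\<^bsup>t S\<^sub>n \<psi>\<^esup> d\<mu> \<le> e\<^bsup>n t\<^sup>2 B\<^sup>2\<^esup>\<close> for \<open>B \<ge> |\<psi>|\<close>, and \<open>\<sigma>\<^sup>2 > 0\<close> because \<open>\<mu>\<close> has full support.
\<close>

text \<open>The eigenvalue and the Gibbs measure are selected by \<open>THE\<close>, so nothing can
  be said of them before existence and uniqueness are established; hence Riesz representation and
  the Ruelle-Perron-Frobenius theorem precede all probability. The cone contraction yields the
  eigenfunction, which reduces \<open>f\<close> to the Markov case. There the limit of
  \<open>L\<^sup>n p\<close> is a positive functional of \<open>p\<close>, hence a measure;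
  weighting it by the reciprocal of the eigenfunction gives the eigenmeasure of \<open>f\<close>.
  The bridge from approximate eigenfunctions to eigenvalues is positivity: two-sided pointwise
  bounds on the image of one explicit positive function, integrated against the eigenmeasure,
  confine the eigenvalue. A third-order expansion of the pressure at 0 says nothing about its
  derivative at nearby points, since the remainder may oscillate. Repeating the decomposition of
  \<open>g\<close> at each \<open>f + s g\<close> identifies that derivative as a Gibbs mean, and
  the tangents with these slopes control how it varies.\<close>

lemma continuous_bounded_compact_UNIV:
  fixes p :: "'b::metric_space \<Rightarrow> 'c::real_normed_vector"
  assumes "compact (UNIV :: 'b set)" "continuous_on UNIV p"
  shows "\<exists>B>0. \<forall>x. norm (p x) \<le> B"
proof -
  have "bounded (range p)"
    using assms by (intro compact_imp_bounded compact_continuous_image) auto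
  then show ?thesis
    by (auto simp: bounded_pos)
qed

lemma integrable_continuous_compact_UNIV:
  fixes p :: "'b::metric_space \<Rightarrow> 'c::{banach, second_countable_topology}"
  assumes "compact (UNIV :: 'b set)" "finite_measure M" "sets M = sets borel"
    and "continuous_on UNIV p"
  shows "integrable M p"
proof -
  obtain B where "\<And>x. norm (p x) \<le> B"
    using continuous_bounded_compact_UNIV[OF assms(1,4)] by blast
  moreover have "p \<in> borel_measurable M"
    using borel_measurable_continuous_onI[OF assms(4)] measurable_cong_sets[OF assms(3) refl] by blast
  ultimately show ?thesis
    using assms(2) by (intro finite_measure.integrable_const_bound[where B=B]) auto
qed

subsection \<open>Positive functionals on a compact metric space\<close>

text \<open>The laws concern continuous arguments only, so that a functional defined by a limit
  qualifies although its values elsewhere are arbitrary.\<close>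

locale positive_functional =
  fixes \<Phi> :: "('b::metric_space \<Rightarrow> real) \<Rightarrow> real"
  assumes compact_UNIV_b: "compact (UNIV :: 'b set)"
    and Phi_add: "continuous_on UNIV p \<Longrightarrow> continuous_on UNIV q \<Longrightarrow> \<Phi> (\<lambda>x. p x + q x) = \<Phi> p + \<Phi> q"
    and Phi_scale: "continuous_on UNIV p \<Longrightarrow> \<Phi> (\<lambda>x. c * p x) = c * \<Phi> p"
    and Phi_nonneg: "continuous_on UNIV p \<Longrightarrow> (\<And>x. 0 \<le> p x) \<Longrightarrow> 0 \<le> \<Phi> p"
    and Phi_one: "\<Phi> (\<lambda>x. 1) = 1"
begin

lemma Phi_const: "\<Phi> (\<lambda>x. c) = c"
  using Phi_scale[of "\<lambda>x. 1" c] Phi_one by simp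

lemma Phi_diff:
  "continuous_on UNIV p \<Longrightarrow> continuous_on UNIV q \<Longrightarrow> \<Phi> (\<lambda>x. p x - q x) = \<Phi> p - \<Phi> q"
  using Phi_add[of p "\<lambda>x. -1 * q x"] Phi_scale[of q "-1"] by (simp add: continuous_intros)

lemma Phi_mono:
  assumes "continuous_on UNIV p" "continuous_on UNIV q" "\<And>x. p x \<le> q x"
  shows "\<Phi> p \<le> \<Phi> q"
  using Phi_nonneg[of "\<lambda>x. q x - p x"] Phi_diff[of q p] assms by (simp add: continuous_intros)

lemma Phi_sum:
  assumes "finite I" "\<And>i. i \<in> I \<Longrightarrow> continuous_on UNIV (p i)"
  shows "\<Phi> (\<lambda>x. \<Sum>i\<in>I. p i x) = (\<Sum>i\<in>I. \<Phi> (p i))"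
  using assms
  by (induction I rule: finite_induct) (simp_all add: Phi_const Phi_add continuous_on_sum)

definition below :: "'b set \<Rightarrow> ('b \<Rightarrow> real) set" where
  "below U = {p. continuous_on UNIV p \<and> (\<forall>x. 0 \<le> p x \<and> p x \<le> indicator U x)}"

text \<open>The value that a representing measure must give to an open set, whose indicator is an
  increasing limit of continuous functions below it. \<open>outer\<close> then extends it to all
  sets by regularity from outside.\<close>

definition content :: "'b set \<Rightarrow> ennreal" where
  "content U = (SUP p\<in>below U. ennreal (\<Phi> p))"

definition outer :: "'b set \<Rightarrow> ennreal" where
  "outer A = (INF U\<in>{U. open U \<and> A \<subseteq> U}. content U)"

lemma belowD:
  assumes "p \<in> below U"
  shows "continuous_on UNIV p" "0 \<le> p x" "p x \<le> 1" "x \<notin> U \<Longrightarrow> p x = 0" "0 \<le> \<Phi> p"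
proof -
  show c: "continuous_on UNIV p" and p: "0 \<le> p x" for x
    using assms by (auto simp: below_def)
  show "0 \<le> \<Phi> p"
    using Phi_nonneg c p by blast
  have "p x \<le> indicator U x"
    using assms by (auto simp: below_def)
  then show "p x \<le> 1" "x \<notin> U \<Longrightarrow> p x = 0"
    using p[of x] by (cases "x \<in> U"; simp)+
qed

lemma belowI:
  assumes "continuous_on UNIV p" "\<And>x. 0 \<le> p x" "\<And>x. p x \<le> 1" "\<And>x. x \<notin> U \<Longrightarrow> p x \<le> 0"
  shows "p \<in> below U"
  using assms by (auto simp: below_def indicator_def)

lemma content_upper: "p \<in> below U \<Longrightarrow> ennreal (\<Phi> p) \<le> content U"
  unfolding content_def by (rule SUP_upper)

lemma content_mono: "U \<subseteq> V \<Longrightarrow> content U \<le> content V"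
  unfolding content_def
  by (rule SUP_subset_mono) (auto intro!: belowI dest: belowD)

lemma content_le_1: "content U \<le> 1"
  unfolding content_def
proof (rule SUP_least)
  fix p assume p: "p \<in> below U"
  have "\<Phi> p \<le> \<Phi> (\<lambda>x. 1)"
    using belowD[OF p] by (intro Phi_mono) auto
  then show "ennreal (\<Phi> p) \<le> 1"
    by (simp add: Phi_one)
qed

lemma content_empty: "content {} = 0"
proof -
  have "ennreal (\<Phi> p) = 0" if "p \<in> below {}" for p
  proof -
    have "p = (\<lambda>x. 0)"
      using belowD(4)[OF that] by auto
    then show ?thesis
      by (simp add: Phi_const)
  qed
  then show ?thesis
    unfolding content_def by (simp add: SUP_eq_const[where x=0] SUP_le_iff flip: le_zero_eq)
qed

lemma outer_le: "open U \<Longrightarrow> A \<subseteq> U \<Longrightarrow> outer A \<le> content U"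
  unfolding outer_def by (rule INF_lower) auto

lemma outer_open: "open U \<Longrightarrow> outer U = content U"
  unfolding outer_def by (intro antisym INF_lower INF_greatest content_mono) auto

lemma outer_mono: "A \<subseteq> B \<Longrightarrow> outer A \<le> outer B"
  unfolding outer_def by (rule INF_superset_mono) auto

text \<open>Tents of slope \<open>k\<close> over \<open>U\<close>: they increase to the indicator of \<open>U\<close>. The case distinction
  is needed because \<open>infdist x {} = 0\<close>.\<close>

definition tent :: "'b set \<Rightarrow> nat \<Rightarrow> 'b \<Rightarrow> real" where
  "tent U k x = (if U = UNIV then min 1 (real k) else min 1 (real k * infdist x (- U)))"

lemma tent_below: "tent U k \<in> below U"
proof (rule belowI)
  show "continuous_on UNIV (tent U k)"
    unfolding tent_def[abs_def] by (cases "U = UNIV") (simp_all add: continuous_intros)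
  show "tent U k x \<le> 0" if "x \<notin> U" for x
    using that by (auto simp: tent_def)
qed (auto simp: tent_def infdist_nonneg)

lemma tent_mono: "k \<le> l \<Longrightarrow> tent U k x \<le> tent U l x"
  unfolding tent_def
  by (cases "U = UNIV") (simp_all add: infdist_nonneg mult_right_mono min.coboundedI2)

lemma tent_eq_1:
  assumes "open U" "x \<in> U"
  shows "\<exists>k. tent U k x = 1"
proof (cases "U = UNIV")
  case True
  then show ?thesis
    by (auto simp: tent_def intro!: exI[of _ 1])
next
  case False
  then have "infdist x (- U) > 0"
    using assms in_closed_iff_infdist_zero[of "- U" x] infdist_nonneg[of x "- U"] by fastforce
  then obtain k where "1 \<le> real k * infdist x (- U)"
    using reals_Archimedean3 less_imp_le by blast
  then have "tent U k x = 1"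
    using False by (simp add: tent_def)
  then show ?thesis ..
qed

text \<open>A Dini argument. The functions \<open>s k\<close> increase with \<open>k\<close>, and at
  each point some \<open>s k\<close> exceeds \<open>p - e\<close>. By compactness finitely many of
  the open sets \<open>W k\<close> cover the space, so a single \<open>s K\<close> exceeds
  \<open>p - e\<close> everywhere, and \<open>\<Phi>\<close> can be applied to this
  inequality.\<close>

lemma content_UN_le:
  fixes U :: "nat \<Rightarrow> 'b set"
  assumes "\<And>i. open (U i)"
  shows "content (\<Union>i. U i) \<le> (\<Sum>i. content (U i))"
  unfolding content_def[of "\<Union>i. U i"]
proof (rule SUP_least)
  fix p assume p: "p \<in> below (\<Union>i. U i)"
  show "ennreal (\<Phi> p) \<le> (\<Sum>i. content (U i))"
  proof (rule ennreal_le_epsilon)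
    fix e :: real assume "e > 0"
    \<comment> \<open>The index \<open>k\<close> truncates the sum and steepens the tents at the
      same time, which makes \<open>s\<close> increasing in \<open>k\<close>.\<close>
    define s where "s k x = (\<Sum>i<k. tent (U i) k x)" for k x
    have cont_s: "continuous_on UNIV (s k)" for k
      unfolding s_def by (intro continuous_intros belowD(1)[OF tent_below])
    have s_mono: "s k x \<le> s l x" if "k \<le> l" for k l x
    proof -
      have "s k x \<le> (\<Sum>i<k. tent (U i) l x)"
        unfolding s_def using that by (intro sum_mono tent_mono)
      also have "\<dots> \<le> s l x"
        unfolding s_def using that by (intro sum_mono2) (auto intro: belowD(2)[OF tent_below])
      finally show ?thesis .
    qed
    define W where "W k = {x. p x - e < s k x}" for k
    have open_W: "open (W k)" for k
      unfolding W_def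
      by (intro open_Collect_less continuous_intros cont_s belowD(1)[OF p])
    have "UNIV \<subseteq> (\<Union>k. W k)"
    proof
      fix x
      show "x \<in> (\<Union>k. W k)"
      proof (cases "x \<in> (\<Union>i. U i)")
        case True
        then obtain i where "x \<in> U i" by auto
        then obtain k where k: "tent (U i) k x = 1"
          using tent_eq_1 assms by blast
        define m where "m = max k (Suc i)"
        have "1 \<le> tent (U i) m x"
          using tent_mono[of k m "U i" x] k by (simp add: m_def)
        also have "\<dots> \<le> s m x"
          unfolding s_def
          by (rule member_le_sum) (auto simp: m_def intro: belowD(2)[OF tent_below])
        finally have "p x - e < s m x"
          using belowD(3)[OF p, of x] \<open>e > 0\<close> by linarith
        then show ?thesis
          by (auto simp: W_def)
      next
        case False
        then have "p x - e < s 0 x"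
          using belowD(4)[OF p] \<open>e > 0\<close> by (auto simp: s_def)
        then show ?thesis
          unfolding W_def by blast
      qed
    qed
    with compact_UNIV_b open_W obtain C where C: "finite C" "UNIV \<subseteq> (\<Union>k\<in>C. W k)"
      by (meson compactE_image)
    define K where "K = Max C"
    have "p x \<le> s K x + e" for x
    proof -
      obtain k where k: "k \<in> C" "x \<in> W k" using C by blast
      then have "k \<le> K"
        unfolding K_def using C(1) by simp
      with k(2) s_mono[of k K x] show ?thesis
        by (simp add: W_def)
    qed
    then have "\<Phi> p \<le> \<Phi> (\<lambda>x. s K x + e)"
      by (intro Phi_mono continuous_intros cont_s belowD(1)[OF p])
    also have "\<dots> = (\<Sum>i<K. \<Phi> (tent (U i) K)) + e"
      using Phi_add[OF cont_s continuous_on_const, of K e] Phi_const[of e]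
        Phi_sum[of "{..<K}" "\<lambda>i. tent (U i) K"] belowD(1)[OF tent_below]
      by (simp add: s_def[abs_def])
    finally have "ennreal (\<Phi> p) \<le> ennreal ((\<Sum>i<K. \<Phi> (tent (U i) K)) + e)"
      by (rule ennreal_leI)
    also have "\<dots> = (\<Sum>i<K. ennreal (\<Phi> (tent (U i) K))) + ennreal e"
      using \<open>e > 0\<close> belowD(5)[OF tent_below]
      by (simp add: ennreal_plus sum_nonneg flip: sum_ennreal)
    also have "\<dots> \<le> (\<Sum>i<K. content (U i)) + ennreal e"
      by (intro add_right_mono sum_mono content_upper tent_below)
    also have "\<dots> \<le> (\<Sum>i. content (U i)) + ennreal e"
      by (intro add_right_mono sum_le_suminf) auto
    finally show "ennreal (\<Phi> p) \<le> (\<Sum>i. content (U i)) + ennreal e" .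
  qed
qed

lemma outer_UN_le:
  fixes A :: "nat \<Rightarrow> 'b set"
  shows "outer (\<Union>i. A i) \<le> (\<Sum>i. outer (A i))"
proof (rule ennreal_le_epsilon)
  fix e :: real assume "e > 0"
  have "\<exists>U. open U \<and> A i \<subseteq> U \<and> content U \<le> outer (A i) + ennreal (e * (1/2) ^ Suc i)" for i
  proof -
    \<comment> \<open>Strictness requires \<open>outer (A i)\<close> to be finite, which
      \<open>content_le_1\<close> ensures.\<close>
    have "outer (A i) < outer (A i) + ennreal (e * (1/2) ^ Suc i)"
    proof -
      have "outer (A i) \<le> 1"
        using outer_le[of UNIV "A i"] content_le_1[of UNIV] by (auto intro: order_trans)
      then show ?thesis
        using \<open>e > 0\<close>
        by (cases "outer (A i)") (auto simp: ennreal_less_iff top_unique simp flip: ennreal_plus)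
    qed
    then show ?thesis
      unfolding outer_def[of "A i"] by (auto simp: INF_less_iff intro: less_imp_le)
  qed
  then obtain U where U: "\<And>i. open (U i)" "\<And>i. A i \<subseteq> U i"
    "\<And>i. content (U i) \<le> outer (A i) + ennreal (e * (1/2) ^ Suc i)"
    by metis
  have "outer (\<Union>i. A i) \<le> content (\<Union>i. U i)"
    using U(1,2) by (intro outer_le) auto
  also have "\<dots> \<le> (\<Sum>i. content (U i))"
    by (rule content_UN_le[OF U(1)])
  also have "\<dots> \<le> (\<Sum>i. outer (A i) + ennreal (e * (1/2) ^ Suc i))"
    by (intro suminf_le U(3)) auto
  also have "\<dots> = (\<Sum>i. outer (A i)) + (\<Sum>i. ennreal (e * (1/2) ^ Suc i))"
    by (subst suminf_add) auto
  also have "(\<Sum>i. ennreal (e * (1/2) ^ Suc i)) = ennreal e"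
    using \<open>e > 0\<close> sums_mult[OF power_half_series, of e]
    by (intro suminf_ennreal_eq) auto
  finally show "outer (\<Union>i. A i) \<le> (\<Sum>i. outer (A i)) + ennreal e" .
qed

lemma outer_empty: "outer {} = 0"
  using outer_open[of "{}"] content_empty by simp

lemma outer_measure_space_outer: "outer_measure_space UNIV outer"
  unfolding outer_measure_space_def positive_def increasing_def countably_subadditive_def
  using outer_empty outer_mono outer_UN_le by auto

lemma outer_Un_le: "outer (A \<union> B) \<le> outer A + outer B"
proof -
  have "outer (\<Union>i. binaryset A B i) \<le> (\<Sum>i. outer (binaryset A B i))"
    by (rule outer_UN_le)
  then show ?thesis
    using suminf_binaryset_eq[of outer A B] outer_empty by (simp add: UN_binaryset_eq)
qed

text \<open>Cut \<open>p\<close> down to \<open>q = max 0 (p - e)\<close>, which lives where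
  \<open>p > e\<close>. A function \<open>r\<close> below \<open>V\<close> and supported where
  \<open>p < e\<close> does not overlap with \<open>q\<close>, so \<open>q + r\<close> is still
  below \<open>V\<close>. The set where \<open>p < e\<close> contains \<open>V - U\<close>, hence
  the functions \<open>r\<close> account for \<open>outer (V - U)\<close>, and the cut costs only
  \<open>e\<close>.\<close>

lemma open_split_le:
  assumes "open U" "open V"
  shows "content (V \<inter> U) + outer (V - U) \<le> content V"
proof -
  have "ennreal (\<Phi> p) + outer (V - U) \<le> content V" if p: "p \<in> below (V \<inter> U)" for p
  proof (rule ennreal_le_epsilon)
    fix e :: real assume "e > 0"
    define q where "q x = max 0 (p x - e)" for x
    have cq: "continuous_on UNIV q"
      unfolding q_def by (intro continuous_intros belowD(1)[OF p])
    have "open (V \<inter> {x. p x < e})"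
      by (intro open_Int assms open_Collect_less belowD(1)[OF p] continuous_on_const)
    then have "outer (V - U) \<le> content (V \<inter> {x. p x < e})"
      using belowD(4)[OF p] \<open>e > 0\<close> by (intro outer_le) auto
    then have "ennreal (\<Phi> p) + outer (V - U) \<le> ennreal (\<Phi> p) + content (V \<inter> {x. p x < e})"
      by (intro add_left_mono)
    also have "\<dots> = (SUP r\<in>below (V \<inter> {x. p x < e}). ennreal (\<Phi> p) + ennreal (\<Phi> r))"
      unfolding content_def using tent_below by (subst ennreal_SUP_add_right) auto
    also have "\<dots> \<le> content V + ennreal e"
    proof (rule SUP_least)
      fix r assume r: "r \<in> below (V \<inter> {x. p x < e})"
      have "(\<lambda>x. q x + r x) \<in> below V"
      proof (rule belowI)
        show "continuous_on UNIV (\<lambda>x. q x + r x)"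
          by (intro continuous_intros cq belowD(1)[OF r])
        show "0 \<le> q x + r x" for x
          using belowD(2)[OF r, of x] by (simp add: q_def)
        show "q x + r x \<le> 1" for x
          using belowD(3)[OF r, of x] belowD(4)[OF r, of x] belowD(3)[OF p, of x] \<open>e > 0\<close>
          by (cases "p x < e") (auto simp: q_def)
        show "q x + r x \<le> 0" if "x \<notin> V" for x
          using belowD(4)[OF r, of x] belowD(4)[OF p, of x] that \<open>e > 0\<close> by (simp add: q_def)
      qed
      then have le: "ennreal (\<Phi> (\<lambda>x. q x + r x)) \<le> content V"
        by (rule content_upper)
      have "\<Phi> p \<le> \<Phi> (\<lambda>x. q x + e)"
        by (intro Phi_mono continuous_intros cq belowD(1)[OF p]) (auto simp: q_def)
      also have "\<dots> = \<Phi> q + e"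
        using Phi_add[OF cq continuous_on_const, of e] Phi_const[of e] by simp
      finally have "\<Phi> p + \<Phi> r \<le> \<Phi> (\<lambda>x. q x + r x) + e"
        using Phi_add[OF cq belowD(1)[OF r]] by simp
      then have "ennreal (\<Phi> p) + ennreal (\<Phi> r) \<le> ennreal (\<Phi> (\<lambda>x. q x + r x) + e)"
        using belowD(5)[OF p] belowD(5)[OF r] by (simp add: ennreal_leI flip: ennreal_plus)
      also have "\<dots> = ennreal (\<Phi> (\<lambda>x. q x + r x)) + ennreal e"
      proof (rule ennreal_plus)
        have "0 \<le> \<Phi> q"
          by (rule Phi_nonneg[OF cq]) (simp add: q_def)
        then show "0 \<le> \<Phi> (\<lambda>x. q x + r x)"
          using Phi_add[OF cq belowD(1)[OF r]] belowD(5)[OF r] by simp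
      qed (use \<open>e > 0\<close> in simp)
      also have "\<dots> \<le> content V + ennreal e"
        using le by (rule add_right_mono)
      finally show "ennreal (\<Phi> p) + ennreal (\<Phi> r) \<le> content V + ennreal e" .
    qed
    finally show "ennreal (\<Phi> p) + outer (V - U) \<le> content V + ennreal e" .
  qed
  then have "(SUP p\<in>below (V \<inter> U). outer (V - U) + ennreal (\<Phi> p)) \<le> content V"
    by (intro SUP_least) (simp add: add.commute)
  then show ?thesis
    unfolding content_def[of "V \<inter> U"] using tent_below
    by (subst (asm) ennreal_SUP_add_right[symmetric]) (auto simp: add.commute)
qed

text \<open>Caratheodory's criterion for an arbitrary test set \<open>A\<close> follows from
  \<open>open_split_le\<close> for the open supersets of \<open>A\<close>, on passing to the
  infimum.\<close>

lemma open_in_lambda_system: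
  assumes "open U"
  shows "U \<in> lambda_system UNIV UNIV outer"
proof -
  have "outer (A \<inter> U) + outer (A - U) = outer A" for A
  proof (rule antisym)
    show "outer A \<le> outer (A \<inter> U) + outer (A - U)"
      using outer_Un_le[of "A \<inter> U" "A - U"] by (simp add: Int_Diff_Un)
    show "outer (A \<inter> U) + outer (A - U) \<le> outer A"
      unfolding outer_def[of A]
    proof (rule INF_greatest)
      fix V assume V: "V \<in> {U. open U \<and> A \<subseteq> U}"
      have "outer (A \<inter> U) + outer (A - U) \<le> content (V \<inter> U) + outer (V - U)"
        using V assms by (intro add_mono outer_le outer_mono) auto
      also have "\<dots> \<le> content V"
        using V assms by (intro open_split_le) auto
      finally show "outer (A \<inter> U) + outer (A - U) \<le> content V" .
    qed
  qed
  then show ?thesis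
    using algebra.lambda_system_eq[OF algebra_Pow[of "UNIV :: 'b set"], of outer] by simp
qed

section \<open>The representing measure and its integral\<close>

definition riesz :: "'b measure" where
  "riesz = measure_of UNIV {U. open U} outer"

lemma sets_riesz [simp]: "sets riesz = sets borel"
  by (simp add: riesz_def borel_def)

lemma space_riesz [simp]: "space riesz = UNIV"
  by (simp add: riesz_def)

lemma emeasure_riesz_open:
  assumes "open U"
  shows "emeasure riesz U = content U"
proof -
  let ?L = "lambda_system UNIV UNIV outer"
  have ms: "measure_space UNIV ?L outer"
    using sigma_algebra.caratheodory_lemma[OF sigma_algebra_Pow[of "UNIV :: 'b set"]]
      outer_measure_space_outer by simp
  then have "sigma_sets UNIV {U :: 'b set. open U} \<subseteq> ?L"
    unfolding measure_space_def using open_in_lambda_system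
    by (intro sigma_algebra.sigma_sets_subset) auto
  then have "measure_space UNIV (sigma_sets UNIV {U :: 'b set. open U}) outer"
    using ms by (intro measure_down[OF ms] sigma_algebra_sigma_sets) auto
  then have "emeasure riesz U = outer U"
    using assms by (intro emeasure_measure_of[OF riesz_def])
      (auto simp: measure_space_def riesz_def)
  then show ?thesis
    using outer_open assms by simp
qed

lemma prob_space_riesz: "prob_space riesz"
proof
  have "ennreal (\<Phi> (\<lambda>x. 1)) \<le> content UNIV"
    by (rule content_upper) (auto intro: belowI)
  then show "emeasure riesz (space riesz) = 1"
    using emeasure_riesz_open[of UNIV] content_le_1[of UNIV] by (simp add: Phi_one)
qed

lemma integrable_riesz:
  fixes p :: "'b \<Rightarrow> real"
  shows "continuous_on UNIV p \<Longrightarrow> integrable riesz p"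
  by (intro integrable_continuous_compact_UNIV[OF compact_UNIV_b] prob_space_riesz
      prob_space.finite_measure sets_riesz)

lemma measure_riesz_open_le:
  assumes "open U" "continuous_on UNIV q" "\<And>x. 0 \<le> q x" "\<And>x. x \<in> U \<Longrightarrow> 1 \<le> q x"
  shows "measure riesz U \<le> \<Phi> q"
proof -
  interpret prob_space riesz by (rule prob_space_riesz)
  have "content U \<le> ennreal (\<Phi> q)"
    unfolding content_def
  proof (rule SUP_least)
    fix p assume p: "p \<in> below U"
    have "p x \<le> q x" for x
      using belowD(3,4)[OF p, of x] assms(3,4)[of x] by fastforce
    then show "ennreal (\<Phi> p) \<le> ennreal (\<Phi> q)"
      by (intro ennreal_leI Phi_mono belowD(1)[OF p] assms)
  qed
  then show ?thesis
    using emeasure_riesz_open[OF assms(1)] Phi_nonneg[OF assms(2,3)]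
    by (metis emeasure_eq_measure ennreal_le_iff)
qed

text \<open>Slicing \<open>p\<close> into layers of height \<open>1 / n\<close> bounds the integral by \<open>\<Phi> p + 1 / n\<close>; the
  reverse inequality comes from \<open>1 - p\<close>.\<close>

lemma integral_riesz_le:
  assumes "continuous_on UNIV p" "\<And>x. 0 \<le> p x" "\<And>x. p x \<le> 1"
  shows "(LINT x|riesz. p x) \<le> \<Phi> p"
proof -
  interpret prob_space riesz by (rule prob_space_riesz)
  have "(LINT x|riesz. p x) \<le> \<Phi> p + 1 / real n" if "n > 0" for n :: nat
  proof -
    \<comment> \<open>The part of \<open>n p\<close> between the heights \<open>i\<close> and
      \<open>i + 1\<close>; these layers add up to \<open>n p\<close>.\<close>
    define q where "q i x = min 1 (max 0 (real n * p x - real i))" for i x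
    have cq: "continuous_on UNIV (q i)" for i
      unfolding q_def by (intro continuous_intros assms)
    have q: "0 \<le> q i x" "q i x \<le> 1" for i x
      by (auto simp: q_def)
    have sum_q: "(\<Sum>i<k. q i x) = min (real k) (real n * p x)" for k :: nat and x :: 'b
    proof (induction k)
      case 0
      then show ?case
        using assms(2)[of x] by simp
    next
      case (Suc k)
      then show ?case
        by (simp add: q_def min_def max_def)
    qed
    have sum_q': "(\<Sum>i<n. q i x) = real n * p x" for x
      unfolding sum_q using assms(3)[of x] by (simp add: mult_left_le)
    have int_q: "integrable riesz (q i)" for i
      by (intro integrable_riesz cq)
    \<comment> \<open>An open set separates consecutive layers: \<open>q (Suc i)\<close> vanishes
      outside the set where \<open>n p > i + 1\<close>, and \<open>q i\<close> equals 1 on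
      it.\<close>
    have le: "(LINT x|riesz. q (Suc i) x) \<le> \<Phi> (q i)" for i
    proof -
      have op: "open {x. real i + 1 < real n * p x}"
        by (intro open_Collect_less continuous_intros assms)
      have "(LINT x|riesz. q (Suc i) x) \<le> (LINT x|riesz. indicator {x. real i + 1 < real n * p x} x)"
        using op q by (intro integral_mono int_q integrable_real_indicator)
          (auto simp: emeasure_eq_measure q_def indicator_def)
      also have "\<dots> = measure riesz {x. real i + 1 < real n * p x}"
        using op by simp
      also have "\<dots> \<le> \<Phi> (q i)"
        by (rule measure_riesz_open_le[OF op cq q(1)]) (auto simp: q_def)
      finally show ?thesis .
    qed
    have "real n * (LINT x|riesz. p x) = (LINT x|riesz. (\<Sum>i<n. q i x))"
      unfolding sum_q' by simp
    also have "\<dots> = (\<Sum>i<n. LINT x|riesz. q i x)"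
      by (intro Bochner_Integration.integral_sum int_q)
    also have "\<dots> \<le> (\<Sum>i<Suc n. LINT x|riesz. q i x)"
      using q(1) by (simp add: integral_nonneg)
    also have "\<dots> = (LINT x|riesz. q 0 x) + (\<Sum>i<n. LINT x|riesz. q (Suc i) x)"
      by (rule sum.lessThan_Suc_shift)
    \<comment> \<open>The bottom layer has nothing below it to be compared with; it costs at most 1,
      which becomes \<open>1 / n\<close> after division.\<close>
    also have "\<dots> \<le> 1 + (\<Sum>i<n. \<Phi> (q i))"
      using integral_le_const[OF int_q[of 0], of 1] q(2) by (intro add_mono sum_mono le) auto
    also have "(\<Sum>i<n. \<Phi> (q i)) = \<Phi> (\<lambda>x. real n * p x)"
      using Phi_sum[of "{..<n}" q] cq by (simp add: sum_q')
    also have "\<dots> = real n * \<Phi> p"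
      by (rule Phi_scale[OF assms(1)])
    finally show ?thesis
      using that by (simp add: field_simps)
  qed
  then have "(LINT x|riesz. p x) \<le> \<Phi> p + 1 / real (Suc n)" for n
    by blast
  moreover have "(\<lambda>n. \<Phi> p + 1 / real (Suc n)) \<longlonglongrightarrow> \<Phi> p + 0"
    by (intro tendsto_intros LIMSEQ_Suc[OF lim_1_over_n])
  ultimately show ?thesis
    by (intro LIMSEQ_le_const) auto
qed

lemma integral_riesz:
  assumes "continuous_on UNIV p"
  shows "(LINT x|riesz. p x) = \<Phi> p"
proof -
  interpret prob_space riesz by (rule prob_space_riesz)
  have *: "(LINT x|riesz. q x) = \<Phi> q"
    if q: "continuous_on UNIV q" "\<And>x. 0 \<le> q x" "\<And>x. q x \<le> 1" for q
  proof (rule antisym)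
    show "(LINT x|riesz. q x) \<le> \<Phi> q"
      by (rule integral_riesz_le) (use q in auto)
    have "(LINT x|riesz. 1 - q x) \<le> \<Phi> (\<lambda>x. 1 - q x)"
      by (rule integral_riesz_le) (use q in \<open>auto intro: continuous_intros\<close>)
    moreover have "integrable riesz q"
      by (intro integrable_riesz q)
    moreover have "\<Phi> (\<lambda>x. 1 - q x) = 1 - \<Phi> q"
      using Phi_diff[of "\<lambda>x. 1" q] q(1) by (simp add: Phi_one)
    ultimately show "\<Phi> q \<le> (LINT x|riesz. q x)"
      using prob_space by simp
  qed
  obtain B where B: "B > 0" "\<And>x. \<bar>p x\<bar> \<le> B"
    using continuous_bounded_compact_UNIV[OF compact_UNIV_b assms] by (metis real_norm_def)
  define q where "q x = (p x + B) / (2 * B)" for x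
  have cq: "continuous_on UNIV q"
    unfolding q_def using B(1) by (intro continuous_intros assms) auto
  have "0 \<le> q x" "q x \<le> 1" for x
    using B(1) B(2)[of x] by (auto simp: q_def field_simps)
  then have eq: "(LINT x|riesz. q x) = \<Phi> q"
    by (intro * cq)
  have p: "p x = 2 * B * q x - B" for x
    using B(1) by (simp add: q_def)
  have "integrable riesz q"
    by (intro integrable_riesz cq)
  then have "(LINT x|riesz. 2 * B * q x - B) = 2 * B * (LINT x|riesz. q x) - B"
    using prob_space by simp
  also have "\<dots> = \<Phi> (\<lambda>x. 2 * B * q x - B)"
    using Phi_diff[of "\<lambda>x. 2 * B * q x" "\<lambda>x. B"] Phi_scale[OF cq, of "2 * B"] Phi_const[of B] cq
    by (simp add: eq continuous_intros)
  finally show ?thesis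
    unfolding p[abs_def, symmetric] .
qed

text \<open>Tents determine the measure of every open set as a limit of values of
  \<open>\<Phi>\<close>, and the open sets form an intersection-stable generator of the Borel
  sets.\<close>

lemma riesz_unique:
  assumes M: "prob_space M" "sets M = sets borel"
    and eq: "\<And>p. continuous_on UNIV p \<Longrightarrow> (LINT x|M. p x) = \<Phi> p"
  shows "M = riesz"
proof -
  have lim: "(\<lambda>k. \<Phi> (tent U k)) \<longlonglongrightarrow> measure M' U"
    if U: "open U" and M': "prob_space M'" "sets M' = sets borel"
      and eq': "\<And>p. continuous_on UNIV p \<Longrightarrow> (LINT x|M'. p x) = \<Phi> p" for M' U
  proof -
    interpret M': prob_space M' by fact
    have meas: "p \<in> borel_measurable M'" if "p \<in> borel_measurable borel" for p :: "'b \<Rightarrow> real"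
      using that measurable_cong_sets[OF M'(2) refl] by blast
    have "(\<lambda>k. LINT x|M'. tent U k x) \<longlonglongrightarrow> (LINT x|M'. indicator U x)"
    proof (rule integral_dominated_convergence[where w="\<lambda>x. 1"])
      show "AE x in M'. (\<lambda>k. tent U k x) \<longlonglongrightarrow> indicator U x"
      proof (rule AE_I2)
        fix x
        show "(\<lambda>k. tent U k x) \<longlonglongrightarrow> indicator U x"
        proof (cases "x \<in> U")
          case True
          then obtain k where k: "tent U k x = 1"
            using tent_eq_1[OF U] by blast
          have "tent U l x = 1" if "k \<le> l" for l
            using tent_mono[OF that, of U x] belowD(3)[OF tent_below[of U l], of x] k by simp
          then have "\<forall>\<^sub>F l in sequentially. tent U l x = 1"
            by (rule eventually_sequentiallyI)
          then show ?thesis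
            using True by (simp add: tendsto_eventually)
        next
          case False
          then show ?thesis
            using belowD(4)[OF tent_below] by simp
        qed
      qed
      show "AE x in M'. norm (tent U k x) \<le> 1" for k
        using belowD(2,3)[OF tent_below[of U k]] by (intro AE_I2) simp
      show "tent U k \<in> borel_measurable M'" for k
        by (intro meas borel_measurable_continuous_onI belowD(1)[OF tent_below])
      show "(indicator U :: 'b \<Rightarrow> real) \<in> borel_measurable M'"
        using U by (intro meas) simp
    qed simp
    moreover have "(LINT x|M'. tent U k x) = \<Phi> (tent U k)" for k
      by (intro eq' belowD(1)[OF tent_below])
    moreover have "(LINT x|M'. indicator U x) = measure M' U"
      using U M'(2) by simp
    ultimately show ?thesis
      by simp
  qed
  have "measure M U = measure riesz U" if "open U" for U
    using LIMSEQ_unique[OF lim[OF that M eq] lim[OF that prob_space_riesz sets_riesz integral_riesz]] .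
  then have "emeasure M U = emeasure riesz U" if "open U" for U
    using that M(1) prob_space_riesz
    by (simp add: finite_measure.emeasure_eq_measure prob_space.finite_measure)
  then show ?thesis
  proof (intro measure_eqI_generator_eq[where E="{U. open U}" and A="\<lambda>_. UNIV" and \<Omega>=UNIV])
    show "emeasure M UNIV \<noteq> \<infinity>" for i :: nat
      using M(1) by (simp add: finite_measure.emeasure_eq_measure prob_space.finite_measure)
    show "sets M = sigma_sets UNIV {U. open U}" "sets riesz = sigma_sets UNIV {U. open U}"
      by (simp_all add: M(2) sets_borel)
  qed (auto simp: Int_stable_def)
qed

end

subsection \<open>The sequence space\<close>

lemma seq_shift_prepend [simp]: "seq_shift (prepend a x) = x"
  by (simp add: seq_shift_def prepend_def)

lemma continuous_seq_shift:
  "continuous_on UNIV (seq_shift :: (nat \<Rightarrow> 'a::topological_space) \<Rightarrow> _)"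
  unfolding seq_shift_def
  by (intro continuous_on_coordinatewise_then_product continuous_on_product_coordinates)

lemma continuous_prepend_right:
  "continuous_on UNIV (prepend (a::'a::topological_space))"
proof (rule continuous_on_coordinatewise_then_product)
  show "continuous_on UNIV (\<lambda>x. prepend a x i)" for i
    by (cases i) (simp_all add: prepend_def continuous_on_product_coordinates)
qed

lemma continuous_prepend_left:
  "continuous_on UNIV (\<lambda>a. prepend (a::'a::topological_space) x)"
proof (rule continuous_on_coordinatewise_then_product)
  show "continuous_on UNIV (\<lambda>a. prepend a x i)" for i
    by (cases i) (simp_all add: prepend_def)
qed

locale full_shift =
  fixes \<nu> :: "'a::metric_space measure"
  assumes compact_M: "compact (UNIV :: 'a set)"
    and diam_M: "diameter (UNIV :: 'a set) = 1"
    and apriori: "a_priori_measure \<nu>"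
begin

sublocale nu: prob_space \<nu>
  using apriori by (simp add: a_priori_measure_def)

lemma sets_nu [simp]: "sets \<nu> = sets borel"
  using apriori by (simp add: a_priori_measure_def)

lemma space_nu [simp]: "space \<nu> = UNIV"
  using sets_eq_imp_space_eq[OF sets_nu] by simp

lemma compact_Omega: "compact (UNIV :: (nat \<Rightarrow> 'a) set)"
proof -
  have "compact_space (euclidean :: 'a topology)"
    using compact_M by (simp add: compact_space_def)
  then have "compact_space (product_topology (\<lambda>i::nat. euclidean :: 'a topology) UNIV)"
    by (simp add: compact_space_product_topology)
  then show ?thesis
    by (simp add: euclidean_product_topology compact_space_def)
qed

abbreviation D :: "(nat \<Rightarrow> 'a) \<Rightarrow> (nat \<Rightarrow> 'a) \<Rightarrow> real" where "D \<equiv> seq_dist"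

lemmas summable_D = summable_seq_dist[OF compact_M diam_M]

lemma D_nonneg [simp]: "0 \<le> D x y"
  unfolding seq_dist_def by (intro suminf_nonneg summable_D) auto

lemma D_self [simp]: "D x x = 0"
  by (simp add: seq_dist_def)

lemma D_sym: "D x y = D y x"
  by (simp add: seq_dist_def dist_commute)

lemma D_le_1: "D x y \<le> 1"
proof -
  have "D x y \<le> (\<Sum>n. (1/2) ^ Suc n)"
    unfolding seq_dist_def
  proof (rule suminf_le)
    show "(1/2) ^ Suc n * dist (x n) (y n) \<le> (1/2) ^ Suc n" for n
      using seq_dist_term_le[OF compact_M diam_M, of n x y] by (simp add: abs_mult)
  qed (use summable_D sums_summable[OF power_half_series] in auto)
  then show ?thesis
    using sums_unique[OF power_half_series] by simp
qed

lemma dist_coord_le: "dist (x n) (y n) \<le> 2 ^ Suc n * D x y"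
proof -
  have "(1/2) ^ Suc n * dist (x n) (y n) \<le> D x y"
    unfolding seq_dist_def using sum_le_suminf[OF summable_D, of "{n}" x y] by auto
  then have "2 ^ Suc n * ((1/2) ^ Suc n * dist (x n) (y n)) \<le> 2 ^ Suc n * D x y"
    by (intro mult_left_mono) auto
  then show ?thesis
    by (simp add: field_simps power_one_over)
qed

text \<open>This halving is the contraction of the inverse branches of the shift;
  \<open>ruelle_cone\<close> draws its gain from it.\<close>

lemma D_prepend: "D (prepend a x) (prepend a y) = D x y / 2"
proof -
  have "D (prepend a x) (prepend a y)
      = (\<Sum>n. (1/2) ^ Suc (Suc n) * dist (x n) (y n)) + (1/2) ^ Suc 0 * dist a a"
    unfolding seq_dist_def
    using suminf_split_head[OF summable_D[of "prepend a x" "prepend a y"]]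
    by (simp add: prepend_def)
  also have "(\<Sum>n. (1/2) ^ Suc (Suc n) * dist (x n) (y n))
      = (\<Sum>n. (1/2) * ((1/2) ^ Suc n * dist (x n) (y n)))"
    by (simp add: mult.assoc)
  also have "\<dots> = D x y / 2"
    unfolding seq_dist_def by (subst suminf_mult[OF summable_D]) simp
  finally show ?thesis
    by simp
qed

lemma D_shift_le: "D (seq_shift x) (seq_shift y) \<le> 2 * D x y"
proof -
  have "D (seq_shift x) (seq_shift y) = (\<Sum>n. 2 * ((1/2) ^ Suc (Suc n) * dist (x (Suc n)) (y (Suc n))))"
    by (simp add: seq_dist_def seq_shift_def mult.assoc)
  also have "\<dots> = 2 * (\<Sum>n. (1/2) ^ Suc (Suc n) * dist (x (Suc n)) (y (Suc n)))"
    using summable_D[of x y] by (intro suminf_mult) (subst summable_Suc_iff)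
  also have "(\<Sum>n. (1/2) ^ Suc (Suc n) * dist (x (Suc n)) (y (Suc n))) = D x y - (1/2) ^ Suc 0 * dist (x 0) (y 0)"
    unfolding seq_dist_def by (rule suminf_split_head[OF summable_D])
  finally show ?thesis
    by simp
qed

section \<open>Lipschitz and continuous functions on sequence space\<close>

abbreviation cont :: "((nat \<Rightarrow> 'a) \<Rightarrow> 'c::topological_space) \<Rightarrow> bool" where
  "cont p \<equiv> continuous_on UNIV p"

text \<open>Ties the polymorphic \<open>Lip\<close> to the alphabet \<open>'a\<close> of the
  locale.\<close>

abbreviation LipM :: "((nat \<Rightarrow> 'a) \<Rightarrow> real) set" where
  "LipM \<equiv> Lip"

lemma Lip_bound:
  assumes "f \<in> LipM"
  shows "\<exists>K\<ge>0. \<forall>x y. \<bar>f x - f y\<bar> \<le> K * D x y"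
proof -
  obtain K where K: "\<And>x y. \<bar>f x - f y\<bar> \<le> K * D x y"
    using assms unfolding Lip_def by blast
  have "\<bar>f x - f y\<bar> \<le> max 0 K * D x y" for x y
    by (rule order_trans[OF K mult_right_mono]) auto
  then show ?thesis
    by (intro exI[of _ "max 0 K"]) auto
qed

lemma LipI: "(\<And>x y. \<bar>f x - f y\<bar> \<le> K * D x y) \<Longrightarrow> f \<in> LipM"
  unfolding Lip_def mem_Collect_eq by (rule exI[of _ K]) blast

lemma Lip_cont:
  assumes "f \<in> LipM"
  shows "cont f"
proof -
  obtain K where K: "0 \<le> K" "\<And>x y. \<bar>f x - f y\<bar> \<le> K * D x y"
    using Lip_bound[OF assms] by blast
  have "(f \<longlongrightarrow> f x) (at x)" for x
  proof -
    have "isCont (D x) x"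
      using continuous_seq_dist[OF compact_M diam_M, of x] by (simp add: continuous_on_eq_continuous_at)
    then have "(D x \<longlongrightarrow> 0) (at x)"
      unfolding isCont_def D_self .
    then have "((\<lambda>y. K * D x y) \<longlongrightarrow> 0) (at x)"
      by (rule tendsto_mult_right_zero)
    moreover have "norm (f y - f x) \<le> K * D x y" for y
      using K(2)[of y x] unfolding D_sym[of y x] real_norm_def .
    then have "\<forall>\<^sub>F y in at x. norm (f y - f x) \<le> K * D x y"
      by (intro always_eventually allI)
    ultimately have "((\<lambda>y. f y - f x) \<longlongrightarrow> 0) (at x)"
      by (rule Lim_null_comparison[rotated])
    then show ?thesis
      by (rule LIM_zero_cancel)
  qed
  then show ?thesis
    by (simp add: continuous_on_def)
qed

lemma Lip_const [simp]: "(\<lambda>x. c) \<in> LipM"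
  by (rule LipI[where K=0]) auto

lemma Lip_add:
  assumes "f \<in> LipM" "g \<in> LipM"
  shows "(\<lambda>x. f x + g x) \<in> LipM"
proof -
  obtain K where K: "0 \<le> K" "\<And>x y. \<bar>f x - f y\<bar> \<le> K * D x y" using Lip_bound[OF assms(1)] by blast
  obtain H where H: "0 \<le> H" "\<And>x y. \<bar>g x - g y\<bar> \<le> H * D x y" using Lip_bound[OF assms(2)] by blast
  show ?thesis
  proof (rule LipI[where K="K + H"])
    show "\<bar>f x + g x - (f y + g y)\<bar> \<le> (K + H) * D x y" for x y
      using K(2)[of x y] H(2)[of x y] by (simp add: algebra_simps)
  qed
qed

lemma cont_bounded:
  fixes p :: "(nat \<Rightarrow> 'a) \<Rightarrow> 'c::real_normed_vector"
  assumes "cont p"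
  shows "\<exists>B>0. \<forall>x. norm (p x) \<le> B"
  by (rule continuous_bounded_compact_UNIV[OF compact_Omega assms])

lemma cont_bounded_real:
  fixes p :: "(nat \<Rightarrow> 'a) \<Rightarrow> real"
  assumes "cont p"
  shows "\<exists>B>0. \<forall>x. \<bar>p x\<bar> \<le> B"
  using cont_bounded[OF assms] by simp

lemma cont_pos_bound:
  fixes p :: "(nat \<Rightarrow> 'a) \<Rightarrow> real"
  assumes "cont p" "\<And>x. p x > 0"
  shows "\<exists>b>0. \<forall>x. b \<le> p x"
proof -
  obtain x where "\<forall>y. p x \<le> p y"
    using continuous_attains_inf[OF compact_Omega _ assms(1)] by auto
  then show ?thesis
    using assms(2) by blast
qed

lemma Lip_mult:
  assumes "f \<in> LipM" "g \<in> LipM"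
  shows "(\<lambda>x. f x * g x) \<in> LipM"
proof -
  obtain K where K: "0 \<le> K" "\<And>x y. \<bar>f x - f y\<bar> \<le> K * D x y" using Lip_bound[OF assms(1)] by blast
  obtain H where H: "0 \<le> H" "\<And>x y. \<bar>g x - g y\<bar> \<le> H * D x y" using Lip_bound[OF assms(2)] by blast
  obtain A where A: "A > 0" "\<And>x. \<bar>f x\<bar> \<le> A" using cont_bounded_real[OF Lip_cont[OF assms(1)]] by blast
  obtain B where B: "B > 0" "\<And>x. \<bar>g x\<bar> \<le> B" using cont_bounded_real[OF Lip_cont[OF assms(2)]] by blast
  show ?thesis
  proof (rule LipI[where K="A * H + B * K"])
    fix x y
    have "f x * g x - f y * g y = f x * (g x - g y) + (f x - f y) * g y"
      by (simp add: algebra_simps)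
    also have "\<bar>\<dots>\<bar> \<le> \<bar>f x\<bar> * \<bar>g x - g y\<bar> + \<bar>f x - f y\<bar> * \<bar>g y\<bar>"
      by (metis abs_mult abs_triangle_ineq)
    also have "\<dots> \<le> A * (H * D x y) + K * D x y * B"
      using A(1) A(2)[of x] B(1) B(2)[of y] K(1) K(2)[of x y] H(1) H(2)[of x y]
      by (intro add_mono mult_mono) auto
    finally show "\<bar>f x * g x - f y * g y\<bar> \<le> (A * H + B * K) * D x y"
      by (simp add: algebra_simps)
  qed
qed

lemma Lip_diff: "f \<in> LipM \<Longrightarrow> g \<in> LipM \<Longrightarrow> (\<lambda>x. f x - g x) \<in> LipM"
  using Lip_add[OF _ Lip_mult[OF Lip_const[of "-1"]], of f g] by simp

lemma Lip_shift:
  assumes "f \<in> LipM"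
  shows "(\<lambda>x. f (seq_shift x)) \<in> LipM"
proof -
  obtain K where K: "0 \<le> K" "\<And>x y. \<bar>f x - f y\<bar> \<le> K * D x y" using Lip_bound[OF assms] by blast
  show ?thesis
  proof (rule LipI[where K="K * 2"])
    show "\<bar>f (seq_shift x) - f (seq_shift y)\<bar> \<le> K * 2 * D x y" for x y
      using order_trans[OF K(2) mult_left_mono[OF D_shift_le K(1)]] by (simp add: mult.assoc)
  qed
qed

lemma Lip_ln:
  assumes "f \<in> LipM" "\<And>x. f x > 0"
  shows "(\<lambda>x. ln (f x)) \<in> LipM"
proof -
  obtain K where K: "0 \<le> K" "\<And>x y. \<bar>f x - f y\<bar> \<le> K * D x y" using Lip_bound[OF assms(1)] by blast
  obtain b where b: "b > 0" "\<And>x. b \<le> f x" using cont_pos_bound[OF Lip_cont[OF assms(1)] assms(2)] by blast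
  have le: "ln (f x) - ln (f y) \<le> K / b * D x y" for x y
  proof -
    have "ln (f x) - ln (f y) = ln (f x / f y)"
      using assms(2)[of x] assms(2)[of y] by (simp add: ln_div)
    also have "\<dots> \<le> f x / f y - 1"
      using assms(2) by (intro ln_le_minus_one) simp
    also have "\<dots> = (f x - f y) / f y"
      using assms(2)[of y] by (simp add: field_simps)
    also have "\<dots> \<le> K * D x y / f y"
      using assms(2)[of y] K(2)[of x y] by (intro divide_right_mono) auto
    also have "\<dots> \<le> K * D x y / b"
      using b(1) b(2)[of y] K(1) assms(2)[of y] by (intro divide_left_mono) auto
    finally show ?thesis by simp
  qed
  show ?thesis
  proof (rule LipI[where K="K / b"])
    show "\<bar>ln (f x) - ln (f y)\<bar> \<le> K / b * D x y" for x y
      using le[of x y] le[of y x] unfolding D_sym[of y x] by linarith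
  qed
qed

text \<open>Stone-Weierstrass: Lipschitz functions form an algebra, and the distances of single
  coordinates to a fixed point separate sequences. It serves to carry the convergence of iterates
  over to all continuous functions.\<close>

lemma Lip_approx:
  fixes p :: "(nat \<Rightarrow> 'a) \<Rightarrow> real"
  assumes "cont p" "e > 0"
  shows "\<exists>q\<in>LipM. \<forall>x. \<bar>p x - q x\<bar> < e"
proof -
  interpret function_ring_on LipM "UNIV :: (nat \<Rightarrow> 'a) set"
  proof
    fix x y :: "nat \<Rightarrow> 'a" assume "x \<noteq> y"
    then obtain n where n: "x n \<noteq> y n" by auto
    have "(\<lambda>z. dist (z n) (y n)) \<in> LipM"
    proof (rule LipI[where K="2 ^ Suc n"])
      show "\<bar>dist (z n) (y n) - dist (z' n) (y n)\<bar> \<le> 2 ^ Suc n * D z z'" for z z'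
        using dist_coord_le[of z n z'] abs_dist_diff_le[of "z n" "y n" "z' n"]
        by (simp add: dist_commute)
    qed
    then show "\<exists>f\<in>LipM. f x \<noteq> f y"
      using n by (intro bexI[of _ "\<lambda>z. dist (z n) (y n)"]) auto
  qed (simp_all add: compact_Omega Lip_add Lip_mult Lip_cont)
  show ?thesis
    using Stone_Weierstrass_basic[OF assms] by auto
qed

subsection \<open>The Ruelle operator\<close>

lemma integrable_nu_prepend:
  fixes p :: "(nat \<Rightarrow> 'a) \<Rightarrow> 'c::{banach, second_countable_topology}"
  assumes "cont p"
  shows "integrable \<nu> (\<lambda>a. p (prepend a x))"
  by (rule integrable_continuous_compact_UNIV[OF compact_M nu.finite_measure_axioms sets_nu])
     (rule continuous_on_compose2[OF assms continuous_prepend_left], auto)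

lemma continuous_integral_prepend:
  fixes p :: "(nat \<Rightarrow> 'a) \<Rightarrow> 'c::{banach, second_countable_topology}"
  assumes "cont p"
  shows "cont (\<lambda>x. LINT a|\<nu>. p (prepend a x))"
proof -
  obtain B where B: "B > 0" "\<And>x. norm (p x) \<le> B"
    using cont_bounded[OF assms] by blast
  have "(\<lambda>n. LINT a|\<nu>. p (prepend a (u n))) \<longlonglongrightarrow> (LINT a|\<nu>. p (prepend a x))"
    if "u \<longlonglongrightarrow> x" for u x
  proof (rule integral_dominated_convergence[where w="\<lambda>a. B"])
    show "AE a in \<nu>. (\<lambda>n. p (prepend a (u n))) \<longlonglongrightarrow> p (prepend a x)"
    proof (rule AE_I2)
      fix a
      have "cont (\<lambda>x. p (prepend a x))"
        by (rule continuous_on_compose2[OF assms continuous_prepend_right]) auto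
      then show "(\<lambda>n. p (prepend a (u n))) \<longlonglongrightarrow> p (prepend a x)"
        using that by (simp add: continuous_on_sequentially o_def)
    qed
  next
    show "AE a in \<nu>. norm (p (prepend a (u n))) \<le> B" for n
      by (intro AE_I2 B(2))
  qed (simp_all add: borel_measurable_integrable[OF integrable_nu_prepend[OF assms]])
  then show ?thesis
    by (simp add: continuous_on_sequentially o_def)
qed

lemma integrable_ruelle:
  assumes "cont f" "cont p"
  shows "integrable \<nu> (\<lambda>a. exp (f (prepend a x)) * p (prepend a x) :: real)"
  by (rule integrable_nu_prepend[of "\<lambda>x. exp (f x) * p x"]) (intro continuous_intros assms)

lemma cont_ruelle:
  assumes "cont f" "cont p"
  shows "cont (ruelle_op \<nu> f p)"
  unfolding ruelle_op_def
  by (rule continuous_integral_prepend[of "\<lambda>x. exp (f x) * p x"]) (intro continuous_intros assms)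

lemma ruelle_add:
  assumes "cont f" "cont p" "cont q"
  shows "ruelle_op \<nu> f (\<lambda>x. p x + q x) x = ruelle_op \<nu> f p x + ruelle_op \<nu> f q x"
  unfolding ruelle_op_def using integrable_ruelle assms by (simp add: ring_distribs)

lemma ruelle_diff:
  assumes "cont f" "cont p" "cont q"
  shows "ruelle_op \<nu> f (\<lambda>x. p x - q x) x = ruelle_op \<nu> f p x - ruelle_op \<nu> f q x"
  unfolding ruelle_op_def using integrable_ruelle assms by (simp add: ring_distribs)

lemma ruelle_scale: "ruelle_op \<nu> f (\<lambda>x. c * p x) x = c * ruelle_op \<nu> f p x"
  unfolding ruelle_op_def by (simp add: mult.left_commute[of _ c])

text \<open>The factor \<open>p (seq_shift (prepend a x)) = p x\<close> is constant in
  \<open>a\<close>. This pull-out rule, as for conditional expectations, reduces Birkhoff sums to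
  iterates of the operator.\<close>

lemma ruelle_shift_mult:
  "ruelle_op \<nu> f (\<lambda>x. p (seq_shift x) * q x) x = p x * ruelle_op \<nu> f q x"
  unfolding ruelle_op_def by (simp add: mult.left_commute[of _ "p x"])

lemma ruelle_mono:
  assumes "cont f" "cont p" "cont q" "\<And>x. p x \<le> q x"
  shows "ruelle_op \<nu> f p x \<le> ruelle_op \<nu> f q x"
  unfolding ruelle_op_def using assms
  by (intro integral_mono integrable_ruelle) auto

lemma ruelle_limit:
  assumes "cont f" "\<And>n. cont (p n)" "\<And>n x. \<bar>p n x\<bar> \<le> B" "cont q" "\<And>x. (\<lambda>n. p n x) \<longlonglongrightarrow> q x"
  shows "(\<lambda>n. ruelle_op \<nu> f (p n) x) \<longlonglongrightarrow> ruelle_op \<nu> f q x"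
proof -
  obtain A where A: "A > 0" "\<And>x. \<bar>exp (f x)\<bar> \<le> A"
    using cont_bounded_real[OF continuous_on_exp[OF assms(1)]] by blast
  show ?thesis
    unfolding ruelle_op_def
  proof (rule integral_dominated_convergence[where w="\<lambda>a. A * B"])
    show "AE a in \<nu>. norm (exp (f (prepend a x)) * p n (prepend a x)) \<le> A * B" for n
    proof (rule AE_I2)
      fix a
      have "\<bar>exp (f (prepend a x))\<bar> * \<bar>p n (prepend a x)\<bar> \<le> A * B"
        using A(1) A(2)[of "prepend a x"] assms(3)[of n "prepend a x"] by (intro mult_mono) auto
      then show "norm (exp (f (prepend a x)) * p n (prepend a x)) \<le> A * B"
        by (simp add: abs_mult)
    qed
  next
    show "AE a in \<nu>. (\<lambda>n. exp (f (prepend a x)) * p n (prepend a x))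
        \<longlonglongrightarrow> exp (f (prepend a x)) * q (prepend a x)"
      by (intro AE_I2 tendsto_mult_left assms(5))
  qed (simp_all add: borel_measurable_integrable integrable_ruelle assms(1,2,4))
qed

lemma ruelle_pos:
  assumes "cont f" "cont p" "\<And>x. 0 < p x"
  shows "0 < ruelle_op \<nu> f p x"
proof -
  have "cont (\<lambda>x. exp (f x) * p x)"
    by (intro continuous_intros assms)
  then obtain b where b: "b > 0" "\<And>x. b \<le> exp (f x) * p x"
    using cont_pos_bound[of "\<lambda>x. exp (f x) * p x"] assms(3) by auto
  have "(LINT a|\<nu>. b) \<le> ruelle_op \<nu> f p x"
    unfolding ruelle_op_def by (intro integral_mono integrable_ruelle assms b) auto
  then show ?thesis
    using b nu.prob_space by simp
qed

lemma cont_ruelle_iterate: "cont f \<Longrightarrow> cont p \<Longrightarrow> cont ((ruelle_op \<nu> f ^^ n) p)"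
  by (induction n) (auto intro: cont_ruelle)

lemma ruelle_iterate_pos:
  "cont f \<Longrightarrow> cont p \<Longrightarrow> (\<And>x. 0 < p x) \<Longrightarrow> 0 < (ruelle_op \<nu> f ^^ n) p x"
  by (induction n arbitrary: x) (auto intro: ruelle_pos cont_ruelle_iterate)

lemma ruelle_iterate_diff:
  assumes "cont f" "cont p" "cont q"
  shows "(ruelle_op \<nu> f ^^ n) (\<lambda>x. p x - c * q x) x
    = (ruelle_op \<nu> f ^^ n) p x - c * (ruelle_op \<nu> f ^^ n) q x"
proof (induction n arbitrary: x)
  case (Suc n)
  then have "(ruelle_op \<nu> f ^^ n) (\<lambda>x. p x - c * q x)
      = (\<lambda>x. (ruelle_op \<nu> f ^^ n) p x - c * (ruelle_op \<nu> f ^^ n) q x)"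
    by (rule ext)
  then show ?case
    using assms
    by (simp add: ruelle_diff ruelle_scale cont_ruelle_iterate continuous_on_mult continuous_on_const)
qed simp

end

subsection \<open>Cones of functions of bounded logarithmic variation\<close>

lemma exp_minus_one_le: "exp u - 1 \<le> u * exp (u::real)"
proof -
  have "1 - u \<le> exp (- u)"
    using exp_ge_add_one_self[of "- u"] by simp
  then have "(1 - u) * exp u \<le> exp (- u) * exp u"
    by (rule mult_right_mono) simp
  then show ?thesis
    by (simp add: algebra_simps flip: exp_add)
qed

text \<open>Convexity of \<open>exp\<close> on the segment from \<open>-(K + K') d\<close> to \<open>0\<close>, multiplied by \<open>exp (K d)\<close>.\<close>

lemma exp_diff_ratio:
  fixes K K' d :: real
  assumes "0 \<le> K'" "K' < K" "0 \<le> d"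
  shows "exp (K * d) - exp (- (K' * d)) \<le> (K + K') / (K - K') * (exp (K * d) - exp (K' * d))"
proof -
  define t where "t = (K - K') / (K + K')"
  have t: "0 < t" "t \<le> 1"
    using assms by (auto simp: t_def field_simps)
  have "exp ((1 - t) *\<^sub>R 0 + t *\<^sub>R (- ((K + K') * d))) \<le> (1 - t) * exp 0 + t * exp (- ((K + K') * d))"
    using t by (intro convex_onD[OF exp_convex]) auto
  moreover have "t * ((K + K') * d) = (K - K') * d"
    using assms by (simp add: t_def)
  ultimately have "exp (- ((K - K') * d)) \<le> 1 - t + t * exp (- ((K + K') * d))"
    by simp
  then have "t * (1 - exp (- ((K + K') * d))) \<le> 1 - exp (- ((K - K') * d))"
    by (simp add: algebra_simps)
  then have "exp (K * d) * (t * (1 - exp (- ((K + K') * d)))) \<le> exp (K * d) * (1 - exp (- ((K - K') * d)))"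
    by (rule mult_left_mono) simp
  moreover have "exp (K * d) * exp (- ((K + K') * d)) = exp (- (K' * d))"
    "exp (K * d) * exp (- ((K - K') * d)) = exp (K' * d)"
    by (simp_all add: algebra_simps flip: exp_add)
  ultimately have "t * (exp (K * d) - exp (- (K' * d))) \<le> exp (K * d) - exp (K' * d)"
    by (simp add: algebra_simps)
  then show ?thesis
    using assms by (simp add: t_def field_simps)
qed

context full_shift
begin

text \<open>The positive functions whose logarithm is \<open>K\<close>-Lipschitz, written
  multiplicatively so that the zero function belongs as well.\<close>

definition cone :: "real \<Rightarrow> ((nat \<Rightarrow> 'a) \<Rightarrow> real) set" where
  "cone K = {p. \<forall>x y. 0 \<le> p x \<and> p x \<le> exp (K * D x y) * p y}"

lemma coneI:
  "(\<And>x. 0 \<le> p x) \<Longrightarrow> (\<And>x y. p x \<le> exp (K * D x y) * p y) \<Longrightarrow> p \<in> cone K"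
  unfolding cone_def by blast

lemma cone_nonneg: "p \<in> cone K \<Longrightarrow> 0 \<le> p x"
  unfolding cone_def by blast

lemma cone_le: "p \<in> cone K \<Longrightarrow> p x \<le> exp (K * D x y) * p y"
  unfolding cone_def by blast

lemma cone_mono:
  assumes "p \<in> cone K" "K \<le> K'"
  shows "p \<in> cone K'"
proof (rule coneI)
  show "p x \<le> exp (K' * D x y) * p y" for x y
    using assms(2) cone_nonneg[OF assms(1), of y]
    by (intro order_trans[OF cone_le[OF assms(1), of x y]] mult_right_mono) (auto intro: mult_right_mono)
qed (rule cone_nonneg[OF assms(1)])

lemma cone_le_const:
  assumes "p \<in> cone K" "0 \<le> K"
  shows "p x \<le> exp K * p y"
  using assms(2) cone_nonneg[OF assms(1), of y]
  by (intro order_trans[OF cone_le[OF assms(1), of x y]] mult_right_mono)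
     (auto intro: mult_left_le D_le_1)

lemma cone_const: "0 \<le> c \<Longrightarrow> 0 \<le> K \<Longrightarrow> (\<lambda>x. c) \<in> cone K"
  by (rule coneI) (auto simp: mult_le_cancel_right1)

lemma cone_oscillation:
  assumes p: "p \<in> cone K" and K: "0 \<le> K" and M: "\<And>x. p x \<le> M"
  shows "\<bar>p x - p y\<bar> \<le> K * exp K * M * D x y"
proof -
  have le: "p x - p y \<le> K * exp K * M * D x y" for x y
  proof -
    have "p x - p y \<le> (exp (K * D x y) - 1) * p y"
      using cone_le[OF p, of x y] by (simp add: algebra_simps)
    also have "\<dots> \<le> (K * D x y * exp (K * D x y)) * p y"
      by (intro mult_right_mono exp_minus_one_le cone_nonneg[OF p])
    also have "\<dots> \<le> (K * D x y * exp K) * M"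
      using K cone_nonneg[OF p, of y] M[of y] D_le_1[of x y]
      by (intro mult_mono) (auto intro: mult_left_le)
    finally show ?thesis
      by (simp add: algebra_simps)
  qed
  show ?thesis
    using le[of x y] le[of y x] unfolding D_sym[of y x] by linarith
qed

lemma cone_Lip:
  assumes "p \<in> cone K" "0 \<le> K"
  shows "p \<in> LipM"
  by (rule LipI, rule cone_oscillation[OF assms]) (rule cone_le_const[OF assms])

text \<open>A Lipschitz function enters the cone once it is raised so far that its lower bound
  \<open>m\<close> satisfies \<open>C \<le> K * m\<close>: absolute variation then becomes relative
  variation.\<close>

lemma Lip_cone:
  assumes "\<And>x y. \<bar>p x - p y\<bar> \<le> C * D x y" "0 \<le> K" "0 \<le> m" "C \<le> K * m" "\<And>x. m \<le> p x"
  shows "p \<in> cone K"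
proof (rule coneI)
  show "0 \<le> p x" for x
    using assms(3) assms(5)[of x] by linarith
  show "p x \<le> exp (K * D x y) * p y" for x y
  proof -
    have "p x \<le> p y + C * D x y"
      using assms(1)[of x y] by linarith
    also have "\<dots> \<le> p y + K * p y * D x y"
      using assms(2) assms(5)[of y]
      by (intro add_left_mono mult_right_mono order_trans[OF assms(4)] mult_left_mono) auto
    also have "\<dots> = (1 + K * D x y) * p y"
      by (simp add: algebra_simps)
    also have "\<dots> \<le> exp (K * D x y) * p y"
      using assms(3) assms(5)[of y] by (intro mult_right_mono exp_ge_add_one_self) auto
    finally show ?thesis .
  qed
qed

text \<open>Both functions obey the sharper inequality with \<open>K'\<close>. The slack
  \<open>(exp (K d) - exp (K' d)) * p y\<close> must absorb what subtracting \<open>q\<close> can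
  cost, at most \<open>c * (exp (K d) - exp (- K' d)) * q y\<close>. By
  \<open>exp_diff_ratio\<close> the quotient of the two exponential differences is bounded uniformly
  in \<open>d\<close>, and this bound is the factor demanded in the last assumption.\<close>

lemma cone_diff:
  assumes p: "p \<in> cone K'" and q: "q \<in> cone K'" and K: "0 \<le> K'" "K' < K"
    and c: "0 \<le> c" "\<And>y. c * ((K + K') / (K - K')) * q y \<le> p y"
  shows "(\<lambda>x. p x - c * q x) \<in> cone K"
proof (rule coneI)
  define R where "R = (K + K') / (K - K')"
  have R: "1 \<le> R"
    using K by (simp add: R_def)
  show "0 \<le> p x - c * q x" for x
  proof -
    have "c * q x \<le> c * R * q x"
      using R c(1) cone_nonneg[OF q, of x] mult_right_mono[of 1 R "c * q x"]
      by (simp add: algebra_simps)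
    then show ?thesis
      using c(2)[of x] by (simp add: R_def)
  qed
  show "p x - c * q x \<le> exp (K * D x y) * (p y - c * q y)" for x y
  proof -
    let ?a = "exp (K * D x y)" and ?b = "exp (K' * D x y)" and ?b' = "exp (- (K' * D x y))"
    have "?b' * q y \<le> ?b' * (?b * q x)"
      using cone_le[OF q, of y x] D_sym[of y x] by (intro mult_left_mono) auto
    also have "\<dots> = q x"
      by (simp flip: mult.assoc exp_add)
    finally have "?b' * q y \<le> q x" .
    then have "c * (?a * q y - q x) \<le> c * ((?a - ?b') * q y)"
      using c(1) by (intro mult_left_mono) (auto simp: algebra_simps)
    also have "\<dots> \<le> c * (R * (?a - ?b) * q y)"
      using c(1) exp_diff_ratio[OF K, of "D x y"] cone_nonneg[OF q, of y] unfolding R_def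
      by (intro mult_left_mono mult_right_mono) auto
    also have "\<dots> = (?a - ?b) * (c * R * q y)"
      by simp
    also have "\<dots> \<le> (?a - ?b) * p y"
      using c(2)[of y] K by (intro mult_left_mono) (auto simp: R_def intro: mult_right_mono)
    also have "\<dots> \<le> ?a * p y - p x"
      using cone_le[OF p, of x y] by (simp add: algebra_simps)
    finally show ?thesis
      by (simp add: algebra_simps)
  qed
qed

end

subsection \<open>Contraction of the cone and the eigenfunction\<close>

locale lip_potential = full_shift +
  fixes f :: "(nat \<Rightarrow> 'a) \<Rightarrow> real" and F :: real
  assumes F_nonneg: "0 \<le> F" and F_bound: "\<bar>f x - f y\<bar> \<le> F * seq_dist x y"
begin

abbreviation L :: "((nat \<Rightarrow> 'a) \<Rightarrow> real) \<Rightarrow> (nat \<Rightarrow> 'a) \<Rightarrow> real" where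
  "L \<equiv> ruelle_op \<nu> f"

lemma f_Lip: "f \<in> LipM"
  by (rule LipI[OF F_bound])

lemmas f_cont = Lip_cont[OF f_Lip]

text \<open>\<open>K\<close> has to exceed \<open>F\<close>, also for \<open>F = 0\<close>: then
  \<open>K'\<close>, the cone constant after one application of \<open>L\<close>, is smaller than
  \<open>K\<close> and leaves the room that \<open>cone_diff\<close> uses. \<open>R\<close> is the
  ratio occurring there.\<close>

definition K where "K = 2 * F + 1"
definition K' where "K' = (K + F) / 2"
definition R where "R = (K + K') / (K - K')"
text \<open>The 2 comes from choosing the better of two gaps, \<open>R\<close> from
  \<open>cone_diff\<close>, and \<open>exp (- (2 * K))\<close> from two comparisons of values of
  cone functions at different points.\<close>

definition \<theta> where "\<theta> = 1 - exp (- (2 * K)) / (2 * R)"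

lemma K_facts: "0 \<le> K'" "K' < K" "0 < K" "0 \<le> K" "1 \<le> R" "0 < R"
  using F_nonneg by (auto simp: R_def K'_def K_def field_simps)

lemma theta: "0 \<le> \<theta>" "\<theta> < 1"
proof -
  have "exp (- (2 * K)) \<le> 1"
    using K_facts by simp
  also have "1 \<le> 2 * R"
    using K_facts by simp
  finally show "0 \<le> \<theta>"
    using K_facts by (simp add: \<theta>_def)
  show "\<theta> < 1"
    using K_facts by (simp add: \<theta>_def)
qed

lemma cone_cont: "p \<in> cone K \<Longrightarrow> cont p"
  using Lip_cont cone_Lip K_facts by blast

text \<open>After prepending, points at distance \<open>d\<close> are \<open>d / 2\<close> apart, so
  \<open>p\<close> contributes \<open>K d / 2\<close> and \<open>f\<close> contributes
  \<open>F d / 2\<close> to the exponent, together \<open>K' d\<close>.\<close>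

lemma ruelle_cone:
  assumes p: "p \<in> cone K"
  shows "L p \<in> cone K'"
proof (rule coneI)
  note [simp] = integrable_ruelle[OF f_cont cone_cont[OF p]]
  show "0 \<le> L p x" for x
    unfolding ruelle_op_def by (intro Bochner_Integration.integral_nonneg) (simp add: cone_nonneg[OF p])
  show "L p x \<le> exp (K' * D x y) * L p y" for x y
  proof -
    have "L p x \<le> (LINT a|\<nu>. exp (K' * D x y) * (exp (f (prepend a y)) * p (prepend a y)))"
      unfolding ruelle_op_def
    proof (intro integral_mono)
      fix a
      have "f (prepend a x) \<le> f (prepend a y) + F * (D x y / 2)"
        using F_bound[of "prepend a x" "prepend a y"] unfolding D_prepend by linarith
      then have "exp (f (prepend a x)) * p (prepend a x)
          \<le> exp (f (prepend a y) + F * (D x y / 2)) * (exp (K * (D x y / 2)) * p (prepend a y))"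
        using cone_le[OF p, of "prepend a x" "prepend a y"] cone_nonneg[OF p] D_prepend[of a x y]
        by (intro mult_mono) auto
      also have "\<dots> = exp (K' * D x y) * (exp (f (prepend a y)) * p (prepend a y))"
        by (simp add: exp_add K'_def algebra_simps add_divide_distrib)
      finally show "exp (f (prepend a x)) * p (prepend a x)
          \<le> exp (K' * D x y) * (exp (f (prepend a y)) * p (prepend a y))" .
    qed auto
    then show ?thesis
      by (simp add: ruelle_op_def)
  qed
qed

text \<open>One of the two gaps \<open>p - \<alpha> q\<close> and \<open>\<beta> q - p\<close> has an image of size at least half of
  \<open>(\<beta> - \<alpha>) L q\<close> somewhere, hence up to a constant everywhere, and leaves room to move
  \<open>\<alpha>\<close> or \<open>\<beta>\<close>.\<close>

lemma cone_contraction: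
  assumes q: "q \<in> cone K" and p: "cont p"
    and \<alpha>: "(\<lambda>x. p x - \<alpha> * q x) \<in> cone K" and \<beta>: "(\<lambda>x. \<beta> * q x - p x) \<in> cone K"
    and "\<alpha> \<le> \<beta>"
  shows "\<exists>\<alpha>' \<beta>'. \<alpha>' \<le> \<beta>' \<and> \<beta>' - \<alpha>' \<le> \<theta> * (\<beta> - \<alpha>) \<and>
    (\<lambda>x. L p x - \<alpha>' * L q x) \<in> cone K \<and> (\<lambda>x. \<beta>' * L q x - L p x) \<in> cone K"
proof -
  define A where "A x = L p x - \<alpha> * L q x" for x
  define B where "B x = \<beta> * L q x - L p x" for x
  note cq = cone_cont[OF q]
  have Lq: "L q \<in> cone K'"
    by (rule ruelle_cone[OF q])
  have "A = L (\<lambda>x. p x - \<alpha> * q x)"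
    unfolding A_def by (intro ext) (simp add: ruelle_diff ruelle_scale f_cont p cq continuous_on_mult)
  then have A: "A \<in> cone K'"
    using ruelle_cone[OF \<alpha>] by simp
  have "B = L (\<lambda>x. \<beta> * q x - p x)"
    unfolding B_def by (intro ext) (simp add: ruelle_diff ruelle_scale f_cont p cq continuous_on_mult)
  then have B: "B \<in> cone K'"
    using ruelle_cone[OF \<beta>] by simp
  define c where "c = (\<beta> - \<alpha>) * (exp (- (2 * K)) / (2 * R))"
  have c: "0 \<le> c" "\<beta> - \<alpha> - c = \<theta> * (\<beta> - \<alpha>)" "c \<le> \<beta> - \<alpha>"
    using \<open>\<alpha> \<le> \<beta>\<close> K_facts theta(1) mult_nonneg_nonneg[OF theta(1), of "\<beta> - \<alpha>"]
    by (auto simp: c_def \<theta>_def algebra_simps)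
  have room: "(\<lambda>x. E x - c * L q x) \<in> cone K"
    if E: "E \<in> cone K'" and "(\<beta> - \<alpha>) / 2 * L q z \<le> E z" for E z
  proof (rule cone_diff[OF E Lq K_facts(1,2) c(1)])
    fix y
    have exp_K: "exp (- (2 * K)) * exp K = exp (- K)"
      by (simp flip: exp_add)
    \<comment> \<open>Move \<open>L q\<close> from \<open>y\<close> to \<open>z\<close> and
      \<open>E\<close> back from \<open>z\<close> to \<open>y\<close>; each move costs a factor
      \<open>exp K\<close>, and \<open>c\<close> was chosen to pay for both.\<close>
    have "c * ((K + K') / (K - K')) * L q y = (\<beta> - \<alpha>) / 2 * (exp (- (2 * K)) * L q y)"
      unfolding R_def[symmetric] c_def using K_facts by simp
    also have "\<dots> \<le> (\<beta> - \<alpha>) / 2 * (exp (- (2 * K)) * (exp K * L q z))"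
      using \<open>\<alpha> \<le> \<beta>\<close> K_facts cone_mono[OF Lq, of K]
      by (intro mult_left_mono cone_le_const) auto
    also have "\<dots> = exp (- K) * ((\<beta> - \<alpha>) / 2 * L q z)"
      unfolding exp_K[symmetric] by (simp only: mult_ac)
    also have "\<dots> \<le> exp (- K) * (exp K * E y)"
      using K_facts cone_mono[OF E, of K]
      by (intro mult_left_mono order_trans[OF that(2)] cone_le_const) auto
    also have "\<dots> = E y"
      by (simp flip: mult.assoc exp_add)
    finally show "c * ((K + K') / (K - K')) * L q y \<le> E y" .
  qed
  \<comment> \<open>Any point will do, since \<open>room\<close> needs its inequality at one point
    only. The two gaps add up to \<open>(\<beta> - \<alpha>) * L q z\<close>, so one of them is at
    least half of it.\<close>
  define z :: "nat \<Rightarrow> 'a" where "z = undefined"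
  have "A z + B z = (\<beta> - \<alpha>) * L q z"
    by (simp add: A_def B_def algebra_simps)
  then consider "(\<beta> - \<alpha>) / 2 * L q z \<le> A z" | "(\<beta> - \<alpha>) / 2 * L q z \<le> B z"
    by fastforce
  then show ?thesis
  proof cases
    case 1
    from room[OF A this] have "(\<lambda>x. L p x - (\<alpha> + c) * L q x) \<in> cone K"
      by (simp add: A_def algebra_simps)
    moreover have "(\<lambda>x. \<beta> * L q x - L p x) \<in> cone K"
      using cone_mono[OF B, of K] K_facts by (simp add: B_def[abs_def])
    ultimately show ?thesis
      using c by (intro exI[of _ "\<alpha> + c"] exI[of _ \<beta>]) (auto simp: algebra_simps)
  next
    case 2
    from room[OF B this] have "(\<lambda>x. (\<beta> - c) * L q x - L p x) \<in> cone K"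
      by (simp add: B_def algebra_simps)
    moreover have "(\<lambda>x. L p x - \<alpha> * L q x) \<in> cone K"
      using cone_mono[OF A, of K] K_facts by (simp add: A_def[abs_def])
    ultimately show ?thesis
      using c by (intro exI[of _ \<alpha>] exI[of _ "\<beta> - c"]) (auto simp: algebra_simps)
  qed
qed

lemma ruelle_iterate_cone: "q \<in> cone K \<Longrightarrow> (L ^^ n) q \<in> cone K"
  using K_facts by (induction n) (auto intro: cone_mono[OF ruelle_cone])

lemma cone_contraction_iterate:
  assumes q: "q \<in> cone K" and p: "cont p"
    and \<alpha>: "(\<lambda>x. p x - \<alpha> * q x) \<in> cone K" and \<beta>: "(\<lambda>x. \<beta> * q x - p x) \<in> cone K"
    and "\<alpha> \<le> \<beta>"
  shows "\<exists>\<alpha>' \<beta>'. \<alpha>' \<le> \<beta>' \<and> \<beta>' - \<alpha>' \<le> \<theta> ^ n * (\<beta> - \<alpha>) \<and>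
    (\<lambda>x. (L ^^ n) p x - \<alpha>' * (L ^^ n) q x) \<in> cone K \<and>
    (\<lambda>x. \<beta>' * (L ^^ n) q x - (L ^^ n) p x) \<in> cone K"
proof (induction n)
  case 0
  then show ?case
    using assms by (intro exI[of _ \<alpha>] exI[of _ \<beta>]) auto
next
  case (Suc n)
  then obtain a b where ab: "a \<le> b" "b - a \<le> \<theta> ^ n * (\<beta> - \<alpha>)"
    "(\<lambda>x. (L ^^ n) p x - a * (L ^^ n) q x) \<in> cone K"
    "(\<lambda>x. b * (L ^^ n) q x - (L ^^ n) p x) \<in> cone K"
    by blast
  from cone_contraction[OF ruelle_iterate_cone[OF q] cont_ruelle_iterate[OF f_cont p] ab(3,4,1)]
  obtain a' b' where "a' \<le> b'" "b' - a' \<le> \<theta> * (b - a)"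
    "(\<lambda>x. (L ^^ Suc n) p x - a' * (L ^^ Suc n) q x) \<in> cone K"
    "(\<lambda>x. b' * (L ^^ Suc n) q x - (L ^^ Suc n) p x) \<in> cone K"
    by auto
  moreover have "\<theta> * (b - a) \<le> \<theta> ^ Suc n * (\<beta> - \<alpha>)"
    using mult_left_mono[OF ab(2) theta(1)] by (simp add: mult.assoc)
  ultimately show ?case
    by (meson order_trans)
qed

text \<open>Iterates the contraction with \<open>q = 1\<close>, starting from the bounds 0 and
  \<open>R * b\<close>. The factor \<open>R\<close> is what \<open>cone_diff\<close> asks for in
  order to place the upper gap \<open>R * b - p\<close> in the cone.\<close>

lemma cone_iterate_ratio:
  assumes p: "p \<in> cone K'" and b: "\<And>x. p x \<le> b"
  shows "\<exists>\<alpha>' \<beta>'. \<beta>' - \<alpha>' \<le> \<theta> ^ n * (R * b) \<and>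
    (\<forall>x. \<alpha>' * (L ^^ n) (\<lambda>x. 1) x \<le> (L ^^ n) p x \<and> (L ^^ n) p x \<le> \<beta>' * (L ^^ n) (\<lambda>x. 1) x)"
proof -
  have one: "(\<lambda>x. 1) \<in> cone K'" "(\<lambda>x. 1) \<in> cone K"
    using K_facts by (auto intro: cone_const)
  have b0: "0 \<le> b"
    using b[of undefined] cone_nonneg[OF p, of undefined] by linarith
  have p': "(\<lambda>x. p x - 0 * 1) \<in> cone K"
    using cone_mono[OF p, of K] K_facts by simp
  have "(\<lambda>x. R * b - 1 * p x) \<in> cone K"
  proof (rule cone_diff[OF _ p K_facts(1,2)])
    show "(\<lambda>x. R * b) \<in> cone K'"
      using K_facts b0 by (intro cone_const) auto
    show "1 * ((K + K') / (K - K')) * p y \<le> R * b" for y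
      unfolding R_def[symmetric] using b[of y] K_facts by simp
  qed simp
  then have q': "(\<lambda>x. R * b * 1 - p x) \<in> cone K"
    by simp
  have "0 \<le> R * b"
    using b0 K_facts by simp
  moreover have "cont p"
    using cone_cont[of p] p' by simp
  ultimately obtain a' b' where ab: "b' - a' \<le> \<theta> ^ n * (R * b - 0)"
    and a': "(\<lambda>x. (L ^^ n) p x - a' * (L ^^ n) (\<lambda>x. 1) x) \<in> cone K"
    and b': "(\<lambda>x. b' * (L ^^ n) (\<lambda>x. 1) x - (L ^^ n) p x) \<in> cone K"
    using cone_contraction_iterate[OF one(2) _ p' q', of n] by blast
  show ?thesis
    using ab cone_nonneg[OF a'] cone_nonneg[OF b'] by (intro exI[of _ a'] exI[of _ b']) auto
qed

lemma ruelle_iterate_scale: "(L ^^ n) (\<lambda>x. c * p x) = (\<lambda>x. c * (L ^^ n) p x)"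
  by (induction n) (auto simp: ruelle_scale)

lemma ruelle_iterate_mono:
  "cont p \<Longrightarrow> cont q \<Longrightarrow> (\<And>x. p x \<le> q x) \<Longrightarrow> (L ^^ n) p x \<le> (L ^^ n) q x"
  by (induction n arbitrary: x) (auto intro: ruelle_mono cont_ruelle_iterate f_cont)

text \<open>Iterates of 1, normalized at a base point \<open>z\<close>, form a Cauchy sequence:
  \<open>v (n + m) / v n\<close> equals \<open>r / r z\<close>, where \<open>r\<close> is the ratio
  of \<open>L\<^sup>n (v m)\<close> to \<open>L\<^sup>n 1\<close>, and by the cone contraction
  \<open>r\<close> oscillates by at most a multiple of \<open>\<theta>\<^sup>n\<close>. The cone
  bounds survive the limit and keep it positive.\<close>

theorem eigenfunction_exists:
  "\<exists>c w. c > 0 \<and> w \<in> LipM \<and> (\<forall>x. w x > 0) \<and> (\<forall>x. L w x = c * w x)"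
proof -
  define z :: "nat \<Rightarrow> 'a" where "z = undefined"
  define G where "G n = (L ^^ n) (\<lambda>x. 1)" for n
  define v where "v n x = G n x / G n z" for n x
  have one: "(\<lambda>x. 1) \<in> cone K"
    using K_facts by (auto intro: cone_const)
  have G_pos: "0 < G n x" for n x
    unfolding G_def by (rule ruelle_iterate_pos) (auto simp: f_cont)
  have G_cone: "G n \<in> cone K" for n
    unfolding G_def by (rule ruelle_iterate_cone[OF one])
  have v_cone: "v n \<in> cone K" for n
    using G_pos[of n z] cone_nonneg[OF G_cone[of n]] cone_le[OF G_cone[of n]]
    unfolding v_def by (intro coneI) (auto simp: field_simps)
  have v_z: "v n z = 1" for n
    using G_pos[of n z] by (simp add: v_def)
  have v_le: "v n x \<le> exp K" for n x
    using cone_le_const[OF v_cone K_facts(4), of n x z] by (simp add: v_z)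
  have v_ge: "exp (- K) \<le> v n x" for n x
    using cone_le_const[OF v_cone K_facts(4), of n z x] by (simp add: v_z exp_minus field_simps)
  \<comment> \<open>\<open>cone_iterate_ratio\<close> wants its argument in the smaller cone, which
    one application of \<open>L\<close> provides; hence \<open>n > 0\<close>.\<close>
  have v_cone': "v n \<in> cone K'" if pos: "n > 0" for n
  proof -
    obtain m where m: "n = Suc m"
      using pos by (cases n) auto
    have "G n = L (G m)"
      by (simp add: G_def m)
    then have "G n \<in> cone K'"
      using ruelle_cone[OF G_cone] by simp
    then show ?thesis
      using G_pos[of n z] cone_nonneg[of "G n" K'] cone_le[of "G n" K']
      unfolding v_def by (intro coneI) (auto simp: field_simps)
  qed
  have cauchy_step: "\<bar>v (n + m) x - v n x\<bar> \<le> \<theta> ^ n * (exp K * exp K * (R * exp K))" if pos: "m > 0" for n m x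
  proof -
    obtain a b where ab: "b - a \<le> \<theta> ^ n * (R * exp K)"
      "\<And>x. a * G n x \<le> (L ^^ n) (v m) x" "\<And>x. (L ^^ n) (v m) x \<le> b * G n x"
      using cone_iterate_ratio[OF v_cone'[OF pos], of "exp K" n] v_le unfolding G_def by blast
    define r where "r x = (L ^^ n) (v m) x / G n x" for x
    have r: "a \<le> r x" "r x \<le> b" for x
      using ab(2,3)[of x] G_pos[of n x] by (auto simp: r_def field_simps)
    have "exp (- K) * G n z = (L ^^ n) (\<lambda>x. exp (- K) * 1) z"
      unfolding ruelle_iterate_scale by (simp add: G_def)
    also have "\<dots> \<le> (L ^^ n) (v m) z"
      using v_ge by (intro ruelle_iterate_mono cone_cont[OF v_cone]) auto
    finally have r_z: "exp (- K) \<le> r z"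
      using G_pos[of n z] by (simp add: r_def field_simps)
    have "v m = (\<lambda>x. 1 / G m z * G m x)"
      by (simp add: v_def[abs_def])
    then have "(L ^^ n) (v m) = (\<lambda>x. 1 / G m z * (L ^^ n) (G m) x)"
      by (simp only: ruelle_iterate_scale)
    moreover have "(L ^^ n) (G m) = G (n + m)"
      by (simp add: G_def funpow_add)
    ultimately have "r x = G (n + m) x / (G m z * G n x)" for x
      by (simp add: r_def)
    then have "G (n + m) x = r x * (G m z * G n x)" for x
      using G_pos[of m z] G_pos[of n x] by simp
    then have "v (n + m) x = v n x * (r x / r z)"
      using G_pos[of m z] by (simp add: v_def mult_ac)
    moreover have r_z': "0 < r z"
      using order.strict_trans2[OF exp_gt_zero r_z] .
    ultimately have "v (n + m) x - v n x = v n x * ((r x - r z) / r z)"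
      by (simp add: field_simps)
    then have "\<bar>v (n + m) x - v n x\<bar> = v n x * (\<bar>r x - r z\<bar> / r z)"
      using r_z' cone_nonneg[OF v_cone, of n x] by (simp add: abs_mult)
    also have "\<dots> \<le> exp K * (\<theta> ^ n * (R * exp K) / exp (- K))"
    proof (rule mult_mono)
      have "\<bar>r x - r z\<bar> \<le> \<theta> ^ n * (R * exp K)"
        using r[of x] r[of z] ab(1) by linarith
      then show "\<bar>r x - r z\<bar> / r z \<le> \<theta> ^ n * (R * exp K) / exp (- K)"
        using r_z theta K_facts by (intro frac_le) auto
    qed (use r_z' v_le in auto)
    finally show ?thesis
      by (simp add: exp_minus field_simps)
  qed
  have cau: "Cauchy (\<lambda>n. v n x)" for x
  proof (rule CauchyI)
    fix e :: real assume "e > 0"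
    define C where "C = exp K * exp K * (R * exp K)"
    have "C > 0"
      using K_facts by (simp add: C_def)
    have "(\<lambda>n. \<theta> ^ n * C) \<longlonglongrightarrow> 0 * C"
      using theta by (intro tendsto_intros LIMSEQ_power_zero) auto
    then have "eventually (\<lambda>n. \<theta> ^ n * C < e / 2) sequentially"
      using \<open>e > 0\<close> by (intro order_tendstoD(2)) auto
    then obtain M where M: "\<theta> ^ M * C < e / 2"
      by (auto simp: eventually_sequentially)
    have *: "\<bar>v n x - v M x\<bar> < e / 2" if "M \<le> n" for n
    proof (cases "n = M")
      case False
      then have "\<bar>v (M + (n - M)) x - v M x\<bar> \<le> \<theta> ^ M * C"
        using that unfolding C_def by (intro cauchy_step) auto
      then show ?thesis
        using M that by simp
    qed (use \<open>e > 0\<close> in simp)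
    show "\<exists>M. \<forall>m\<ge>M. \<forall>n\<ge>M. norm (v m x - v n x) < e"
    proof (intro exI[of _ M] allI impI)
      fix m n assume "M \<le> m" "M \<le> n"
      from *[OF this(1)] *[OF this(2)] show "norm (v m x - v n x) < e"
        by (simp add: abs_if split: if_splits)
    qed
  qed
  define w where "w x = lim (\<lambda>n. v n x)" for x
  have w: "(\<lambda>n. v n x) \<longlonglongrightarrow> w x" for x
    using cau[of x] unfolding w_def by (simp add: Cauchy_convergent_iff convergent_LIMSEQ_iff)
  have w_ge: "exp (- K) \<le> w x" for x
    by (rule LIMSEQ_le_const[OF w]) (use v_ge in blast)
  have w_cone: "w \<in> cone K"
  proof (rule coneI)
    show "0 \<le> w x" for x
      using order_trans[OF less_imp_le[OF exp_gt_zero] w_ge] .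
    show "w x \<le> exp (K * D x y) * w y" for x y
      by (rule LIMSEQ_le[OF w tendsto_mult_left[OF w]]) (use cone_le[OF v_cone] in blast)
  qed
  have "\<bar>v n x\<bar> \<le> exp K" for n x
    using v_le[of n x] cone_nonneg[OF v_cone, of n x] by simp
  then have lim_L: "(\<lambda>n. L (v n) x) \<longlonglongrightarrow> L w x" for x
    by (intro ruelle_limit[OF f_cont _ _ cone_cont[OF w_cone] w] cone_cont[OF v_cone])
  \<comment> \<open>Up to a scalar, \<open>L (v n)\<close> is \<open>v (Suc n)\<close>; as the
    latter equals 1 at \<open>z\<close>, the scalar is \<open>L (v n) z\<close>. Its limit is the
    eigenvalue.\<close>
  have L_v: "L (v n) x = L (v n) z * v (Suc n) x" for n x
  proof -
    have "L (v n) y = G (Suc n) y / G n z" for y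
    proof -
      have "L (v n) y = L (\<lambda>x. 1 / G n z * G n x) y"
        by (simp add: v_def[abs_def])
      also have "\<dots> = 1 / G n z * L (G n) y"
        by (rule ruelle_scale)
      finally show ?thesis
        by (simp add: G_def)
    qed
    then show ?thesis
      using G_pos[of "Suc n" z] by (simp add: v_def)
  qed
  have "L w x = L w z * w x" for x
  proof (rule LIMSEQ_unique[OF lim_L])
    show "(\<lambda>n. L (v n) x) \<longlonglongrightarrow> L w z * w x"
      unfolding L_v[of _ x] by (intro tendsto_mult lim_L LIMSEQ_Suc[OF w])
  qed
  moreover have w_pos: "0 < w x" for x
    using order.strict_trans2[OF exp_gt_zero w_ge] .
  moreover have "0 < L w z"
    by (rule ruelle_pos[OF f_cont cone_cont[OF w_cone] w_pos])
  ultimately show ?thesis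
    using cone_Lip[OF w_cone] K_facts by blast
qed

end

subsection \<open>Normalized potentials\<close>

locale markov_potential = lip_potential +
  assumes ruelle_one: "ruelle_op \<nu> f (\<lambda>x. 1) x = 1"
begin

lemma ruelle_const [simp]: "L (\<lambda>x. c) = (\<lambda>x. c)"
  using ruelle_scale[of f c "\<lambda>x. 1"] ruelle_one by auto

lemma ruelle_iterate_const [simp]: "(L ^^ n) (\<lambda>x. c) = (\<lambda>x. c)"
  by (induction n) auto

lemma ruelle_iterate_bounds:
  assumes "cont p" "\<And>x. a \<le> p x" "\<And>x. p x \<le> b"
  shows "a \<le> (L ^^ n) p x" "(L ^^ n) p x \<le> b"
  using ruelle_iterate_mono[of "\<lambda>x. a" p n x] ruelle_iterate_mono[of p "\<lambda>x. b" n x] assms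
  by auto

lemma ruelle_iterate_close:
  assumes "cont p" "cont q" "\<And>x. \<bar>p x - q x\<bar> \<le> e"
  shows "\<bar>(L ^^ n) p x - (L ^^ n) q x\<bar> \<le> e"
proof -
  have "cont (\<lambda>x. p x - 1 * q x)"
    by (intro continuous_intros assms)
  moreover have "- e \<le> p y - 1 * q y" "p y - 1 * q y \<le> e" for y
    using assms(3)[of y] by auto
  ultimately have "- e \<le> (L ^^ n) (\<lambda>x. p x - 1 * q x) x" "(L ^^ n) (\<lambda>x. p x - 1 * q x) x \<le> e"
    by (blast intro: ruelle_iterate_bounds)+
  then show ?thesis
    unfolding ruelle_iterate_diff[OF f_cont assms(1,2)] by simp
qed

text \<open>Compare \<open>p\<close> with constants, which \<open>L\<close> fixes: the gaps to a
  lower and an upper constant stay in the cone while their distance shrinks by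
  \<open>\<theta>\<close> in each step. Cone membership turns small size into small Lipschitz
  constant, which gives the second estimate; it is what makes solutions of the Poisson equation
  Lipschitz.\<close>

theorem spectral_gap:
  assumes "p \<in> LipM"
  shows "\<exists>C\<ge>0. \<exists>l. \<forall>n x y. \<bar>(L ^^ n) p x - l\<bar> \<le> C * \<theta> ^ n \<and>
    \<bar>(L ^^ n) p x - (L ^^ n) p y\<bar> \<le> C * \<theta> ^ n * D x y"
proof -
  obtain H where H: "0 \<le> H" "\<And>x y. \<bar>p x - p y\<bar> \<le> H * D x y"
    using Lip_bound[OF assms] by blast
  note cp = Lip_cont[OF assms]
  obtain B where B: "B > 0" "\<And>x. \<bar>p x\<bar> \<le> B"
    using cont_bounded_real[OF cp] by blast
  \<comment> \<open>The margin \<open>H / K\<close> is the lower bound that \<open>Lip_cone\<close>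
    requires of both gaps.\<close>
  define b where "b = B + H / K"
  have b: "0 \<le> b"
    using B(1) H(1) K_facts by (simp add: b_def)
  have "(\<lambda>x. p x - - b * 1) \<in> cone K"
  proof (rule Lip_cone[where C=H and m="H / K"])
    show "H / K \<le> p x - - b * 1" for x
      using B(2)[of x] by (auto simp: b_def)
    show "\<bar>p x - - b * 1 - (p y - - b * 1)\<bar> \<le> H * D x y" for x y
      using H(2)[of x y] by simp
  qed (use K_facts H(1) in auto)
  moreover have "(\<lambda>x. b * 1 - p x) \<in> cone K"
  proof (rule Lip_cone[where C=H and m="H / K"])
    show "H / K \<le> b * 1 - p x" for x
      using B(2)[of x] by (auto simp: b_def)
    show "\<bar>b * 1 - p x - (b * 1 - p y)\<bar> \<le> H * D x y" for x y
      using H(2)[of y x] D_sym[of y x] by simp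
  qed (use K_facts H(1) in auto)
  moreover have "(\<lambda>x. 1) \<in> cone K"
    using K_facts by (auto intro: cone_const)
  note cones = this calculation
  define Q where "Q n \<alpha>' \<beta>' \<longleftrightarrow> \<beta>' - \<alpha>' \<le> \<theta> ^ n * (b + b) \<and>
      (\<lambda>x. (L ^^ n) p x - \<alpha>') \<in> cone K \<and> (\<lambda>x. \<beta>' - (L ^^ n) p x) \<in> cone K" for n \<alpha>' \<beta>'
  have "\<exists>\<alpha>' \<beta>'. Q n \<alpha>' \<beta>'" for n
  proof -
    have "- b \<le> b"
      using b by simp
    from cone_contraction_iterate[OF cones(1) cp cones(2,3) this, of n]
    show ?thesis
      unfolding ruelle_iterate_const Q_def by simp blast
  qed
  then obtain \<alpha>' \<beta>' where "\<And>n. Q n (\<alpha>' n) (\<beta>' n)"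
    by metis
  then have ab: "\<And>n. \<beta>' n - \<alpha>' n \<le> \<theta> ^ n * (b + b)"
    "\<And>n. (\<lambda>x. (L ^^ n) p x - \<alpha>' n) \<in> cone K" "\<And>n. (\<lambda>x. \<beta>' n - (L ^^ n) p x) \<in> cone K"
    unfolding Q_def by blast+
  \<comment> \<open>Later iterates remain between the bounds found at time \<open>n\<close>, because
    \<open>L\<close> preserves order and constants.\<close>
  have range: "\<alpha>' n \<le> (L ^^ (m + n)) p x" "(L ^^ (m + n)) p x \<le> \<beta>' n" for m n x
    using ruelle_iterate_bounds[OF cont_ruelle_iterate[OF f_cont cp], of "\<alpha>' n" n "\<beta>' n" m x]
      cone_nonneg[OF ab(2)[of n]] cone_nonneg[OF ab(3)[of n]]
    by (simp_all add: funpow_add)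
  have close: "\<bar>(L ^^ n) p x - (L ^^ (m + n)) p y\<bar> \<le> \<theta> ^ n * (b + b)" for m n x y
    using range(1)[of n 0 x] range(2)[of 0 n x] ab(1)[of n] range(1)[of n m y] range(2)[of m n y]
    by simp
  define z :: "nat \<Rightarrow> 'a" where "z = undefined"
  have pow: "(\<lambda>n. \<theta> ^ n * (b + b)) \<longlonglongrightarrow> 0"
    using theta by (intro tendsto_mult_left_zero LIMSEQ_power_zero) auto
  have "Cauchy (\<lambda>n. (L ^^ n) p z)"
  proof (rule CauchyI')
    fix e :: real assume "e > 0"
    then have "eventually (\<lambda>n. \<theta> ^ n * (b + b) < e) sequentially"
      using pow by (rule order_tendstoD(2)[rotated])
    then obtain M where M: "\<And>n. M \<le> n \<Longrightarrow> \<theta> ^ n * (b + b) < e"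
      by (auto simp: eventually_sequentially)
    show "\<exists>M. \<forall>m\<ge>M. \<forall>n>m. dist ((L ^^ m) p z) ((L ^^ n) p z) < e"
    proof (intro exI allI impI)
      fix m n assume "M \<le> m" "m < n"
      then show "dist ((L ^^ m) p z) ((L ^^ n) p z) < e"
        using close[of m z "n - m" z] M[of m] by (simp add: dist_real_def)
    qed
  qed
  then obtain l where l: "(\<lambda>n. (L ^^ n) p z) \<longlonglongrightarrow> l"
    by (auto simp: Cauchy_convergent_iff convergent_def)
  define C where "C = (b + b) * (1 + K * exp K)"
  have "\<bar>(L ^^ n) p x - l\<bar> \<le> \<theta> ^ n * (b + b)" for n x
  proof (rule LIMSEQ_le_const2)
    show "(\<lambda>m. \<bar>(L ^^ n) p x - (L ^^ (m + n)) p z\<bar>) \<longlonglongrightarrow> \<bar>(L ^^ n) p x - l\<bar>"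
      by (intro tendsto_intros LIMSEQ_ignore_initial_segment[OF l])
  qed (use close in blast)
  moreover have bC: "\<theta> ^ n * (b + b) \<le> C * \<theta> ^ n" for n
    using b theta K_facts by (simp add: C_def algebra_simps)
  ultimately have 1: "\<bar>(L ^^ n) p x - l\<bar> \<le> C * \<theta> ^ n" for n x
    by (meson order_trans)
  have 2: "\<bar>(L ^^ n) p x - (L ^^ n) p y\<bar> \<le> C * \<theta> ^ n * D x y" for n x y
  proof -
    have "(L ^^ n) p x - \<alpha>' n \<le> \<theta> ^ n * (b + b)" for x
      using range(2)[of 0 n x] ab(1)[of n] by simp
    from cone_oscillation[OF ab(2)[of n] K_facts(4) this, of x y]
    have "\<bar>(L ^^ n) p x - (L ^^ n) p y\<bar> \<le> K * exp K * (\<theta> ^ n * (b + b)) * D x y"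
      by simp
    also have "\<dots> \<le> C * \<theta> ^ n * D x y"
      using b theta K_facts by (intro mult_right_mono) (auto simp: C_def algebra_simps)
    finally show ?thesis .
  qed
  have "0 \<le> C"
    using b K_facts by (simp add: C_def)
  with 1 2 show ?thesis
    by blast
qed

text \<open>Approximation by Lipschitz functions: the iterates of a Markov operator do not increase
  uniform distances, so the limit persists although the rate is lost.\<close>

lemma ruelle_iterate_convergent:
  assumes "cont p"
  shows "\<exists>l. \<forall>x. (\<lambda>n. (L ^^ n) p x) \<longlonglongrightarrow> l"
proof -
  have main: "\<exists>M. \<forall>m\<ge>M. \<forall>n\<ge>M. \<bar>(L ^^ m) p x - (L ^^ n) p y\<bar> < e" if "e > 0" for x y e
  proof -
    obtain q where q: "q \<in> LipM" "\<And>x. \<bar>p x - q x\<bar> < e / 4"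
      using Lip_approx[OF assms, of "e / 4"] \<open>e > 0\<close> by auto
    obtain C l where C: "\<And>n x. \<bar>(L ^^ n) q x - l\<bar> \<le> C * \<theta> ^ n"
      using spectral_gap[OF q(1)] by blast
    have "(\<lambda>n. C * \<theta> ^ n) \<longlonglongrightarrow> 0"
      using theta by (intro tendsto_mult_right_zero LIMSEQ_power_zero) auto
    then have "eventually (\<lambda>n. C * \<theta> ^ n < e / 4) sequentially"
      using \<open>e > 0\<close> by (intro order_tendstoD(2)) auto
    then obtain M where M: "\<And>n. M \<le> n \<Longrightarrow> C * \<theta> ^ n < e / 4"
      by (auto simp: eventually_sequentially)
    have "\<bar>(L ^^ n) p x - l\<bar> < e / 2" if "M \<le> n" for n x
      using ruelle_iterate_close[OF assms Lip_cont[OF q(1)] less_imp_le[OF q(2)], of n x]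
        C[of n x] M[OF that] by linarith
    note * = this
    show ?thesis
    proof (intro exI allI impI)
      fix m n assume "M \<le> m" "M \<le> n"
      from *[OF this(1), of x] *[OF this(2), of y]
      show "\<bar>(L ^^ m) p x - (L ^^ n) p y\<bar> < e" by linarith
    qed
  qed
  have "Cauchy (\<lambda>n. (L ^^ n) p x)" for x
    by (rule CauchyI) (unfold real_norm_def, use main[of _ x x] in blast)
  then have "convergent (\<lambda>n. (L ^^ n) p x)" for x
    by (simp add: Cauchy_convergent_iff)
  then obtain l where l: "\<And>x. (\<lambda>n. (L ^^ n) p x) \<longlonglongrightarrow> l x"
    unfolding convergent_def by metis
  have "l x = l y" for x y
  proof -
    have "\<bar>l x - l y\<bar> \<le> e" if "e > 0" for e
    proof -
      obtain M where M: "\<And>m n. M \<le> m \<Longrightarrow> M \<le> n \<Longrightarrow> \<bar>(L ^^ m) p x - (L ^^ n) p y\<bar> < e"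
        using main[OF \<open>e > 0\<close>, of x y] by blast
      have "(\<lambda>n. \<bar>(L ^^ n) p x - (L ^^ n) p y\<bar>) \<longlonglongrightarrow> \<bar>l x - l y\<bar>"
        by (intro tendsto_intros l)
      then show ?thesis
        by (rule LIMSEQ_le_const2) (use M in \<open>auto intro: less_imp_le\<close>)
    qed
    then have "\<bar>l x - l y\<bar> \<le> 0"
      by (rule field_le_epsilon) simp
    then show ?thesis by simp
  qed
  then show ?thesis
    using l by metis
qed

text \<open>\<open>undefined\<close> is an arbitrary base point; for continuous \<open>p\<close> the
  limit is the same at every point.\<close>

definition \<Phi> :: "((nat \<Rightarrow> 'a) \<Rightarrow> real) \<Rightarrow> real" where
  "\<Phi> p = lim (\<lambda>n. (L ^^ n) p undefined)"

lemma Phi_lim: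
  assumes "cont p"
  shows "(\<lambda>n. (L ^^ n) p x) \<longlonglongrightarrow> \<Phi> p"
proof -
  obtain l where l: "\<And>x. (\<lambda>n. (L ^^ n) p x) \<longlonglongrightarrow> l"
    using ruelle_iterate_convergent[OF assms] by blast
  then have "\<Phi> p = l"
    unfolding \<Phi>_def by (intro limI)
  then show ?thesis
    using l by simp
qed

sublocale Phi: positive_functional \<Phi>
proof
  show "compact (UNIV :: (nat \<Rightarrow> 'a) set)"
    by (rule compact_Omega)
  fix p q :: "(nat \<Rightarrow> 'a) \<Rightarrow> real" and c :: real
  assume p: "cont p"
  show "\<Phi> (\<lambda>x. c * p x) = c * \<Phi> p"
    using Phi_lim[OF p, of undefined] unfolding \<Phi>_def ruelle_iterate_scale
    by (intro limI tendsto_mult_left) (simp add: \<Phi>_def)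
  show "0 \<le> \<Phi> p" if "\<And>x. 0 \<le> p x"
  proof (rule LIMSEQ_le_const[OF Phi_lim[OF p]])
    show "\<exists>N. \<forall>n\<ge>N. 0 \<le> (L ^^ n) p undefined"
      using ruelle_iterate_mono[of "\<lambda>x. 0" p] p that by auto
  qed
  assume q: "cont q"
  have "(L ^^ n) (\<lambda>x. p x - - 1 * q x) x = (L ^^ n) p x - - 1 * (L ^^ n) q x" for n x
    by (rule ruelle_iterate_diff[OF f_cont p q])
  then have "(L ^^ n) (\<lambda>x. p x + q x) x = (L ^^ n) p x + (L ^^ n) q x" for n x
    by simp
  then show "\<Phi> (\<lambda>x. p x + q x) = \<Phi> p + \<Phi> q"
    using tendsto_add[OF Phi_lim[OF p, of undefined] Phi_lim[OF q, of undefined]]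
    unfolding \<Phi>_def[of "\<lambda>x. p x + q x"] by (intro limI) simp
next
  show "\<Phi> (\<lambda>x. 1) = 1"
    unfolding \<Phi>_def by (intro limI) simp
qed

lemma integral_ruelle_iterate:
  assumes "dual_eigenprob \<nu> f 1 \<mu>" "cont p"
  shows "(LINT x|\<mu>. (L ^^ n) p x) = (LINT x|\<mu>. p x)"
proof (induction n)
  case (Suc n)
  have "(LINT x|\<mu>. L ((L ^^ n) p) x) = 1 * (LINT x|\<mu>. (L ^^ n) p x)"
    using assms(1) cont_ruelle_iterate[OF f_cont assms(2), of n] unfolding dual_eigenprob_def by blast
  with Suc show ?case
    by simp
qed simp

text \<open>Invariance lets \<open>p\<close> be replaced by \<open>L\<^sup>n p\<close> under the
  integral, and these converge boundedly to a constant. All invariant probabilities therefore have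
  the same integrals, whence uniqueness.\<close>

lemma integral_eq_Phi:
  assumes "dual_eigenprob \<nu> f 1 \<mu>" "cont p"
  shows "(LINT x|\<mu>. p x) = \<Phi> p"
proof -
  interpret mu: prob_space \<mu>
    using assms(1) by (simp add: dual_eigenprob_def)
  have sets_mu: "sets \<mu> = sets borel"
    using assms(1) by (simp add: dual_eigenprob_def)
  obtain B where B: "B > 0" "\<And>x. \<bar>p x\<bar> \<le> B"
    using cont_bounded_real[OF assms(2)] by blast
  have "(\<lambda>n. LINT x|\<mu>. (L ^^ n) p x) \<longlonglongrightarrow> (LINT x|\<mu>. \<Phi> p)"
  proof (rule integral_dominated_convergence[where w="\<lambda>x. B"])
    have "norm ((L ^^ n) p x) \<le> B" for n x
    proof -
      have "- B \<le> p y" "p y \<le> B" for y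
        using B(2)[of y] by linarith+
      then show ?thesis
        using ruelle_iterate_bounds[OF assms(2), of "- B" B] unfolding real_norm_def abs_le_iff
        by (metis minus_le_iff)
    qed
    then show "AE x in \<mu>. norm ((L ^^ n) p x) \<le> B" for n
      by (rule AE_I2)
    show "(L ^^ n) p \<in> borel_measurable \<mu>" for n
      using borel_measurable_continuous_onI[OF cont_ruelle_iterate[OF f_cont assms(2)]]
        measurable_cong_sets[OF sets_mu refl] by blast
    show "AE x in \<mu>. (\<lambda>n. (L ^^ n) p x) \<longlonglongrightarrow> \<Phi> p"
      by (intro AE_I2 Phi_lim assms(2))
  qed simp_all
  then have "(\<lambda>n. LINT x|\<mu>. p x) \<longlonglongrightarrow> \<Phi> p"
    using mu.prob_space by (simp add: integral_ruelle_iterate[OF assms])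
  then show ?thesis
    by (simp add: LIMSEQ_const_iff)
qed

lemma Phi_ruelle:
  assumes p: "cont p"
  shows "\<Phi> (L p) = \<Phi> p"
proof (rule LIMSEQ_unique)
  show "(\<lambda>n. (L ^^ n) (L p) undefined) \<longlonglongrightarrow> \<Phi> (L p)"
    by (intro Phi_lim cont_ruelle f_cont p)
  show "(\<lambda>n. (L ^^ n) (L p) undefined) \<longlonglongrightarrow> \<Phi> p"
    using LIMSEQ_Suc[OF Phi_lim[OF p, of undefined]] unfolding funpow_Suc_right o_def .
qed

lemma invariant_prob: "dual_eigenprob \<nu> f 1 Phi.riesz"
  unfolding dual_eigenprob_def
proof (intro conjI allI impI)
  show "(LINT x|Phi.riesz. L p x) = 1 * (LINT x|Phi.riesz. p x)" if "cont p" for p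
    unfolding Phi.integral_riesz[OF cont_ruelle[OF f_cont that]] Phi.integral_riesz[OF that]
      Phi_ruelle[OF that] by simp
qed (rule Phi.prob_space_riesz, rule Phi.sets_riesz)

lemma invariant_prob_unique: "dual_eigenprob \<nu> f 1 \<mu> \<Longrightarrow> \<mu> = Phi.riesz"
  by (rule Phi.riesz_unique) (simp_all only: integral_eq_Phi, simp_all add: dual_eigenprob_def)

lemma ex1_invariant_prob: "\<exists>!\<mu>. dual_eigenprob \<nu> f 1 \<mu>"
  using invariant_prob invariant_prob_unique by blast

text \<open>\<open>h\<close> is the Neumann series of \<open>L\<^sup>j p - l\<close>. Both estimates
  of \<open>spectral_gap\<close> are summable in \<open>j\<close>, so the partial sums have a common
  bound and a common Lipschitz constant.\<close>

lemma poisson_equation: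
  assumes "dual_eigenprob \<nu> f 1 \<mu>" and p: "p \<in> LipM"
  shows "\<exists>h\<in>LipM. \<forall>x. h x - L h x = p x - (LINT x|\<mu>. p x)"
proof -
  note cp = Lip_cont[OF p]
  obtain C l where C: "0 \<le> C" "\<And>n x. \<bar>(L ^^ n) p x - l\<bar> \<le> C * \<theta> ^ n"
    "\<And>n x y. \<bar>(L ^^ n) p x - (L ^^ n) p y\<bar> \<le> C * \<theta> ^ n * D x y"
    using spectral_gap[OF p] by blast
  have pow: "(\<lambda>n. C * \<theta> ^ n) \<longlonglongrightarrow> 0"
    using theta by (intro tendsto_mult_right_zero LIMSEQ_power_zero) auto
  have "(\<lambda>n. (L ^^ n) p undefined - l) \<longlonglongrightarrow> 0"
    by (rule Lim_null_comparison[OF always_eventually pow]) (unfold real_norm_def, use C(2) in blast)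
  then have "(\<lambda>n. (L ^^ n) p undefined) \<longlonglongrightarrow> l"
    by (rule LIM_zero_cancel)
  then have l: "l = (LINT x|\<mu>. p x)"
    using LIMSEQ_unique[OF Phi_lim[OF cp]] integral_eq_Phi[OF assms(1) cp] by simp
  have geo: "(\<Sum>j<n. C * \<theta> ^ j) \<le> C / (1 - \<theta>)" for n
  proof -
    have "(\<Sum>j<n. C * \<theta> ^ j) \<le> (\<Sum>j. C * \<theta> ^ j)"
      using theta C(1) by (intro sum_le_suminf summable_mult summable_geometric) auto
    also have "\<dots> = C / (1 - \<theta>)"
      using theta by (subst suminf_mult) (auto simp: suminf_geometric summable_geometric)
    finally show ?thesis .
  qed
  define s where "s n x = (\<Sum>j<n. (L ^^ j) p x - l)" for n x
  have s_cont: "cont (s n)" for n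
    unfolding s_def by (intro continuous_intros cont_ruelle_iterate f_cont cp)
  have s_bound: "\<bar>s n x\<bar> \<le> C / (1 - \<theta>)" for n x
    unfolding s_def using C(2) by (intro order_trans[OF sum_abs order_trans[OF sum_mono geo[of n]]])
  have s_Lip: "\<bar>s n x - s n y\<bar> \<le> C / (1 - \<theta>) * D x y" for n x y
  proof -
    have "\<bar>s n x - s n y\<bar> = \<bar>\<Sum>j<n. (L ^^ j) p x - (L ^^ j) p y\<bar>"
      by (simp add: s_def flip: sum_subtractf)
    also have "\<dots> \<le> (\<Sum>j<n. C * \<theta> ^ j * D x y)"
      using C(3) by (intro order_trans[OF sum_abs sum_mono])
    also have "\<dots> \<le> C / (1 - \<theta>) * D x y"
      unfolding sum_distrib_right[symmetric] by (intro mult_right_mono geo) auto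
    finally show ?thesis .
  qed
  have "summable (\<lambda>j. (L ^^ j) p x - l)" for x
  proof (rule summable_comparison_test')
    show "summable (\<lambda>n. C * \<theta> ^ n)"
      using theta by (intro summable_mult summable_geometric) auto
  qed (unfold real_norm_def, use C(2) in blast)
  then have s_lim: "(\<lambda>n. s n x) \<longlonglongrightarrow> (\<Sum>j. (L ^^ j) p x - l)" for x
    unfolding s_def by (rule summable_LIMSEQ)
  define h where "h x = (\<Sum>j. (L ^^ j) p x - l)" for x
  note s_lim = s_lim[folded h_def]
  have h: "h \<in> LipM"
  proof (rule LipI)
    show "\<bar>h x - h y\<bar> \<le> C / (1 - \<theta>) * D x y" for x y
      by (rule LIMSEQ_le_const2[OF tendsto_rabs[OF tendsto_diff[OF s_lim s_lim]]])
         (use s_Lip in blast)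
  qed
  have step: "s n x - L (s n) x = p x - (L ^^ n) p x" for n x
  proof (induction n arbitrary: x)
    case (Suc n)
    have "L (s (Suc n)) x = L (\<lambda>x. s n x + ((L ^^ n) p x - l)) x"
      by (simp add: s_def[abs_def])
    also have "\<dots> = L (s n) x + ((L ^^ Suc n) p x - l)"
      using s_cont cont_ruelle_iterate[OF f_cont cp, of n] f_cont
      by (simp add: ruelle_add ruelle_diff continuous_on_diff)
    finally have "L (s (Suc n)) x = L (s n) x + ((L ^^ Suc n) p x - l)" .
    moreover have "s (Suc n) x = s n x + ((L ^^ n) p x - l)"
      by (simp add: s_def)
    ultimately show ?case
      using Suc[of x] by linarith
  next
    case 0
    have "s 0 = (\<lambda>x. 0)"
      by (simp add: s_def[abs_def])
    then show ?case
      by simp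
  qed
  have "h x - L h x = p x - l" for x
  proof (rule LIMSEQ_unique)
    show "(\<lambda>n. s n x - L (s n) x) \<longlonglongrightarrow> h x - L h x"
      by (intro tendsto_diff s_lim ruelle_limit[OF f_cont s_cont s_bound Lip_cont[OF h]])
    have "(\<lambda>n. (L ^^ n) p x - l) \<longlonglongrightarrow> 0"
      by (rule Lim_null_comparison[OF always_eventually pow]) (unfold real_norm_def, use C(2) in blast)
    then show "(\<lambda>n. s n x - L (s n) x) \<longlonglongrightarrow> p x - l"
      unfolding step by (rule tendsto_diff[OF tendsto_const LIM_zero_cancel])
  qed
  with h show ?thesis
    unfolding l by blast
qed

end

subsection \<open>The Ruelle-Perron-Frobenius theorem\<close>

context full_shift
begin

text \<open>The coboundary in \<open>N\<close> contributes the factor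
  \<open>w (prepend a x) / w x\<close>, so multiplication by \<open>w\<close> conjugates the two
  operators up to the scalar \<open>c\<close>.\<close>

lemma ruelle_conjugate:
  assumes "c > 0" "\<And>x. w x > 0" "N = (\<lambda>x. f x + ln (w x) - ln (w (seq_shift x)) - ln c)"
  shows "ruelle_op \<nu> f (\<lambda>x. w x * p x) x = c * w x * ruelle_op \<nu> N p x"
proof -
  have "exp (f (prepend a x)) * (w (prepend a x) * p (prepend a x))
      = c * w x * (exp (N (prepend a x)) * p (prepend a x))" for a
    using assms(1) assms(2)[of x] assms(2)[of "prepend a x"] by (simp add: assms(3) exp_diff exp_add)
  then show ?thesis
    unfolding ruelle_op_def by (simp only: integral_mult_right_zero)
qed

lemma markov_potentialI:
  assumes "N \<in> LipM" "\<And>x. ruelle_op \<nu> N (\<lambda>x. 1) x = 1"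
  shows "\<exists>F. markov_potential \<nu> N F"
proof -
  obtain F where "0 \<le> F" "\<And>x y. \<bar>N x - N y\<bar> \<le> F * D x y"
    using Lip_bound[OF assms(1)] by blast
  then have "markov_potential \<nu> N F"
    using assms(2) by unfold_locales
  then show ?thesis ..
qed

lemma normalized_potential:
  assumes f: "f \<in> LipM" and c: "c > 0" and w: "w \<in> LipM" "\<And>x. w x > 0"
    and eig: "\<And>x. ruelle_op \<nu> f w x = c * w x"
    and N: "N = (\<lambda>x. f x + ln (w x) - ln (w (seq_shift x)) - ln c)"
  shows "\<exists>F. markov_potential \<nu> N F"
proof (rule markov_potentialI)
  show "N \<in> LipM"
    unfolding N using Lip_diff[OF Lip_diff[OF Lip_add[OF f Lip_ln[OF w]] Lip_shift[OF Lip_ln[OF w]]] Lip_const]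
    by simp
  show "ruelle_op \<nu> N (\<lambda>x. 1) x = 1" for x
    using ruelle_conjugate[OF c w(2) N, of "\<lambda>x. 1" x] eig[of x] c w(2)[of x] by simp
qed

theorem rpf_data_exists:
  assumes f: "f \<in> LipM"
  shows "\<exists>c w \<rho>. rpf_data \<nu> f c w \<rho>"
proof -
  obtain F where "0 \<le> F" "\<And>x y. \<bar>f x - f y\<bar> \<le> F * D x y"
    using Lip_bound[OF f] by blast
  then interpret lip_potential \<nu> f F
    by unfold_locales
  obtain c w where c: "c > 0" and w: "w \<in> LipM" "\<And>x. w x > 0" and eig: "\<And>x. L w x = c * w x"
    using eigenfunction_exists by blast
  define N where "N = (\<lambda>x. f x + ln (w x) - ln (w (seq_shift x)) - ln c)"
  obtain F' where "markov_potential \<nu> N F'"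
    using normalized_potential[OF f c w eig N_def] by blast
  then interpret N: markov_potential \<nu> N F' .
  note cw = Lip_cont[OF w(1)]
  have cdiv: "cont (\<lambda>x. p x / w x)" if "cont p" for p :: "_ \<Rightarrow> real"
    using w(2) by (intro continuous_on_divide that cw) (auto simp: less_imp_neq[symmetric])
  obtain b where b: "b > 0" "\<And>x. b \<le> 1 / w x"
    using cont_pos_bound[OF cdiv[of "\<lambda>x. 1"]] w(2) by auto
  have "b \<le> N.\<Phi> (\<lambda>x. 1 / w x)"
    using N.Phi.Phi_mono[of "\<lambda>x. b" "\<lambda>x. 1 / w x"] b(2) cdiv[of "\<lambda>x. 1"]
    by (simp add: N.Phi.Phi_const)
  then have Z: "0 < N.\<Phi> (\<lambda>x. 1 / w x)"
    using b(1) by linarith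
  \<comment> \<open>The candidate eigenmeasure: the invariant probability of \<open>N\<close> with
    density \<open>1 / w\<close>, normalized to mass 1.\<close>
  interpret Psi: positive_functional "\<lambda>p. N.\<Phi> (\<lambda>x. p x / w x) / N.\<Phi> (\<lambda>x. 1 / w x)"
  proof
    fix p q :: "(nat \<Rightarrow> 'a) \<Rightarrow> real" and k :: real
    assume p: "cont p"
    show "N.\<Phi> (\<lambda>x. k * p x / w x) / N.\<Phi> (\<lambda>x. 1 / w x)
        = k * (N.\<Phi> (\<lambda>x. p x / w x) / N.\<Phi> (\<lambda>x. 1 / w x))"
      using N.Phi.Phi_scale[OF cdiv[OF p], of k] by simp
    show "0 \<le> N.\<Phi> (\<lambda>x. p x / w x) / N.\<Phi> (\<lambda>x. 1 / w x)" if "\<And>x. 0 \<le> p x"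
      using Z that w(2) by (intro divide_nonneg_pos N.Phi.Phi_nonneg cdiv[OF p]) (auto intro: less_imp_le)
    assume q: "cont q"
    show "N.\<Phi> (\<lambda>x. (p x + q x) / w x) / N.\<Phi> (\<lambda>x. 1 / w x)
        = N.\<Phi> (\<lambda>x. p x / w x) / N.\<Phi> (\<lambda>x. 1 / w x) + N.\<Phi> (\<lambda>x. q x / w x) / N.\<Phi> (\<lambda>x. 1 / w x)"
      using N.Phi.Phi_add[OF cdiv[OF p] cdiv[OF q]] by (simp add: add_divide_distrib)
  qed (use Z compact_Omega in auto)
  have "(LINT x|Psi.riesz. L p x) = c * (LINT x|Psi.riesz. p x)" if p: "cont p" for p
  proof -
    have "L p x / w x = c * ruelle_op \<nu> N (\<lambda>x. p x / w x) x" for x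
    proof -
      have "(\<lambda>x. w x * (p x / w x)) = p"
        using w(2) by (auto simp: less_imp_neq[symmetric])
      then show ?thesis
        using ruelle_conjugate[OF c w(2) N_def, of "\<lambda>x. p x / w x" x] w(2)[of x] by simp
    qed
    then have "N.\<Phi> (\<lambda>x. L p x / w x) = c * N.\<Phi> (ruelle_op \<nu> N (\<lambda>x. p x / w x))"
      using N.Phi.Phi_scale[OF cont_ruelle[OF N.f_cont cdiv[OF p]]] by simp
    also have "N.\<Phi> (ruelle_op \<nu> N (\<lambda>x. p x / w x)) = N.\<Phi> (\<lambda>x. p x / w x)"
      by (rule N.Phi_ruelle[OF cdiv[OF p]])
    finally show ?thesis
      using p cont_ruelle[OF f_cont p] by (simp add: Psi.integral_riesz)
  qed
  then have "dual_eigenprob \<nu> f c Psi.riesz"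
    by (simp add: dual_eigenprob_def Psi.prob_space_riesz)
  then have "rpf_data \<nu> f c w Psi.riesz"
    using c w eig by (simp add: rpf_data_def)
  then show ?thesis
    by blast
qed

lemma integrable_Omega:
  fixes p :: "(nat \<Rightarrow> 'a) \<Rightarrow> 'c::{banach, second_countable_topology}"
  assumes "prob_space \<rho>" "sets \<rho> = sets borel" "cont p"
  shows "integrable \<rho> p"
  using assms
  by (intro integrable_continuous_compact_UNIV[OF compact_Omega]) (auto intro: prob_space.finite_measure)

lemma integral_pos:
  fixes p :: "(nat \<Rightarrow> 'a) \<Rightarrow> real"
  assumes "prob_space \<rho>" "sets \<rho> = sets borel" "cont p" "\<And>x. 0 < p x"
  shows "0 < (LINT x|\<rho>. p x)"
proof -
  interpret prob_space \<rho> by fact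
  obtain b where b: "b > 0" "\<And>x. b \<le> p x"
    using cont_pos_bound[OF assms(3,4)] by blast
  then have "b \<le> (LINT x|\<rho>. p x)"
    using integrable_Omega[OF assms(1-3)] by (intro integral_ge_const) auto
  with b(1) show ?thesis by linarith
qed

text \<open>Pair the eigenfunction of one triple with the eigenmeasure of the other; the integral is
  positive and can be cancelled.\<close>

lemma rpf_eigenvalue_eq:
  assumes "rpf_data \<nu> f c w \<rho>"
  shows "rpf_eigenvalue \<nu> f = c"
  unfolding rpf_eigenvalue_def
proof (rule the_equality)
  show "\<exists>w \<rho>. rpf_data \<nu> f c w \<rho>"
    using assms by blast
  fix c' assume "\<exists>w \<rho>. rpf_data \<nu> f c' w \<rho>"
  then obtain w' \<rho>' where *: "rpf_data \<nu> f c' w' \<rho>'" by blast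
  have cw: "cont w"
    using assms by (auto simp: rpf_data_def intro: Lip_cont)
  have "(LINT x|\<rho>'. ruelle_op \<nu> f w x) = c' * (LINT x|\<rho>'. w x)"
    using * cw by (simp add: rpf_data_def dual_eigenprob_def)
  moreover have "(LINT x|\<rho>'. ruelle_op \<nu> f w x) = c * (LINT x|\<rho>'. w x)"
    using assms by (simp add: rpf_data_def)
  moreover have "0 < (LINT x|\<rho>'. w x)"
    using * assms cw by (intro integral_pos) (auto simp: rpf_data_def dual_eigenprob_def)
  ultimately show "c' = c"
    by simp
qed

lemma rpf_data_rpf:
  assumes "f \<in> LipM"
  shows "\<exists>\<rho>. rpf_data \<nu> f (rpf_eigenvalue \<nu> f) (rpf_eigenfunction \<nu> f) \<rho>"
proof -
  obtain c w \<rho> where *: "rpf_data \<nu> f c w \<rho>"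
    using rpf_data_exists[OF assms] by blast
  then have "\<exists>w \<rho>. rpf_data \<nu> f (rpf_eigenvalue \<nu> f) w \<rho>"
    unfolding rpf_eigenvalue_eq[OF *] by blast
  then show ?thesis
    unfolding rpf_eigenfunction_def by (rule someI_ex)
qed

lemma markov_normalization:
  assumes "f \<in> LipM"
  shows "\<exists>F. markov_potential \<nu> (normalization \<nu> f) F"
proof -
  obtain \<rho> where *: "rpf_data \<nu> f (rpf_eigenvalue \<nu> f) (rpf_eigenfunction \<nu> f) \<rho>"
    using rpf_data_rpf[OF assms] by blast
  show ?thesis
    by (rule normalized_potential[OF assms, where c="rpf_eigenvalue \<nu> f" and w="rpf_eigenfunction \<nu> f"])
       (use * in \<open>auto simp: rpf_data_def normalization_def[abs_def]\<close>)
qed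

lemma dual_eigenprob_gibbs:
  assumes "f \<in> LipM"
  shows "dual_eigenprob \<nu> (normalization \<nu> f) 1 (gibbs_measure \<nu> f)"
proof -
  obtain F where "markov_potential \<nu> (normalization \<nu> f) F"
    using markov_normalization[OF assms] by blast
  from markov_potential.ex1_invariant_prob[OF this] show ?thesis
    unfolding gibbs_measure_def by (rule theI')
qed

end

subsection \<open>Full support of the invariant probability\<close>

context full_shift
begin

lemma prepend_shift [simp]: "prepend (x 0) (seq_shift x) = x"
  by (rule ext) (auto simp: prepend_def seq_shift_def split: nat.split)

lemma D_cylinder_le:
  assumes "\<And>i. i < n \<Longrightarrow> x i = y i"
  shows "D x y \<le> (1 / 2) ^ n"
  using assms
proof (induction n arbitrary: x y)
  case 0
  then show ?case
    using D_le_1 by simp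
next
  case (Suc n)
  have "D x y = D (prepend (x 0) (seq_shift x)) (prepend (x 0) (seq_shift y))"
    using Suc.prems[of 0] prepend_shift[of x] prepend_shift[of y] by simp
  also have "\<dots> = D (seq_shift x) (seq_shift y) / 2"
    by (rule D_prepend)
  also have "D (seq_shift x) (seq_shift y) \<le> (1 / 2) ^ n"
    using Suc.prems by (intro Suc.IH) (simp add: seq_shift_def)
  finally show ?case
    by simp
qed

text \<open>Here the full support of \<open>\<nu>\<close> enters: positivity at one preimage of
  \<open>x\<close> persists for an open set of letters, which has positive measure.\<close>

lemma ruelle_pos_point:
  assumes f: "cont f" and p: "cont p" "\<And>x. 0 \<le> p x" and a: "0 < p (prepend a x)"
  shows "0 < ruelle_op \<nu> f p x"
proof -
  define r where "r b = exp (f (prepend b x)) * p (prepend b x)" for b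
  have "cont (\<lambda>x. exp (f x) * p x)"
    by (intro continuous_intros f p)
  then have r_cont: "continuous_on UNIV r"
    unfolding r_def by (rule continuous_on_compose2[OF _ continuous_prepend_left]) auto
  have r0: "0 \<le> r b" for b
    using p(2) by (simp add: r_def)
  define U where "U = {b. r a / 2 < r b}"
  have "open U"
    unfolding U_def by (intro open_Collect_less continuous_on_const r_cont)
  moreover have ra: "0 < r a"
    using a by (simp add: r_def)
  then have "a \<in> U"
    by (simp add: U_def)
  ultimately have "0 < measure \<nu> U"
    using apriori unfolding a_priori_measure_def by blast
  then have "0 < r a / 2 * measure \<nu> U"
    using ra by simp
  also have "\<dots> = (LINT b|\<nu>. r a / 2 * indicator U b)"
    using \<open>open U\<close> by simp
  also have "\<dots> \<le> (LINT b|\<nu>. r b)"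
  proof (rule integral_mono)
    show "integrable \<nu> r"
      unfolding r_def by (rule integrable_ruelle[OF f p(1)])
    show "integrable \<nu> (\<lambda>b. r a / 2 * indicator U b)"
      using \<open>open U\<close> by (intro integrable_mult_right integrable_real_indicator)
        (auto simp: nu.emeasure_eq_measure)
    show "r a / 2 * indicator U b \<le> r b" for b
      using r0[of b] by (cases "b \<in> U") (auto simp: U_def)
  qed
  finally show ?thesis
    by (simp add: ruelle_op_def r_def)
qed

text \<open>The preimages of any \<open>x\<close> under \<open>n\<close> shifts carry all words of
  length \<open>n\<close> in front, in particular the one of \<open>y\<close>. The induction
  prepends the letters of \<open>y\<close>, the first one last.\<close>

lemma ruelle_iterate_pos_cylinder:
  assumes "cont f" "cont p" "\<And>x. 0 \<le> p x" "\<And>x. (\<And>i. i < n \<Longrightarrow> x i = y i) \<Longrightarrow> 0 < p x"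
  shows "0 < (ruelle_op \<nu> f ^^ n) p x"
  using assms(2-)
proof (induction n arbitrary: p y x)
  case (Suc n)
  have "0 < (ruelle_op \<nu> f ^^ n) (ruelle_op \<nu> f p) x"
  proof (rule Suc.IH)
    show "cont (ruelle_op \<nu> f p)"
      by (rule cont_ruelle[OF assms(1) Suc.prems(1)])
    show "0 \<le> ruelle_op \<nu> f p x" for x
      unfolding ruelle_op_def using Suc.prems(2) by (intro Bochner_Integration.integral_nonneg) simp
    fix x assume x: "\<And>i. i < n \<Longrightarrow> x i = seq_shift y i"
    have "0 < p (prepend (y 0) x)"
    proof (rule Suc.prems(3))
      show "prepend (y 0) x i = y i" if "i < Suc n" for i
        using that x[of "i - 1"] by (cases i) (auto simp: prepend_def seq_shift_def)
    qed
    then show "0 < ruelle_op \<nu> f p x"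
      by (rule ruelle_pos_point[OF assms(1) Suc.prems(1,2)])
  qed
  then show ?case
    unfolding funpow_Suc_right o_def .
qed simp

end

lemma (in markov_potential) full_support:
  fixes p :: "(nat \<Rightarrow> 'a) \<Rightarrow> real"
  assumes mu: "dual_eigenprob \<nu> f 1 \<mu>" and p: "cont p" "\<And>x. 0 \<le> p x" and y: "0 < p y"
  shows "0 < (LINT x|\<mu>. p x)"
proof -
  have "open {x. 0 < p x}"
    by (intro open_Collect_less continuous_on_const p)
  then obtain e where e: "e > 0" "\<And>x. D y x < e \<Longrightarrow> 0 < p x"
    using y unfolding open_iff_seq_dist[OF compact_M diam_M] by blast
  obtain n where n: "(1 / 2) ^ n < e"
    using real_arch_pow_inv[OF e(1), of "1 / 2"] by auto
  have "0 < (L ^^ n) p x" for x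
  proof (rule ruelle_iterate_pos_cylinder[OF f_cont p])
    fix x assume "\<And>i. i < n \<Longrightarrow> x i = y i"
    then have "D y x \<le> (1 / 2) ^ n"
      by (intro D_cylinder_le) simp
    then show "0 < p x"
      using n by (intro e(2)) simp
  qed
  then have "0 < (LINT x|\<mu>. (L ^^ n) p x)"
    using mu by (intro integral_pos cont_ruelle_iterate f_cont p) (auto simp: dual_eigenprob_def)
  then show ?thesis
    unfolding integral_ruelle_iterate[OF mu p(1)] .
qed

subsection \<open>The martingale part of an observable\<close>

text \<open>\<open>L \<psi> = 0\<close> says that the \<open>\<psi> \<circ> T\<^sup>j\<close> are reverse martingale differences. The function \<open>q\<close>
  corrects for the conditional variance \<open>L (\<psi>\<^sup>2)\<close> not being constant.\<close>

locale martingale_part = markov_potential +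
  fixes \<mu> :: "(nat \<Rightarrow> 'a) measure" and \<psi> q :: "(nat \<Rightarrow> 'a) \<Rightarrow> real"
  assumes mu: "dual_eigenprob \<nu> f 1 \<mu>"
    and psi_cont: "continuous_on UNIV \<psi>" and q_cont: "continuous_on UNIV q"
    and ruelle_psi: "ruelle_op \<nu> f \<psi> x = 0"
    and q_eq: "q x - ruelle_op \<nu> f q x
      = ruelle_op \<nu> f (\<lambda>x. (\<psi> x)\<^sup>2) x - (LINT x|\<mu>. (\<psi> x)\<^sup>2)"

text \<open>Gordin's decomposition: if \<open>h - L h = g - \<alpha>\<close>, then
  \<open>\<psi> = h - (L h) \<circ> T\<close> is annihilated by \<open>L\<close>, since
  \<open>L\<close> undoes composition with the shift.\<close>

lemma (in markov_potential) martingale_decomposition: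
  assumes mu: "dual_eigenprob \<nu> f 1 \<mu>" and g: "g \<in> LipM"
  shows "\<exists>\<psi> q k. martingale_part \<nu> f F \<mu> \<psi> q \<and> cont k \<and>
    (\<forall>x. g x = (LINT x|\<mu>. g x) + \<psi> x - k x + k (seq_shift x))"
proof -
  define \<alpha> where "\<alpha> = (LINT x|\<mu>. g x)"
  obtain h where h: "h \<in> LipM" "\<And>x. h x - L h x = g x - \<alpha>"
    using poisson_equation[OF mu g] unfolding \<alpha>_def by blast
  \<comment> \<open>This is \<open>L h\<close>; written in this way it is Lipschitz because
    \<open>h\<close> and \<open>g\<close> are.\<close>
  define k where "k x = h x - (g x - \<alpha>)" for x
  have k: "k \<in> LipM"
    unfolding k_def using Lip_diff[OF h(1) Lip_diff[OF g Lip_const]] .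
  have k_eq: "k = L h"
    using h(2) by (auto simp: k_def algebra_simps)
  define \<psi> where "\<psi> x = h x - k (seq_shift x)" for x
  have psi: "\<psi> \<in> LipM"
    unfolding \<psi>_def using Lip_diff[OF h(1) Lip_shift[OF k]] .
  have "L (\<lambda>x. k (seq_shift x)) x = k x" for x
    using ruelle_shift_mult[of f k "\<lambda>x. 1" x] by simp
  then have L_psi: "L \<psi> x = 0" for x
    unfolding \<psi>_def using Lip_cont[OF h(1)] Lip_cont[OF Lip_shift[OF k]]
    by (simp add: ruelle_diff f_cont k_eq)
  have sq: "(\<lambda>x. (\<psi> x)\<^sup>2) \<in> LipM"
    unfolding power2_eq_square by (rule Lip_mult[OF psi psi])
  define \<sigma>2 where "\<sigma>2 = (LINT x|\<mu>. (\<psi> x)\<^sup>2)"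
  obtain q' where q': "q' \<in> LipM" "\<And>x. q' x - L q' x = (\<psi> x)\<^sup>2 - \<sigma>2"
    using poisson_equation[OF mu sq] unfolding \<sigma>2_def by blast
  \<comment> \<open>Again this is \<open>L q'\<close>. Applying \<open>L\<close> to the Poisson
    equation of \<open>q'\<close> gives the equation required of \<open>q\<close>, with the
    conditional variance in place of the square itself.\<close>
  define q where "q x = q' x - ((\<psi> x)\<^sup>2 - \<sigma>2)" for x
  have q: "q \<in> LipM"
    unfolding q_def using Lip_diff[OF q'(1) Lip_diff[OF sq Lip_const]] .
  have "q x - L q x = L (\<lambda>x. (\<psi> x)\<^sup>2) x - \<sigma>2" for x
  proof -
    have "L q x = L q' x - (L (\<lambda>x. (\<psi> x)\<^sup>2) x - \<sigma>2)"
      unfolding q_def using Lip_cont[OF q'(1)] Lip_cont[OF sq]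
      by (simp add: ruelle_diff f_cont continuous_on_diff)
    then show ?thesis
      using q'(2)[of x] by (simp add: q_def)
  qed
  then have "martingale_part \<nu> f F \<mu> \<psi> q"
    unfolding \<sigma>2_def using mu Lip_cont[OF psi] Lip_cont[OF q] L_psi by unfold_locales
  moreover have "g x = \<alpha> + \<psi> x - k x + k (seq_shift x)" for x
    by (simp add: \<psi>_def k_def)
  ultimately show ?thesis
    using Lip_cont[OF k] unfolding \<alpha>_def by blast
qed

lemma norm_exp_taylor2:
  fixes w :: complex
  shows "norm (exp w - (1 + w + w\<^sup>2 / 2)) \<le> exp (norm w) * norm w ^ 3"
proof -
  have "norm (exp w - (\<Sum>k\<le>2. w ^ k / fact k)) \<le> exp \<bar>Re w\<bar> * norm w ^ Suc 2 / fact 2"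
    by (rule Taylor_exp)
  also have "(\<Sum>k\<le>2. w ^ k / fact k) = 1 + w + w\<^sup>2 / 2"
    by (simp add: numeral_2_eq_2)
  also have "exp \<bar>Re w\<bar> * norm w ^ Suc 2 / fact 2 \<le> exp \<bar>Re w\<bar> * norm w ^ 3"
    by (simp add: numeral_3_eq_3 numeral_2_eq_2)
  also have "\<dots> \<le> exp (norm w) * norm w ^ 3"
    by (intro mult_right_mono) (auto simp: abs_Re_le_cmod)
  finally show ?thesis .
qed

context martingale_part
begin

definition \<sigma>2 where "\<sigma>2 = (LINT x|\<mu>. (\<psi> x)\<^sup>2)"

sublocale mu: prob_space \<mu>
  using mu by (simp add: dual_eigenprob_def)

lemma sets_mu [simp]: "sets \<mu> = sets borel"
  using mu by (simp add: dual_eigenprob_def)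

lemma space_mu [simp]: "space \<mu> = UNIV"
  using sets_eq_imp_space_eq[OF sets_mu] by simp

lemma sigma2_nonneg: "0 \<le> \<sigma>2"
  unfolding \<sigma>2_def by (intro Bochner_Integration.integral_nonneg) simp

lemma integrable_mu:
  fixes p :: "(nat \<Rightarrow> 'a) \<Rightarrow> 'c::{banach, second_countable_topology}"
  shows "cont p \<Longrightarrow> integrable \<mu> p"
  by (rule integrable_Omega[OF mu.prob_space_axioms sets_mu])

lemma integral_ruelle: "cont p \<Longrightarrow> (LINT x|\<mu>. L p x) = (LINT x|\<mu>. p x)"
  using integral_ruelle_iterate[OF mu, of p 1] by simp

definition Lc :: "((nat \<Rightarrow> 'a) \<Rightarrow> complex) \<Rightarrow> (nat \<Rightarrow> 'a) \<Rightarrow> complex" where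
  "Lc p x = (LINT a|\<nu>. of_real (exp (f (prepend a x))) * p (prepend a x))"

lemma integrable_Lc:
  fixes p :: "(nat \<Rightarrow> 'a) \<Rightarrow> complex"
  assumes "cont p"
  shows "integrable \<nu> (\<lambda>a. of_real (exp (f (prepend a x))) * p (prepend a x))"
  by (rule integrable_nu_prepend[of "\<lambda>x. of_real (exp (f x)) * p x"])
     (intro continuous_intros f_cont assms)

lemma cont_Lc: "cont p \<Longrightarrow> cont (Lc p)"
  unfolding Lc_def
  by (rule continuous_integral_prepend[of "\<lambda>x. of_real (exp (f x)) * p x"])
     (intro continuous_intros f_cont)

lemma Lc_of_real: "Lc (\<lambda>x. of_real (p x)) x = of_real (L p x)"
  unfolding Lc_def ruelle_op_def by (simp flip: of_real_mult)

lemma Lc_add: "cont p \<Longrightarrow> cont r \<Longrightarrow> Lc (\<lambda>x. p x + r x) x = Lc p x + Lc r x"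
  unfolding Lc_def using integrable_Lc[of p x] integrable_Lc[of r x] by (simp add: ring_distribs)

lemma Lc_scale: "Lc (\<lambda>x. c * p x) x = c * Lc p x"
proof -
  have "Lc (\<lambda>x. c * p x) x = (LINT a|\<nu>. c * (of_real (exp (f (prepend a x))) * p (prepend a x)))"
    unfolding Lc_def by (simp only: mult_ac)
  then show ?thesis
    unfolding Lc_def by (simp only: integral_mult_right_zero)
qed

lemma Lc_shift_mult: "Lc (\<lambda>x. p (seq_shift x) * r x) x = p x * Lc r x"
proof -
  have "Lc (\<lambda>x. p (seq_shift x) * r x) x
      = (LINT a|\<nu>. p x * (of_real (exp (f (prepend a x))) * r (prepend a x)))"
    unfolding Lc_def by (simp only: mult_ac seq_shift_prepend)
  then show ?thesis
    unfolding Lc_def by (simp only: integral_mult_right_zero)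
qed

lemma norm_Lc_le:
  assumes p: "cont p" and B: "\<And>x. norm (p x) \<le> B"
  shows "norm (Lc p x) \<le> B"
proof -
  have "norm (Lc p x) \<le> (LINT a|\<nu>. norm (of_real (exp (f (prepend a x))) * p (prepend a x)))"
    unfolding Lc_def by (rule integral_norm_bound)
  also have "\<dots> \<le> (LINT a|\<nu>. exp (f (prepend a x)) * B)"
    using integrable_norm[OF integrable_Lc[OF p, of x]] integrable_ruelle[OF f_cont continuous_on_const]
    by (intro integral_mono) (auto simp: norm_mult B)
  also have "\<dots> = L (\<lambda>x. B) x"
    by (simp only: ruelle_op_def)
  finally show ?thesis
    by simp
qed

lemma integral_Lc:
  assumes "cont p"
  shows "(LINT x|\<mu>. Lc p x) = (LINT x|\<mu>. p x)"
proof -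
  define a b where "a x = Re (p x)" and "b x = Im (p x)" for x
  have ab: "cont a" "cont b"
    unfolding a_def b_def by (intro continuous_intros assms)+
  have p: "p = (\<lambda>x. of_real (a x) + \<i> * of_real (b x))"
    by (auto simp: a_def b_def complex_eq_iff)
  have "Lc p x = of_real (L a x) + \<i> * of_real (L b x)" for x
    unfolding p using ab by (subst Lc_add) (auto intro!: continuous_intros simp: Lc_scale Lc_of_real)
  moreover have "integrable \<mu> (\<lambda>x. complex_of_real (r x))" if "cont r" for r
    by (intro integrable_mu continuous_intros that)
  ultimately show ?thesis
    using ab cont_ruelle[OF f_cont ab(1)] cont_ruelle[OF f_cont ab(2)] unfolding p
    by (simp add: integral_ruelle)
qed

text \<open>Real \<open>z\<close> gives the expansion of the pressure, imaginary \<open>z\<close> the characteristic functions.\<close>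

lemma perturbed_eigen:
  "\<exists>C\<ge>0. \<forall>z x. norm z \<le> 1 \<longrightarrow>
    norm (Lc (\<lambda>y. exp (z * of_real (\<psi> y)) * (1 + z\<^sup>2 / 2 * of_real (q y))) x
      - (1 + z\<^sup>2 / 2 * of_real \<sigma>2) * (1 + z\<^sup>2 / 2 * of_real (q x))) \<le> C * norm z ^ 3"
proof -
  obtain B where B: "B > 0" "\<And>x. \<bar>\<psi> x\<bar> \<le> B"
    using cont_bounded_real[OF psi_cont] by blast
  obtain Q where Q: "Q > 0" "\<And>x. \<bar>q x\<bar> \<le> Q"
    using cont_bounded_real[OF q_cont] by blast
  define C1 where "C1 = exp B * B ^ 3 * (1 + Q) + (B + B\<^sup>2) * Q"
  have C1: "0 \<le> C1"
    using B(1) Q(1) by (simp add: C1_def)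
  note cpsi = continuous_on_of_real[OF psi_cont, where ?'a=complex]
  note cq = continuous_on_of_real[OF q_cont, where ?'a=complex]
  show ?thesis
  proof (intro exI[of _ "C1 + \<sigma>2 * Q"] conjI allI impI)
    show "0 \<le> C1 + \<sigma>2 * Q"
      using C1 Q(1) sigma2_nonneg by simp
    fix z :: complex and x assume z: "norm z \<le> 1"
    define w where "w y = z * of_real (\<psi> y)" for y
    define v where "v y = z\<^sup>2 / 2 * of_real (q y)" for y
    \<comment> \<open>What remains after the terms of order at most two in \<open>z\<close>;
      \<open>v\<close> already has order two.\<close>
    define E where "E y = exp (w y) * (1 + v y) - (1 + w y + (w y)\<^sup>2 / 2 + v y)" for y
    have cont_w: "cont w" and cont_v: "cont v"
      unfolding w_def v_def by (intro continuous_intros cpsi cq)+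
    have cont_E: "cont E"
      unfolding E_def by (intro continuous_intros cont_w cont_v) auto
    have z3: "norm z ^ k \<le> norm z ^ 3" if "3 \<le> k" for k
      using z that by (intro power_decreasing) auto
    have E_le: "norm (E y) \<le> C1 * norm z ^ 3" for y
    proof -
      have nw: "norm (w y) \<le> norm z * B"
        using B(2)[of y] by (simp add: w_def norm_mult mult_left_mono)
      have nwB: "norm (w y) \<le> B"
        using nw mult_right_mono[OF z less_imp_le[OF B(1)]] by linarith
      have "norm (v y) = (norm z)\<^sup>2 * \<bar>q y\<bar> / 2"
        by (simp add: v_def norm_mult norm_divide norm_power)
      then have nv: "norm (v y) \<le> (norm z)\<^sup>2 * Q"
        using mult_left_mono[OF Q(2)[of y] zero_le_power2[of "norm z"]]
          mult_nonneg_nonneg[OF zero_le_power2[of "norm z"] less_imp_le[OF Q(1)]]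
        by linarith
      have nv1: "norm (v y) \<le> Q"
        using nv mult_right_mono[OF power_le_one[OF norm_ge_zero z, of 2] less_imp_le[OF Q(1)]]
        by linarith
      have "norm (exp (w y) - (1 + w y + (w y)\<^sup>2 / 2)) \<le> exp (norm (w y)) * norm (w y) ^ 3"
        by (rule norm_exp_taylor2)
      also have "\<dots> \<le> exp B * (norm z * B) ^ 3"
        using nwB nw by (intro mult_mono power_mono) auto
      finally have r: "norm (exp (w y) - (1 + w y + (w y)\<^sup>2 / 2)) \<le> exp B * B ^ 3 * norm z ^ 3"
        by (simp add: power_mult_distrib mult_ac)
      \<comment> \<open>Both summands are at least cubic in \<open>z\<close>: a Taylor remainder,
        and a product of a first-order with a second-order factor.\<close>
      have "E y = (exp (w y) - (1 + w y + (w y)\<^sup>2 / 2)) * (1 + v y) + (w y + (w y)\<^sup>2 / 2) * v y"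
        by (simp add: E_def algebra_simps)
      also have "norm \<dots> \<le> norm (exp (w y) - (1 + w y + (w y)\<^sup>2 / 2)) * norm (1 + v y)
          + norm (w y + (w y)\<^sup>2 / 2) * norm (v y)"
        by (intro order_trans[OF norm_triangle_ineq]) (simp add: norm_mult)
      also have "\<dots> \<le> (exp B * B ^ 3 * norm z ^ 3) * (1 + Q) + (norm z * (B + B\<^sup>2)) * ((norm z)\<^sup>2 * Q)"
      proof (intro add_mono mult_mono r nv)
        show "norm (1 + v y) \<le> 1 + Q"
          using norm_triangle_ineq[of 1 "v y"] nv1 by simp
        have "norm (w y + (w y)\<^sup>2 / 2) \<le> norm (w y) + (norm (w y))\<^sup>2"
          by (rule order_trans[OF norm_triangle_ineq]) (simp add: norm_divide norm_power)
        also have "\<dots> \<le> norm z * B + norm z * B * B"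
          using nw nwB B(1) by (auto simp: power2_eq_square intro!: add_mono mult_mono)
        finally show "norm (w y + (w y)\<^sup>2 / 2) \<le> norm z * (B + B\<^sup>2)"
          by (simp add: algebra_simps power2_eq_square)
      qed (use B(1) Q(1) in auto)
      also have "\<dots> = C1 * norm z ^ 3"
        by (simp add: C1_def algebra_simps power2_eq_square power3_eq_cube)
      finally show ?thesis .
    qed
    \<comment> \<open>The linear term vanishes because \<open>L \<psi> = 0\<close>, and the equation
      for \<open>q\<close> makes the second-order coefficient \<open>\<sigma>2 + q\<close>, the same
      as in the product with which it is compared.\<close>
    have quad: "Lc (\<lambda>y. 1 + w y + (w y)\<^sup>2 / 2 + v y) x = 1 + z\<^sup>2 / 2 * (of_real \<sigma>2 + of_real (q x))"
    proof -
      have lin: "Lc (\<lambda>y. (p1 y + z * p2 y) + c * (p3 y + p4 y)) x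
          = Lc p1 x + z * Lc p2 x + c * (Lc p3 x + Lc p4 x)"
        if "cont p1" "cont p2" "cont p3" "cont p4" for p1 p2 p3 p4 c
        using that by (simp add: Lc_add Lc_scale continuous_on_add continuous_on_mult)
      have "(\<lambda>y. 1 + w y + (w y)\<^sup>2 / 2 + v y) = (\<lambda>y. (of_real 1 + z * of_real (\<psi> y))
          + z\<^sup>2 / 2 * (of_real ((\<psi> y)\<^sup>2) + of_real (q y)))"
        by (auto simp: w_def v_def algebra_simps power_mult_distrib)
      then have "Lc (\<lambda>y. 1 + w y + (w y)\<^sup>2 / 2 + v y) x
          = Lc (\<lambda>y. of_real 1) x + z * Lc (\<lambda>y. of_real (\<psi> y)) x
          + z\<^sup>2 / 2 * (Lc (\<lambda>y. of_real ((\<psi> y)\<^sup>2)) x + Lc (\<lambda>y. of_real (q y)) x)"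
        using psi_cont q_cont
        by (simp only:) (intro lin continuous_on_of_real continuous_on_power continuous_on_const)
      also have "\<dots> = 1 + z\<^sup>2 / 2 * of_real (L (\<lambda>y. (\<psi> y)\<^sup>2) x + L q x)"
        unfolding Lc_of_real by (simp add: ruelle_psi)
      also have "L (\<lambda>y. (\<psi> y)\<^sup>2) x + L q x = \<sigma>2 + q x"
        using q_eq[of x] by (simp add: \<sigma>2_def)
      finally show ?thesis
        by simp
    qed
    have "Lc (\<lambda>y. exp (w y) * (1 + v y)) x = Lc (\<lambda>y. E y + (1 + w y + (w y)\<^sup>2 / 2 + v y)) x"
      by (simp add: E_def)
    also have "\<dots> = Lc E x + (1 + z\<^sup>2 / 2 * (of_real \<sigma>2 + of_real (q x)))"
      unfolding quad[symmetric] by (intro Lc_add cont_E continuous_intros cont_w cont_v) auto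
    \<comment> \<open>Multiplying out the approximate eigenvalue and eigenfunction leaves a
      fourth-order term besides \<open>Lc E\<close>.\<close>
    finally have eq: "Lc (\<lambda>y. exp (w y) * (1 + v y)) x - (1 + z\<^sup>2 / 2 * of_real \<sigma>2) * (1 + v x)
        = Lc E x - z ^ 4 / 4 * of_real (\<sigma>2 * q x)"
      by (simp add: v_def algebra_simps power2_eq_square power4_eq_xxxx)
    have "norm (Lc E x - z ^ 4 / 4 * of_real (\<sigma>2 * q x)) \<le> C1 * norm z ^ 3 + norm z ^ 4 / 4 * (\<sigma>2 * \<bar>q x\<bar>)"
      using norm_Lc_le[OF cont_E E_le, of x] sigma2_nonneg
      by (intro order_trans[OF norm_triangle_ineq4] add_mono) (auto simp: norm_mult norm_power norm_divide)
    also have "norm z ^ 4 / 4 * (\<sigma>2 * \<bar>q x\<bar>) \<le> norm z ^ 3 * (\<sigma>2 * Q)"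
    proof (rule mult_mono)
      have "norm z ^ 4 \<le> norm z ^ 3"
        by (rule z3) simp
      then show "norm z ^ 4 / 4 \<le> norm z ^ 3"
        using zero_le_power[OF norm_ge_zero, of z 4] by linarith
    qed (use Q(2)[of x] sigma2_nonneg in \<open>auto intro: mult_left_mono\<close>)
    finally show "norm (Lc (\<lambda>y. exp (z * of_real (\<psi> y)) * (1 + z\<^sup>2 / 2 * of_real (q y))) x
      - (1 + z\<^sup>2 / 2 * of_real \<sigma>2) * (1 + z\<^sup>2 / 2 * of_real (q x))) \<le> (C1 + \<sigma>2 * Q) * norm z ^ 3"
      unfolding w_def[symmetric] v_def[symmetric] eq by (simp add: algebra_simps)
  qed
qed

lemma perturbed_eigen_real:
  "\<exists>C\<ge>0. \<forall>t x. \<bar>t\<bar> \<le> 1 \<longrightarrow>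
    \<bar>L (\<lambda>y. exp (t * \<psi> y) * (1 + t\<^sup>2 / 2 * q y)) x - (1 + t\<^sup>2 / 2 * \<sigma>2) * (1 + t\<^sup>2 / 2 * q x)\<bar>
      \<le> C * \<bar>t\<bar> ^ 3"
proof -
  obtain C where C: "0 \<le> C" "\<And>z x. norm z \<le> 1 \<Longrightarrow>
    norm (Lc (\<lambda>y. exp (z * of_real (\<psi> y)) * (1 + z\<^sup>2 / 2 * of_real (q y))) x
      - (1 + z\<^sup>2 / 2 * of_real \<sigma>2) * (1 + z\<^sup>2 / 2 * of_real (q x))) \<le> C * norm z ^ 3"
    using perturbed_eigen by blast
  have "\<bar>L (\<lambda>y. exp (t * \<psi> y) * (1 + t\<^sup>2 / 2 * q y)) x - (1 + t\<^sup>2 / 2 * \<sigma>2) * (1 + t\<^sup>2 / 2 * q x)\<bar>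
      \<le> C * \<bar>t\<bar> ^ 3" if t: "\<bar>t\<bar> \<le> 1" for t x
  proof -
    have "Lc (\<lambda>y. exp (of_real t * of_real (\<psi> y)) * (1 + (of_real t)\<^sup>2 / 2 * of_real (q y))) x
        = Lc (\<lambda>y. of_real (exp (t * \<psi> y) * (1 + t\<^sup>2 / 2 * q y))) x"
      by (simp flip: exp_of_real)
    also have "\<dots> = of_real (L (\<lambda>y. exp (t * \<psi> y) * (1 + t\<^sup>2 / 2 * q y)) x)"
      by (rule Lc_of_real)
    finally have eq: "Lc (\<lambda>y. exp (of_real t * of_real (\<psi> y)) * (1 + (of_real t)\<^sup>2 / 2 * of_real (q y))) x
        - (1 + (of_real t)\<^sup>2 / 2 * of_real \<sigma>2) * (1 + (of_real t)\<^sup>2 / 2 * of_real (q x))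
      = of_real (L (\<lambda>y. exp (t * \<psi> y) * (1 + t\<^sup>2 / 2 * q y)) x
          - (1 + t\<^sup>2 / 2 * \<sigma>2) * (1 + t\<^sup>2 / 2 * q x))"
      by simp
    show ?thesis
      using C(2)[of "of_real t" x] t unfolding eq norm_of_real by simp
  qed
  with C(1) show ?thesis
    by blast
qed

end

subsection \<open>Derivatives of a function with a tangent at every point\<close>

lemma derivative_from_expansion:
  fixes p :: "real \<Rightarrow> real"
  assumes "0 < e" and ex: "\<And>t. \<bar>t\<bar> \<le> e \<Longrightarrow> \<bar>p (s + t) - p s - t * a - t\<^sup>2 / 2 * v\<bar> \<le> C * \<bar>t\<bar> ^ 3"
  shows "(p has_real_derivative a) (at s)"
proof -
  have lim: "((\<lambda>t. \<bar>t\<bar> * (\<bar>v\<bar> / 2 + \<bar>C\<bar> * \<bar>t\<bar>)) \<longlongrightarrow> \<bar>0\<bar> * (\<bar>v\<bar> / 2 + \<bar>C\<bar> * \<bar>0\<bar>)) (at (0::real))"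
    by (intro tendsto_intros)
  have "((\<lambda>t. (p (s + t) - p s) / t - a) \<longlongrightarrow> 0) (at 0)"
  proof (rule Lim_null_comparison)
    show "((\<lambda>t. \<bar>t\<bar> * (\<bar>v\<bar> / 2 + \<bar>C\<bar> * \<bar>t\<bar>)) \<longlongrightarrow> 0) (at (0::real))"
      using lim by simp
    have "norm ((p (s + t) - p s) / t - a) \<le> \<bar>t\<bar> * (\<bar>v\<bar> / 2 + \<bar>C\<bar> * \<bar>t\<bar>)" if "t \<noteq> 0" "\<bar>t\<bar> < e" for t
    proof -
      have "\<bar>p (s + t) - p s - t * a\<bar> \<le> \<bar>t\<^sup>2 / 2 * v\<bar> + C * \<bar>t\<bar> ^ 3"
        using ex[of t] that by linarith
      also have "\<dots> \<le> \<bar>t\<^sup>2 / 2 * v\<bar> + \<bar>C\<bar> * \<bar>t\<bar> ^ 3"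
        by (intro add_left_mono mult_right_mono) auto
      also have "\<dots> = \<bar>t\<bar> * (\<bar>t\<bar> * (\<bar>v\<bar> / 2 + \<bar>C\<bar> * \<bar>t\<bar>))"
        by (simp add: abs_mult power2_eq_square power3_eq_cube algebra_simps)
      finally have "\<bar>p (s + t) - p s - t * a\<bar> / \<bar>t\<bar> \<le> \<bar>t\<bar> * (\<bar>v\<bar> / 2 + \<bar>C\<bar> * \<bar>t\<bar>)"
        using that by (simp add: divide_le_eq mult.commute)
      moreover have "(p (s + t) - p s) / t - a = (p (s + t) - p s - t * a) / t"
        using that by (simp add: field_simps)
      ultimately show ?thesis
        by (simp add: abs_divide)
    qed
    then show "\<forall>\<^sub>F t in at 0. norm ((p (s + t) - p s) / t - a) \<le> \<bar>t\<bar> * (\<bar>v\<bar> / 2 + \<bar>C\<bar> * \<bar>t\<bar>)"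
      unfolding eventually_at using \<open>0 < e\<close> by (intro exI[of _ e]) (simp add: dist_real_def)
  qed
  then show ?thesis
    unfolding DERIV_def by (rule LIM_zero_cancel)
qed

text \<open>Tangents at \<open>t\<close> tested at distance \<open>h = |t|\<^bsup>3/2\<^esup>\<close>, which balances the error
  \<open>|t|\<^sup>3 / h\<close> of the expansion at \<open>0\<close> against the error \<open>h\<close> of the difference quotient.\<close>

lemma second_derivative_from_tangents:
  fixes p \<alpha> :: "real \<Rightarrow> real"
  assumes tangent: "\<And>s r. p s + r * \<alpha> s \<le> p (s + r)"
    and "0 < e" "0 \<le> v" "0 \<le> C"
    and ex: "\<And>t. \<bar>t\<bar> \<le> e \<Longrightarrow> \<bar>p t - p 0 - t * \<alpha> 0 - t\<^sup>2 / 2 * v\<bar> \<le> C * \<bar>t\<bar> ^ 3"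
  shows "(\<alpha> has_real_derivative v) (at 0)"
proof -
  \<comment> \<open>\<open>v / 2\<close> comes from the quadratic term over a step \<open>h\<close>;
    \<open>9 * C\<close> is \<open>8 * C\<close> for the remainder within distance
    \<open>2 * \<bar>t\<bar>\<close> of 0 plus \<open>C\<close> for the one at \<open>t\<close>. In
    \<open>e'\<close>, the half of \<open>e\<close> keeps \<open>t + h\<close> and
    \<open>t - h\<close> in range, and \<open>1 / 2\<close> ensures
    \<open>h \<le> \<bar>t\<bar>\<close>.\<close>
  define M where "M = v / 2 + 9 * C"
  define e' where "e' = min (1 / 2) (e / 2)"
  have e': "0 < e'" "e' \<le> 1 / 2" "e' \<le> e / 2"
    using \<open>0 < e\<close> by (auto simp: e'_def)
  have bound: "\<bar>\<alpha> t - \<alpha> 0 - t * v\<bar> \<le> M * (\<bar>t\<bar> * sqrt \<bar>t\<bar>)" if "t \<noteq> 0" "\<bar>t\<bar> < e'" for t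
  proof -
    define h where "h = \<bar>t\<bar> * sqrt \<bar>t\<bar>"
    have h: "0 < h"
      using that by (simp add: h_def)
    have "sqrt \<bar>t\<bar> \<le> 1"
      using that e' by simp
    then have ht: "h \<le> \<bar>t\<bar>"
      using mult_left_mono[of "sqrt \<bar>t\<bar>" 1 "\<bar>t\<bar>"] by (simp add: h_def)
    have hh: "\<bar>t\<bar> ^ 3 = h * h"
      by (simp add: h_def power3_eq_cube mult_ac)
    define R where "R s = p s - p 0 - s * \<alpha> 0 - s\<^sup>2 / 2 * v" for s
    have R: "\<bar>R s\<bar> \<le> 8 * C * (h * h)" if s: "\<bar>s\<bar> \<le> 2 * \<bar>t\<bar>" for s
    proof -
      have "\<bar>R s\<bar> \<le> C * \<bar>s\<bar> ^ 3"
        unfolding R_def using s \<open>\<bar>t\<bar> < e'\<close> e' by (intro ex) linarith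
      also have "\<dots> \<le> C * (2 * \<bar>t\<bar>) ^ 3"
        using \<open>0 \<le> C\<close> s by (intro mult_left_mono power_mono) auto
      finally show ?thesis
        by (simp add: power_mult_distrib hh)
    qed
    have Rt: "\<bar>R t\<bar> \<le> C * (h * h)"
      unfolding R_def hh[symmetric] using that e' by (intro ex) linarith
    have diff: "p (t + r) - p t = r * (\<alpha> 0 + t * v + r * v / 2) + R (t + r) - R t" for r
      by (simp add: R_def power2_eq_square algebra_simps add_divide_distrib)
    have "h * \<alpha> t \<le> h * (\<alpha> 0 + t * v + M * h)"
    proof -
      have "h * \<alpha> t \<le> p (t + h) - p t"
        using tangent[of t h] by linarith
      also have "\<dots> \<le> h * (\<alpha> 0 + t * v + h * v / 2) + 8 * C * (h * h) + C * (h * h)"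
        unfolding diff using R[of "t + h"] Rt ht h by linarith
      also have "\<dots> = h * (\<alpha> 0 + t * v + M * h)"
        by (simp add: M_def algebra_simps)
      finally show ?thesis .
    qed
    then have upper: "\<alpha> t \<le> \<alpha> 0 + t * v + M * h"
      using h by simp
    have "h * (\<alpha> 0 + t * v - M * h) \<le> h * \<alpha> t"
    proof -
      have "h * (\<alpha> 0 + t * v - M * h) = h * (\<alpha> 0 + t * v - h * v / 2) - 8 * C * (h * h) - C * (h * h)"
        by (simp add: M_def algebra_simps)
      also have "\<dots> \<le> p t - p (t - h)"
      proof -
        have "\<bar>t - h\<bar> \<le> 2 * \<bar>t\<bar>"
          using ht h by linarith
        moreover have "p (t - h) - p t = R (t - h) - h * (\<alpha> 0 + t * v - h * v / 2) - R t"
          using diff[of "- h"] by simp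
        ultimately show ?thesis
          using R[of "t - h"] Rt by linarith
      qed
      also have "\<dots> \<le> h * \<alpha> t"
        using tangent[of t "- h"] by simp
      finally show ?thesis .
    qed
    then have "\<alpha> 0 + t * v - M * h \<le> \<alpha> t"
      using h by simp
    with upper show ?thesis
      by (simp add: h_def abs_le_iff)
  qed
  have "((\<lambda>t. (\<alpha> (0 + t) - \<alpha> 0) / t - v) \<longlongrightarrow> 0) (at 0)"
  proof (rule Lim_null_comparison)
    have "((\<lambda>t. M * sqrt \<bar>t\<bar>) \<longlongrightarrow> M * sqrt \<bar>0\<bar>) (at (0::real))"
      by (intro tendsto_intros)
    then show "((\<lambda>t. M * sqrt \<bar>t\<bar>) \<longlongrightarrow> 0) (at (0::real))"
      by simp
    have "norm ((\<alpha> (0 + t) - \<alpha> 0) / t - v) \<le> M * sqrt \<bar>t\<bar>" if "t \<noteq> 0" "\<bar>t\<bar> < e'" for t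
    proof -
      have "(\<alpha> (0 + t) - \<alpha> 0) / t - v = (\<alpha> t - \<alpha> 0 - t * v) / t"
        using that by (simp add: field_simps)
      then show ?thesis
        using bound[OF that] that by (simp add: abs_divide divide_le_eq mult_ac)
    qed
    then show "\<forall>\<^sub>F t in at 0. norm ((\<alpha> (0 + t) - \<alpha> 0) / t - v) \<le> M * sqrt \<bar>t\<bar>"
      unfolding eventually_at using e'(1) by (intro exI[of _ e']) (simp add: dist_real_def)
  qed
  then show ?thesis
    unfolding DERIV_def by (rule LIM_zero_cancel)
qed

subsection \<open>Differentiating the pressure\<close>

context full_shift
begin

lemma gibbs_decomposition:
  assumes "f \<in> LipM" "g \<in> LipM"
  shows "\<exists>F \<psi> q k. martingale_part \<nu> (normalization \<nu> f) F (gibbs_measure \<nu> f) \<psi> q \<and> cont k \<and>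
    g = (\<lambda>x. (LINT x|gibbs_measure \<nu> f. g x) + \<psi> x - k x + k (seq_shift x))"
proof -
  obtain F where "markov_potential \<nu> (normalization \<nu> f) F"
    using markov_normalization[OF assms(1)] by blast
  then interpret N: markov_potential \<nu> "normalization \<nu> f" F .
  show ?thesis
    using N.martingale_decomposition[OF dual_eigenprob_gibbs[OF assms(1)] assms(2)]
    unfolding fun_eq_iff by blast
qed

text \<open>The weight \<open>w * exp (t k)\<close> removes two coboundaries at once, the one in the
  normalization of \<open>f\<close> and the one in \<open>t g\<close>. Up to a scalar, the operator
  of \<open>f + t g\<close> is thus conjugate to the Markov operator tilted by
  \<open>exp (t \<psi>)\<close>.\<close>

lemma ruelle_perturbed:
  assumes f: "f \<in> LipM" and g: "g = (\<lambda>x. \<alpha> + \<psi> x - k x + k (seq_shift x))"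
  defines "w \<equiv> rpf_eigenfunction \<nu> f"
  shows "ruelle_op \<nu> (\<lambda>x. f x + t * g x) (\<lambda>x. w x * exp (t * k x) * p x) x
    = rpf_eigenvalue \<nu> f * exp (t * \<alpha>) * (w x * exp (t * k x))
      * ruelle_op \<nu> (normalization \<nu> f) (\<lambda>x. exp (t * \<psi> x) * p x) x"
proof -
  obtain \<rho> where "rpf_data \<nu> f (rpf_eigenvalue \<nu> f) w \<rho>"
    using rpf_data_rpf[OF f] unfolding w_def by blast
  then have c: "0 < rpf_eigenvalue \<nu> f" and w: "\<And>x. 0 < w x"
    by (auto simp: rpf_data_def)
  have "exp (f (prepend a x) + t * g (prepend a x)) * (w (prepend a x) * exp (t * k (prepend a x)) * p (prepend a x))
      = rpf_eigenvalue \<nu> f * exp (t * \<alpha>) * (w x * exp (t * k x))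
        * (exp (normalization \<nu> f (prepend a x)) * (exp (t * \<psi> (prepend a x)) * p (prepend a x)))" for a
  proof -
    have "exp (normalization \<nu> f (prepend a x))
        = exp (f (prepend a x)) * w (prepend a x) / w x / rpf_eigenvalue \<nu> f"
      unfolding normalization_def w_def[symmetric] using c w[of x] w[of "prepend a x"]
      by (simp add: exp_diff exp_add)
    moreover have "exp (t * g (prepend a x)) * exp (t * k (prepend a x))
        = exp (t * \<alpha>) * exp (t * \<psi> (prepend a x)) * exp (t * k x)"
      unfolding g by (simp add: algebra_simps flip: exp_add)
    ultimately have "rpf_eigenvalue \<nu> f * exp (t * \<alpha>) * (w x * exp (t * k x))
        * (exp (normalization \<nu> f (prepend a x)) * (exp (t * \<psi> (prepend a x)) * p (prepend a x)))
      = exp (f (prepend a x)) * w (prepend a x)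
        * (exp (t * g (prepend a x)) * exp (t * k (prepend a x))) * p (prepend a x)"
      using c w[of x] by simp
    note eq = this
    show ?thesis
      unfolding eq exp_add by (simp only: mult_ac)
  qed
  then show ?thesis
    unfolding ruelle_op_def by (simp only: integral_mult_right_zero)
qed

context
  fixes f g :: "(nat \<Rightarrow> 'a) \<Rightarrow> real" and \<alpha> t :: real and \<psi> k :: "(nat \<Rightarrow> 'a) \<Rightarrow> real"
  assumes f: "f \<in> LipM" and g: "g \<in> LipM" and psi: "cont \<psi>" and k: "cont k"
    and decomp: "g = (\<lambda>x. \<alpha> + \<psi> x - k x + k (seq_shift x))"
begin

text \<open>The eigenvalue of \<open>f + t g\<close> divided by that of \<open>f\<close> and by
  \<open>exp (t \<alpha>)\<close>, that is, the leading eigenvalue of the tilted Markov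
  operator.\<close>

abbreviation "growth \<equiv> exp (pressure \<nu> (\<lambda>x. f x + t * g x) - pressure \<nu> f - t * \<alpha>)"

lemma ft_Lip: "(\<lambda>x. f x + t * g x) \<in> LipM"
  by (rule Lip_add[OF f Lip_mult[OF Lip_const g]])

text \<open>Integrating the pointwise bounds against the eigenmeasure of \<open>f + t g\<close>
  replaces the operator by its eigenvalue, and the positive integral of the test function
  cancels.\<close>

lemma growth_sandwich:
  assumes p: "cont p" "\<And>x. 0 < p x"
    and a: "\<And>x. a * p x \<le> ruelle_op \<nu> (normalization \<nu> f) (\<lambda>x. exp (t * \<psi> x) * p x) x"
    and b: "\<And>x. ruelle_op \<nu> (normalization \<nu> f) (\<lambda>x. exp (t * \<psi> x) * p x) x \<le> b * p x"
  shows "a \<le> growth" "growth \<le> b"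
proof -
  let ?ft = "\<lambda>x. f x + t * g x"
  define c w where "c = rpf_eigenvalue \<nu> f" and "w = rpf_eigenfunction \<nu> f"
  obtain \<rho>0 where "rpf_data \<nu> f c w \<rho>0"
    using rpf_data_rpf[OF f] unfolding c_def w_def by blast
  then have c: "0 < c" and w: "w \<in> LipM" "\<And>x. 0 < w x"
    by (auto simp: rpf_data_def)
  define c' where "c' = rpf_eigenvalue \<nu> ?ft"
  obtain w' \<rho> where rho: "rpf_data \<nu> ?ft c' w' \<rho>"
    using rpf_data_rpf[OF ft_Lip] unfolding c'_def by blast
  then have c': "0 < c'" and prob: "prob_space \<rho>" "sets \<rho> = sets borel"
    by (auto simp: rpf_data_def dual_eigenprob_def)
  define W where "W x = w x * exp (t * k x) * p x" for x
  have W: "cont W" "\<And>x. 0 < W x"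
    unfolding W_def using w(2) p(2) by (auto intro!: continuous_intros Lip_cont[OF w(1)] k p(1))
  have LW: "ruelle_op \<nu> ?ft W x = c * exp (t * \<alpha>) * (w x * exp (t * k x))
      * ruelle_op \<nu> (normalization \<nu> f) (\<lambda>x. exp (t * \<psi> x) * p x) x" for x
    unfolding W_def c_def w_def by (rule ruelle_perturbed[OF f decomp])
  have pos: "0 < c * exp (t * \<alpha>) * (w x * exp (t * k x))" for x
    using c w(2)[of x] by simp
  have int: "integrable \<rho> W" "integrable \<rho> (ruelle_op \<nu> ?ft W)"
    by (intro integrable_Omega[OF prob] W(1) cont_ruelle Lip_cont[OF ft_Lip])+
  have eig: "(LINT x|\<rho>. ruelle_op \<nu> ?ft W x) = c' * (LINT x|\<rho>. W x)"
    using rho W(1) by (simp add: rpf_data_def dual_eigenprob_def)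
  have W_pos: "0 < (LINT x|\<rho>. W x)"
    by (rule integral_pos[OF prob W])
  have growth: "growth = c' / (c * exp (t * \<alpha>))"
    using c c' unfolding pressure_def c_def[symmetric] c'_def[symmetric] by (simp add: exp_diff)
  have "(LINT x|\<rho>. c * exp (t * \<alpha>) * a * W x) \<le> (LINT x|\<rho>. ruelle_op \<nu> ?ft W x)"
  proof (intro integral_mono integrable_mult_right int)
    show "c * exp (t * \<alpha>) * a * W x \<le> ruelle_op \<nu> ?ft W x" for x
      unfolding LW using mult_left_mono[OF a less_imp_le[OF pos], of x x] by (simp add: W_def mult_ac)
  qed
  then have "c * exp (t * \<alpha>) * a * (LINT x|\<rho>. W x) \<le> c' * (LINT x|\<rho>. W x)"
    unfolding eig by simp
  then show "a \<le> growth"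
    unfolding growth using W_pos c by (simp add: field_simps)
  have "(LINT x|\<rho>. ruelle_op \<nu> ?ft W x) \<le> (LINT x|\<rho>. c * exp (t * \<alpha>) * b * W x)"
  proof (intro integral_mono integrable_mult_right int)
    show "ruelle_op \<nu> ?ft W x \<le> c * exp (t * \<alpha>) * b * W x" for x
      unfolding LW using mult_left_mono[OF b less_imp_le[OF pos], of x x] by (simp add: W_def mult_ac)
  qed
  then have "c' * (LINT x|\<rho>. W x) \<le> c * exp (t * \<alpha>) * b * (LINT x|\<rho>. W x)"
    unfolding eig by simp
  then show "growth \<le> b"
    unfolding growth using W_pos c by (simp add: field_simps)
qed

text \<open>Jensen's inequality for the Markov operator \<open>L\<^sub>N\<close> applied to the exact eigenfunction,
  integrated against the invariant probability.\<close>

lemma growth_ge_1: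
  assumes L_psi: "\<And>x. ruelle_op \<nu> (normalization \<nu> f) \<psi> x = 0"
  shows "1 \<le> growth"
proof -
  obtain F where "markov_potential \<nu> (normalization \<nu> f) F"
    using markov_normalization[OF f] by blast
  then interpret N: markov_potential \<nu> "normalization \<nu> f" F .
  let ?ft = "\<lambda>x. f x + t * g x"
  define c w where "c = rpf_eigenvalue \<nu> f" and "w = rpf_eigenfunction \<nu> f"
  obtain \<rho>0 where "rpf_data \<nu> f c w \<rho>0"
    using rpf_data_rpf[OF f] unfolding c_def w_def by blast
  then have c: "0 < c" and w: "w \<in> LipM" "\<And>x. 0 < w x"
    by (auto simp: rpf_data_def)
  define c' where "c' = rpf_eigenvalue \<nu> ?ft"
  obtain w' \<rho> where "rpf_data \<nu> ?ft c' w' \<rho>"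
    using rpf_data_rpf[OF ft_Lip] unfolding c'_def by blast
  then have c': "0 < c'" and w': "w' \<in> LipM" "\<And>x. 0 < w' x"
    and eig': "\<And>x. ruelle_op \<nu> ?ft w' x = c' * w' x"
    by (auto simp: rpf_data_def)
  define p where "p x = w' x / (w x * exp (t * k x))" for x
  have ww: "w x * exp (t * k x) * p x = w' x" for x
    using w(2)[of x] by (simp add: p_def)
  have p: "0 < p x" for x
    using w(2)[of x] w'(2)[of x] by (simp add: p_def)
  have cp: "cont p"
    unfolding p_def using w(2)
    by (intro continuous_intros Lip_cont[OF w(1)] Lip_cont[OF w'(1)] k) (auto simp: less_imp_neq[symmetric])
  have growth: "growth = c' / (c * exp (t * \<alpha>))"
    using c c' unfolding pressure_def c_def[symmetric] c'_def[symmetric] by (simp add: exp_diff)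
  have eig: "ruelle_op \<nu> (normalization \<nu> f) (\<lambda>x. exp (t * \<psi> x) * p x) x = growth * p x" for x
  proof -
    have "c' * (w x * exp (t * k x) * p x) = c * exp (t * \<alpha>) * (w x * exp (t * k x))
        * ruelle_op \<nu> (normalization \<nu> f) (\<lambda>x. exp (t * \<psi> x) * p x) x"
      using ruelle_perturbed[OF f decomp, of t p x] eig'[of x] ww
      unfolding c_def[symmetric] w_def[symmetric] by simp
    then show ?thesis
      unfolding growth using c w(2)[of x] by (simp add: field_simps)
  qed
  define l where "l x = ln (p x)" for x
  have cl: "cont l"
    unfolding l_def using p by (intro continuous_on_ln cp) (auto simp: less_imp_neq[symmetric])
  have jensen: "N.L l x \<le> ln growth + l x" for x
  proof -
    \<comment> \<open>Jensen through the tangent of \<open>exp\<close> at \<open>A\<close>: the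
      affine minorant of \<open>exp (t * \<psi> y + l y)\<close> has image exactly
      \<open>exp A\<close> at \<open>x\<close>, because \<open>L \<psi> = 0\<close> and
      \<open>A\<close> is the mean of \<open>l\<close>.\<close>
    define A where "A = N.L l x"
    have "exp A * 1 = exp A * N.L (\<lambda>y. (1 - A) + (t * \<psi> y + l y)) x"
      using cl psi by (simp add: ruelle_add ruelle_scale N.f_cont L_psi A_def continuous_on_add continuous_on_mult)
    also have "\<dots> = N.L (\<lambda>y. exp A * ((1 - A) + (t * \<psi> y + l y))) x"
      by (rule ruelle_scale[symmetric])
    also have "\<dots> \<le> N.L (\<lambda>y. exp (t * \<psi> y) * p y) x"
    proof (intro ruelle_mono N.f_cont)
      fix y
      have "exp A * ((1 - A) + (t * \<psi> y + l y)) \<le> exp A * exp (t * \<psi> y + l y - A)"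
      proof (rule mult_left_mono)
        show "(1 - A) + (t * \<psi> y + l y) \<le> exp (t * \<psi> y + l y - A)"
          using exp_ge_add_one_self[of "t * \<psi> y + l y - A"] by linarith
      qed simp
      also have "\<dots> = exp (t * \<psi> y) * p y"
        using p[of y] by (simp add: l_def exp_diff exp_add)
      finally show "exp A * ((1 - A) + (t * \<psi> y + l y)) \<le> exp (t * \<psi> y) * p y" .
    qed (intro continuous_intros psi cl cp)+
    also have "\<dots> = growth * p x"
      by (rule eig)
    finally have "ln (exp A) \<le> ln (growth * p x)"
      by (subst ln_le_cancel_iff) (simp_all add: p)
    then show ?thesis
      using p[of x] by (simp add: ln_mult A_def l_def)
  qed
  have dual: "dual_eigenprob \<nu> (normalization \<nu> f) 1 (gibbs_measure \<nu> f)"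
    by (rule dual_eigenprob_gibbs[OF f])
  then have prob: "prob_space (gibbs_measure \<nu> f)" "sets (gibbs_measure \<nu> f) = sets borel"
    by (auto simp: dual_eigenprob_def)
  have int: "integrable (gibbs_measure \<nu> f) l" "integrable (gibbs_measure \<nu> f) (N.L l)"
    by (intro integrable_Omega[OF prob] cl cont_ruelle N.f_cont)+
  \<comment> \<open>By invariance the two integrals of \<open>l\<close> agree, and only
    \<open>ln growth\<close> is left.\<close>
  have "(LINT x|gibbs_measure \<nu> f. l x) = (LINT x|gibbs_measure \<nu> f. N.L l x)"
    using dual cl by (simp add: dual_eigenprob_def)
  also have "\<dots> \<le> (LINT x|gibbs_measure \<nu> f. ln growth + l x)"
    using prob by (intro integral_mono int Bochner_Integration.integrable_add jensen)
      (auto intro: finite_measure.integrable_const prob_space.finite_measure)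
  also have "\<dots> = ln growth + (LINT x|gibbs_measure \<nu> f. l x)"
    using int prob prob_space.prob_space[OF prob(1)] prob_space.finite_measure[OF prob(1)]
    by (subst Bochner_Integration.integral_add) (auto intro: finite_measure.integrable_const)
  finally have "0 \<le> ln growth"
    by linarith
  then show ?thesis
    by simp
qed

end

lemma pressure_tangent:
  assumes f: "f \<in> LipM" and g: "g \<in> LipM"
  shows "pressure \<nu> f + t * (LINT x|gibbs_measure \<nu> f. g x) \<le> pressure \<nu> (\<lambda>x. f x + t * g x)"
proof -
  define \<alpha> where "\<alpha> = (LINT x|gibbs_measure \<nu> f. g x)"
  obtain F \<psi> q k where "martingale_part \<nu> (normalization \<nu> f) F (gibbs_measure \<nu> f) \<psi> q"
    and k: "cont k" and dec: "g = (\<lambda>x. \<alpha> + \<psi> x - k x + k (seq_shift x))"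
    using gibbs_decomposition[OF f g] unfolding \<alpha>_def by blast
  then interpret P: martingale_part \<nu> "normalization \<nu> f" F "gibbs_measure \<nu> f" \<psi> q by blast
  have "1 \<le> exp (pressure \<nu> (\<lambda>x. f x + t * g x) - pressure \<nu> f - t * \<alpha>)"
    by (rule growth_ge_1[OF f g P.psi_cont k dec P.ruelle_psi])
  then show ?thesis
    unfolding \<alpha>_def by simp
qed

text \<open>For small \<open>t\<close> the approximate eigenfunction \<open>p\<close> is at least
  \<open>1 / 2\<close>, so its absolute error \<open>C * \<bar>t\<bar> ^ 3\<close> is a relative
  error \<open>r\<close>, and \<open>growth_sandwich\<close> puts \<open>growth\<close> within
  \<open>r\<close> of \<open>1 + \<kappa>\<close>. Taking logarithms costs a square of order
  \<open>t\<^sup>4\<close>.\<close>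

lemma pressure_expansion:
  assumes f: "f \<in> LipM" and g: "g \<in> LipM" and k: "cont k"
    and P: "martingale_part \<nu> (normalization \<nu> f) F \<mu> \<psi> q"
    and dec: "g = (\<lambda>x. \<alpha> + \<psi> x - k x + k (seq_shift x))"
  shows "\<exists>C e. 0 \<le> C \<and> 0 < e \<and> (\<forall>t. \<bar>t\<bar> \<le> e \<longrightarrow>
    \<bar>pressure \<nu> (\<lambda>x. f x + t * g x) - pressure \<nu> f - t * \<alpha> - t\<^sup>2 / 2 * (LINT x|\<mu>. (\<psi> x)\<^sup>2)\<bar>
      \<le> C * \<bar>t\<bar> ^ 3)"
proof -
  interpret P: martingale_part \<nu> "normalization \<nu> f" F \<mu> \<psi> q by (rule P)
  obtain C where C: "0 \<le> C" "\<And>t x. \<bar>t\<bar> \<le> 1 \<Longrightarrow>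
    \<bar>P.L (\<lambda>y. exp (t * \<psi> y) * (1 + t\<^sup>2 / 2 * q y)) x - (1 + t\<^sup>2 / 2 * P.\<sigma>2) * (1 + t\<^sup>2 / 2 * q x)\<bar>
      \<le> C * \<bar>t\<bar> ^ 3"
    using P.perturbed_eigen_real by blast
  obtain Q where Q: "Q > 0" "\<And>x. \<bar>q x\<bar> \<le> Q"
    using cont_bounded_real[OF P.q_cont] by blast
  define G where "G t = pressure \<nu> (\<lambda>x. f x + t * g x) - pressure \<nu> f - t * \<alpha>" for t
  define S where "S = P.\<sigma>2 / 2 + 2 * C"
  have S: "0 \<le> S"
    using P.sigma2_nonneg C(1) by (simp add: S_def)
  \<comment> \<open>\<open>e * Q \<le> 1\<close> keeps the eigenfunction above \<open>1 / 2\<close>.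
    As \<open>S * t\<^sup>2\<close> bounds \<open>\<bar>growth - 1\<bar>\<close>, the condition
    \<open>e * S \<le> 1 / 2\<close> admits the quadratic bound for the logarithm.\<close>
  define e where "e = 1 / (1 + Q + 2 * S)"
  have e: "0 < e" "e \<le> 1" "e * Q \<le> 1" "e * S \<le> 1 / 2"
    using Q(1) S by (auto simp: e_def field_simps)
  have "\<bar>G t - t\<^sup>2 / 2 * P.\<sigma>2\<bar> \<le> (2 * C + 2 * S\<^sup>2) * \<bar>t\<bar> ^ 3" if t: "\<bar>t\<bar> \<le> e" for t
  proof -
    define \<kappa> where "\<kappa> = t\<^sup>2 / 2 * P.\<sigma>2"
    define p where "p x = 1 + t\<^sup>2 / 2 * q x" for x
    have t1: "\<bar>t\<bar> \<le> 1"
      using t e by linarith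
    have t2: "t\<^sup>2 \<le> \<bar>t\<bar>"
      using mult_left_mono[OF t1 abs_ge_zero[of t]] by (simp add: power2_eq_square flip: abs_mult)
    have p_half: "1 / 2 \<le> p x" for x
    proof -
      have "\<bar>t\<^sup>2 / 2 * q x\<bar> \<le> e / 2 * Q"
        using t2 t Q(2)[of x] e by (auto simp: abs_mult intro!: mult_mono)
      then show ?thesis
        using e(3) unfolding p_def by linarith
    qed
    have cp: "cont p"
      unfolding p_def by (intro continuous_intros P.q_cont)
    have p_pos: "0 < p x" for x
      using p_half[of x] by linarith
    define r where "r = 2 * C * \<bar>t\<bar> ^ 3"
    have "C * \<bar>t\<bar> ^ 3 \<le> r * p x" for x
      using mult_left_mono[OF p_half, of r x] C(1) by (simp add: r_def)
    then have close: "\<bar>P.L (\<lambda>y. exp (t * \<psi> y) * p y) x - (1 + \<kappa>) * p x\<bar> \<le> r * p x" for x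
      using C(2)[OF t1, of x] unfolding p_def \<kappa>_def by (meson order_trans)
    have "(1 + \<kappa> - r) * p x \<le> P.L (\<lambda>y. exp (t * \<psi> y) * p y) x"
      "P.L (\<lambda>y. exp (t * \<psi> y) * p y) x \<le> (1 + \<kappa> + r) * p x" for x
      using close[of x] by (simp_all add: abs_le_iff algebra_simps)
    note sandwich = growth_sandwich[OF f g P.psi_cont k dec cp p_pos this]
    define y where "y = exp (G t) - 1"
    have y: "\<bar>y - \<kappa>\<bar> \<le> r"
      using sandwich unfolding y_def G_def by linarith
    have t3: "\<bar>t\<bar> ^ 3 \<le> t\<^sup>2"
      using mult_left_mono[OF t1 zero_le_power2[of t]] by (simp add: power3_eq_cube power2_eq_square)
    have "0 \<le> \<kappa>"
      using P.sigma2_nonneg by (simp add: \<kappa>_def)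
    then have "\<bar>y\<bar> \<le> \<kappa> + r"
      using y by linarith
    also have "\<dots> \<le> S * t\<^sup>2"
      using mult_left_mono[OF t3, of "2 * C"] C(1) by (simp add: \<kappa>_def r_def S_def algebra_simps)
    finally have yS: "\<bar>y\<bar> \<le> S * t\<^sup>2" .
    also have "\<dots> \<le> S * e"
      using t2 t S by (intro mult_left_mono) auto
    finally have "\<bar>y\<bar> \<le> 1 / 2"
      using e(4) by (simp add: mult.commute)
    then have "\<bar>ln (1 + y) - y\<bar> \<le> 2 * y\<^sup>2"
      by (rule abs_ln_one_plus_x_minus_x_bound)
    moreover have "ln (1 + y) = G t"
      by (simp add: y_def)
    moreover have "y\<^sup>2 \<le> S\<^sup>2 * \<bar>t\<bar> ^ 3"
    proof -
      have "y\<^sup>2 \<le> (S * t\<^sup>2)\<^sup>2"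
        using power_mono[OF yS, of 2] by simp
      also have "\<dots> = S\<^sup>2 * (\<bar>t\<bar> ^ 3 * \<bar>t\<bar>)"
        by (simp add: power_mult_distrib power2_eq_square power3_eq_cube)
      also have "\<dots> \<le> S\<^sup>2 * (\<bar>t\<bar> ^ 3 * 1)"
        using t1 by (intro mult_left_mono) auto
      finally show ?thesis by simp
    qed
    ultimately show ?thesis
      using y unfolding \<kappa>_def[symmetric] by (simp add: r_def algebra_simps)
  qed
  then show ?thesis
    unfolding G_def P.\<sigma>2_def using C(1) e(1)
    by (intro exI[of _ "2 * C + 2 * S\<^sup>2"] exI[of _ e]) auto
qed

text \<open>The second derivative presupposes the first one as a function. The decomposition is
  therefore repeated with \<open>h s\<close> in place of \<open>f\<close> for every
  \<open>s\<close>; it identifies the derivative at \<open>s\<close> as the Gibbs mean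
  \<open>A s\<close>, which is also the slope of a supporting line of the pressure.\<close>

theorem pressure_derivatives:
  assumes f: "f \<in> LipM" and g: "g \<in> LipM" and k: "cont k"
    and P: "martingale_part \<nu> (normalization \<nu> f) F (gibbs_measure \<nu> f) \<psi> q"
    and dec: "g = (\<lambda>x. \<alpha> + \<psi> x - k x + k (seq_shift x))"
    and \<alpha>: "\<alpha> = (LINT x|gibbs_measure \<nu> f. g x)"
    and \<beta>: "\<And>t. \<beta> t = pressure \<nu> (\<lambda>x. f x + t * g x) - pressure \<nu> f"
  shows "deriv \<beta> 0 = \<alpha>" "deriv (deriv \<beta>) 0 = (LINT x|gibbs_measure \<nu> f. (\<psi> x)\<^sup>2)"
proof -
  define p where "p t = pressure \<nu> (\<lambda>x. f x + t * g x)" for t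
  define h where "h s = (\<lambda>x. f x + s * g x)" for s
  define A where "A s = (LINT x|gibbs_measure \<nu> (h s). g x)" for s
  have h: "h s \<in> LipM" for s
    unfolding h_def by (rule Lip_add[OF f Lip_mult[OF Lip_const g]])
  have p_h: "pressure \<nu> (\<lambda>x. h s x + t * g x) = p (s + t)" "pressure \<nu> (h s) = p s" for s t
    by (simp_all add: p_def h_def algebra_simps)
  have h0: "h 0 = f"
    by (simp add: h_def)
  have A0: "A 0 = \<alpha>"
    by (simp add: A_def h0 \<alpha>)
  have tangent: "p s + r * A s \<le> p (s + r)" for s r
    using pressure_tangent[OF h g, of s r] by (simp add: p_h A_def)
  have "(p has_real_derivative A s) (at s)" for s
  proof -
    obtain F' \<psi>' q' k' where P': "martingale_part \<nu> (normalization \<nu> (h s)) F' (gibbs_measure \<nu> (h s)) \<psi>' q'"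
      and k': "cont k'" and dec': "g = (\<lambda>x. A s + \<psi>' x - k' x + k' (seq_shift x))"
      using gibbs_decomposition[OF h g, of s] unfolding A_def by blast
    define v where "v = (LINT x|gibbs_measure \<nu> (h s). (\<psi>' x)\<^sup>2)"
    obtain C e where "0 < e" "\<And>t. \<bar>t\<bar> \<le> e \<Longrightarrow> \<bar>p (s + t) - p s - t * A s - t\<^sup>2 / 2 * v\<bar> \<le> C * \<bar>t\<bar> ^ 3"
      using pressure_expansion[OF h g k' P' dec'] unfolding p_h v_def by blast
    then show ?thesis
      by (rule derivative_from_expansion)
  qed
  moreover have beta_p: "\<beta> = (\<lambda>t. p t - p 0)"
    using \<beta> by (auto simp: p_def)
  ultimately have "(\<beta> has_real_derivative A s) (at s)" for s
    by (auto intro!: derivative_eq_intros)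
  then have deriv_beta: "deriv \<beta> = A"
    by (intro ext DERIV_imp_deriv)
  then show "deriv \<beta> 0 = \<alpha>"
    by (simp add: A0)
  define v where "v = (LINT x|gibbs_measure \<nu> f. (\<psi> x)\<^sup>2)"
  obtain C e where Ce: "0 \<le> C" "0 < e"
    "\<And>t. \<bar>t\<bar> \<le> e \<Longrightarrow> \<bar>p t - p 0 - t * A 0 - t\<^sup>2 / 2 * v\<bar> \<le> C * \<bar>t\<bar> ^ 3"
    using pressure_expansion[OF f g k P dec] p_h(2)[of 0] unfolding p_def[symmetric] v_def A0 h0 by auto
  have "0 \<le> v"
    unfolding v_def by (intro Bochner_Integration.integral_nonneg) simp
  then have "(A has_real_derivative v) (at 0)"
    using second_derivative_from_tangents[OF tangent Ce(2) _ Ce(1,3)] by blast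
  then show "deriv (deriv \<beta>) 0 = (LINT x|gibbs_measure \<nu> f. (\<psi> x)\<^sup>2)"
    unfolding deriv_beta v_def by (rule DERIV_imp_deriv)
qed

text \<open>If \<open>\<psi>\<close> vanished identically, the decomposition would exhibit
  \<open>g\<close> as a coboundary plus a constant. Full support excludes the intermediate case that
  \<open>\<psi>\<close> vanishes almost everywhere but not everywhere.\<close>

lemma variance_pos:
  assumes P: "martingale_part \<nu> h F \<mu> \<psi> q" and k: "cont k"
    and dec: "g = (\<lambda>x. \<alpha> + \<psi> x - k x + k (seq_shift x))"
    and "\<not> coboundary_to_constant g"
  shows "0 < (LINT x|\<mu>. (\<psi> x)\<^sup>2)"
proof -
  interpret P: martingale_part \<nu> h F \<mu> \<psi> q by (rule P)
  have "\<exists>y. \<psi> y \<noteq> 0"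
  proof (rule ccontr)
    assume "\<not> ?thesis"
    then have "g x = (- k x) - (- k (seq_shift x)) + \<alpha>" for x
      using fun_cong[OF dec, of x] by simp
    moreover have "cont (\<lambda>x. - k x)"
      by (intro continuous_intros k)
    ultimately have "coboundary_to_constant g"
      unfolding coboundary_to_constant_def by (intro exI[of _ "\<lambda>x. - k x"] exI[of _ \<alpha>]) simp
    with assms(4) show False ..
  qed
  then obtain y where "\<psi> y \<noteq> 0" by blast
  then show ?thesis
    by (intro P.full_support[OF P.mu, where y=y] continuous_intros P.psi_cont) auto
qed

end

subsection \<open>Weak convergence to a Gaussian with unbounded test functions\<close>

text \<open>The parameter is the standard deviation; a variance therefore enters through
  \<open>sqrt\<close>.\<close>

abbreviation (input) normal_distribution :: "real \<Rightarrow> real measure" where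
  "normal_distribution \<sigma> \<equiv> density lborel (normal_density 0 \<sigma>)"

lemma real_distribution_normal: "0 < \<sigma> \<Longrightarrow> real_distribution (normal_distribution \<sigma>)"
  using prob_space_normal_density by (auto simp: real_distribution_def real_distribution_axioms_def)

lemma distr_std_normal:
  assumes "0 < \<sigma>"
  shows "distr std_normal_distribution borel (\<lambda>x. \<sigma> * x) = normal_distribution \<sigma>"
proof -
  interpret prob_space std_normal_distribution
    by (rule prob_space_normal_density) simp
  have "distributed std_normal_distribution lborel (\<lambda>x. x) std_normal_density"
    by (auto simp: distributed_def distr_id2 normal_density_nonneg)
  from normal_density_affine[OF this, of \<sigma> 0] assms
  have "distr std_normal_distribution lborel (\<lambda>x. \<sigma> * x) = normal_distribution \<sigma>"
    by (simp add: distributed_def)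
  moreover have "distr std_normal_distribution lborel (\<lambda>x. \<sigma> * x) = distr std_normal_distribution borel (\<lambda>x. \<sigma> * x)"
    by (rule distr_cong) auto
  ultimately show ?thesis
    by simp
qed

lemma char_normal_distribution:
  assumes "0 < \<sigma>"
  shows "char (normal_distribution \<sigma>) t = of_real (exp (- (t\<^sup>2 * \<sigma>\<^sup>2) / 2))"
proof -
  have "char (normal_distribution \<sigma>) t = char std_normal_distribution (t * \<sigma>)"
    unfolding distr_std_normal[OF assms, symmetric] char_def
    by (subst integral_distr) (auto simp: mult.assoc)
  then show ?thesis
    by (simp add: char_std_normal_distribution power_mult_distrib)
qed

text \<open>At the extreme rate \<open>1 / (4 * \<sigma>\<^sup>2)\<close> the factor halves the
  exponent of the density, leaving a multiple of the Gaussian density with variance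
  \<open>2 * \<sigma>\<^sup>2\<close>.\<close>

lemma integrable_normal_exp_square:
  assumes "0 < \<sigma>" "\<delta> \<le> 1 / (4 * \<sigma>\<^sup>2)"
  shows "integrable (normal_distribution \<sigma>) (\<lambda>x. exp (\<delta> * x\<^sup>2))"
proof (subst integrable_density)
  define \<tau> where "\<tau> = sqrt 2 * \<sigma>"
  have "0 < \<tau>"
    using assms(1) by (simp add: \<tau>_def)
  have tau: "\<tau>\<^sup>2 = 2 * \<sigma>\<^sup>2"
    by (simp add: \<tau>_def power_mult_distrib)
  define c where "c = sqrt (2 * pi * \<tau>\<^sup>2) / sqrt (2 * pi * \<sigma>\<^sup>2)"
  show "integrable lborel (\<lambda>x. normal_density 0 \<sigma> x *\<^sub>R exp (\<delta> * x\<^sup>2))"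
  proof (rule Bochner_Integration.integrable_bound)
    show "integrable lborel (\<lambda>x. c * normal_density 0 \<tau> x)"
      using \<open>0 < \<tau>\<close> by (intro integrable_mult_right integrable_normal_density)
    show "AE x in lborel. norm (normal_density 0 \<sigma> x *\<^sub>R exp (\<delta> * x\<^sup>2)) \<le> norm (c * normal_density 0 \<tau> x)"
    proof (rule AE_I2)
      fix x :: real
      have "normal_density 0 \<sigma> x * exp (\<delta> * x\<^sup>2)
          \<le> normal_density 0 \<sigma> x * exp (1 / (4 * \<sigma>\<^sup>2) * x\<^sup>2)"
        using mult_right_mono[OF assms(2) zero_le_power2[of x]]
        by (intro mult_left_mono normal_density_nonneg) simp
      also have "\<dots> = 1 / sqrt (2 * pi * \<sigma>\<^sup>2) * (exp (- (x\<^sup>2 / (2 * \<sigma>\<^sup>2))) * exp (1 / (4 * \<sigma>\<^sup>2) * x\<^sup>2))"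
        by (simp add: normal_density_def)
      also have "\<dots> = 1 / sqrt (2 * pi * \<sigma>\<^sup>2) * exp (- (x\<^sup>2 / (2 * \<sigma>\<^sup>2)) + 1 / (4 * \<sigma>\<^sup>2) * x\<^sup>2)"
        by (simp only: exp_add)
      also have "- (x\<^sup>2 / (2 * \<sigma>\<^sup>2)) + 1 / (4 * \<sigma>\<^sup>2) * x\<^sup>2 = - (x\<^sup>2 / (2 * \<tau>\<^sup>2))"
        using assms(1) by (simp add: tau field_simps)
      also have "1 / sqrt (2 * pi * \<sigma>\<^sup>2) * exp (- (x\<^sup>2 / (2 * \<tau>\<^sup>2))) = c * normal_density 0 \<tau> x"
        using assms(1) by (simp add: normal_density_def c_def tau)
      finally show "norm (normal_density 0 \<sigma> x *\<^sub>R exp (\<delta> * x\<^sup>2)) \<le> norm (c * normal_density 0 \<tau> x)"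
        using normal_density_nonneg[of 0 \<sigma> x] by simp
    qed
  qed simp
qed (auto simp: normal_density_nonneg)

lemma emeasure_normal_negligible:
  assumes "negligible Z" "Z \<in> sets borel"
  shows "emeasure (normal_distribution \<sigma>) Z = 0"
proof -
  have "Z \<in> null_sets lborel"
    using assms by (simp add: negligible_iff_null_sets null_sets_completion_iff)
  then have "AE x in lborel. x \<notin> Z"
    by (rule AE_not_in)
  then have "Z \<in> null_sets (normal_distribution \<sigma>)"
    using assms(2) by (subst null_sets_density_iff) auto
  then show ?thesis
    by (simp add: null_sets_def)
qed

lemma test_function_measurable:
  assumes "simple_test_function u \<or> continuous_test_function u"
  shows "u \<in> borel_measurable borel"
  using assms
proof
  assume "simple_test_function u"
  then obtain k :: nat and a A where A: "\<And>j. j \<in> {1..k} \<Longrightarrow> A j \<in> sets borel"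
    and u_def: "u = (\<lambda>t. \<Sum>j=1..k. a j * indicator (A j) t)"
    unfolding simple_test_function_def by blast
  show ?thesis
    unfolding u_def using A by measurable
next
  assume "continuous_test_function u"
  then show ?thesis
    by (auto simp: continuous_test_function_def intro: borel_measurable_continuous_onI)
qed

text \<open>The discontinuities of \<open>u\<close> lie in a finite union of negligible frontiers,
  which is null for the absolutely continuous limit law.\<close>

lemma simple_test_function_convergence:
  assumes M: "\<And>n. real_distribution (M n)" and w: "weak_conv_m M (normal_distribution \<sigma>)"
    and "0 < \<sigma>"
    and u: "simple_test_function u"
  shows "(\<lambda>n. LINT x|M n. u x) \<longlonglongrightarrow> (LINT x|normal_distribution \<sigma>. u x)"
proof -
  obtain k :: nat and a A where A: "\<And>j. j \<in> {1..k} \<Longrightarrow> A j \<in> sets borel"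
    "\<And>j. j \<in> {1..k} \<Longrightarrow> negligible (frontier (A j))"
    and u_def: "u = (\<lambda>t. \<Sum>j=1..k. a j * indicator (A j) t)"
    using u unfolding simple_test_function_def by blast
  define Z where "Z = (\<Union>j\<in>{1..k}. frontier (A j))"
  have "negligible Z" "Z \<in> sets borel"
    unfolding Z_def using A(2) by (auto intro!: negligible_Union borel_closed closed_UN)
  then have Z0: "emeasure (normal_distribution \<sigma>) Z = 0"
    by (rule emeasure_normal_negligible)
  have "{x. \<not> isCont u x} \<subseteq> Z"
  proof
    fix x assume x: "x \<in> {x. \<not> isCont u x}"
    show "x \<in> Z"
    proof (rule ccontr)
      assume "x \<notin> Z"
      then have "isCont (indicator (A j) :: real \<Rightarrow> real) x" if "j \<in> {1..k}" for j
        using that by (auto simp: Z_def isCont_indicator)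
      then have "isCont u x"
        unfolding u_def by (intro continuous_intros) auto
      with x show False by simp
    qed
  qed
  then have discont: "emeasure (normal_distribution \<sigma>) {x. \<not> isCont u x} = 0"
    using emeasure_mono[of "{x. \<not> isCont u x}" Z "normal_distribution \<sigma>"] \<open>Z \<in> sets borel\<close> Z0 by simp
  have "norm (u x) \<le> (\<Sum>j=1..k. \<bar>a j\<bar>)" for x
    unfolding u_def real_norm_def
    by (rule order_trans[OF sum_abs sum_mono]) (auto simp: abs_mult indicator_def)
  moreover have "u \<in> borel_measurable borel"
    using u by (intro test_function_measurable) blast
  ultimately show ?thesis
    using weak_conv_imp_bdd_ae_continuous_conv[OF M real_distribution_normal[OF \<open>0 < \<sigma>\<close>] w discont] by blast
qed

text \<open>Clamping the argument to the interval from \<open>- R\<close> to \<open>R\<close> makes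
  \<open>u\<close> bounded, where weak convergence applies. The error is at most a multiple of
  \<open>exp (- (\<epsilon> / 2 * R\<^sup>2))\<close> times the moment of \<open>h\<close>, which is
  bounded uniformly in \<open>n\<close>.\<close>

lemma continuous_test_function_convergence:
  assumes M: "\<And>n. real_distribution (M n)" and w: "weak_conv_m M (normal_distribution \<sigma>)"
    and "0 < \<sigma>" "0 < \<delta>"
    and int: "\<And>n. integrable (M n) (\<lambda>x. exp (\<delta> * x\<^sup>2))"
    and bound: "\<And>n. (LINT x|M n. exp (\<delta> * x\<^sup>2)) \<le> B"
    and u: "continuous_test_function u"
  shows "(\<lambda>n. LINT x|M n. u x) \<longlonglongrightarrow> (LINT x|normal_distribution \<sigma>. u x)"
proof -
  \<comment> \<open>Small enough for \<open>h\<close> to have controlled integrals under every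
    \<open>M n\<close> and under the Gaussian.\<close>
  define \<epsilon> where "\<epsilon> = min \<delta> (1 / (4 * \<sigma>\<^sup>2))"
  have eps: "0 < \<epsilon>" "\<epsilon> \<le> \<delta>" "\<epsilon> \<le> 1 / (4 * \<sigma>\<^sup>2)"
    using \<open>0 < \<delta>\<close> \<open>0 < \<sigma>\<close> by (auto simp: \<epsilon>_def)
  have cu: "continuous_on UNIV u"
    using u by (simp add: continuous_test_function_def)
  have mu: "u \<in> borel_measurable borel"
    using u by (intro test_function_measurable) blast
  \<comment> \<open>Growth at half the rate of \<open>h\<close> leaves a surplus that decays in
    \<open>R\<close>.\<close>
  obtain C where C: "\<And>t. \<bar>u t\<bar> \<le> C * exp (\<epsilon> / 2 * t\<^sup>2)"
  proof -
    have "\<exists>C. \<forall>t. \<bar>u t\<bar> \<le> C * exp (e * t\<^sup>2)" if "0 < e" for e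
      using u that unfolding continuous_test_function_def by blast
    from this[of "\<epsilon> / 2"] eps(1) that show thesis
      by (metis half_gt_zero)
  qed
  have C0: "0 \<le> C"
    using C[of 0] by simp
  define h where "h x = exp (\<epsilon> * x\<^sup>2)" for x :: real
  define B' where "B' = max B (LINT x|normal_distribution \<sigma>. h x)"
  have h_le: "h x \<le> exp (\<delta> * x\<^sup>2)" for x
    using eps(2) by (simp add: h_def mult_right_mono)
  have h_int: "integrable (M n) h" for n
  proof (rule Bochner_Integration.integrable_bound[OF int])
    show "h \<in> borel_measurable (M n)"
      unfolding h_def measurable_cong_sets[OF real_distribution.events_eq_borel[OF M] refl] by measurable
    show "AE x in M n. norm (h x) \<le> norm (exp (\<delta> * x\<^sup>2))"
      by (intro AE_I2) (use h_le in \<open>simp add: h_def\<close>)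
  qed
  have h_M: "(LINT x|M n. h x) \<le> B'" for n
  proof -
    have "(LINT x|M n. h x) \<le> (LINT x|M n. exp (\<delta> * x\<^sup>2))"
      by (intro integral_mono h_int int h_le)
    then show ?thesis
      using bound[of n] by (simp add: B'_def)
  qed
  have h_int': "integrable (normal_distribution \<sigma>) h"
    unfolding h_def by (rule integrable_normal_exp_square[OF \<open>0 < \<sigma>\<close> eps(3)])
  have h_N: "(LINT x|normal_distribution \<sigma>. h x) \<le> B'"
    by (simp add: B'_def)
  define v where "v R x = u (max (- R) (min R x))" for R x :: real
  have cv: "continuous_on UNIV (v R)" for R
    unfolding v_def by (intro continuous_on_compose2[OF cu] continuous_intros) auto
  have v_bound: "\<bar>v R x\<bar> \<le> C * exp (\<epsilon> / 2 * R\<^sup>2)" if "0 \<le> R" for R x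
  proof -
    have "(max (- R) (min R x))\<^sup>2 \<le> R\<^sup>2"
      using that by (subst abs_le_square_iff[symmetric]) auto
    then show ?thesis
      unfolding v_def using C0 eps(1)
      by (intro order_trans[OF C]) (auto intro!: mult_left_mono)
  qed
  \<comment> \<open>One estimate serves both terms of the error: \<open>s\<close> is either the
    point \<open>x\<close> itself or its clamped image.\<close>
  have exp_large: "C * exp (\<epsilon> / 2 * s\<^sup>2) \<le> C * exp (- (\<epsilon> / 2 * R\<^sup>2)) * h x"
    if "0 \<le> R" "R \<le> \<bar>x\<bar>" "s = x \<or> \<bar>s\<bar> = R" for s x R
  proof -
    have "R\<^sup>2 \<le> x\<^sup>2"
      using that by (simp add: abs_le_square_iff[symmetric])
    moreover have "s\<^sup>2 = x\<^sup>2 \<or> s\<^sup>2 = R\<^sup>2"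
      using that(3) power2_abs[of s] by auto
    ultimately have "s\<^sup>2 \<le> 2 * x\<^sup>2 - R\<^sup>2"
      by linarith
    then have "\<epsilon> / 2 * s\<^sup>2 \<le> \<epsilon> / 2 * (2 * x\<^sup>2 - R\<^sup>2)"
      using eps(1) by (intro mult_left_mono) auto
    then have "\<epsilon> / 2 * s\<^sup>2 \<le> - (\<epsilon> / 2 * R\<^sup>2) + \<epsilon> * x\<^sup>2"
      by (simp add: algebra_simps)
    then show ?thesis
      using C0 unfolding h_def by (simp add: mult_left_mono mult.assoc flip: exp_add)
  qed
  have uv: "\<bar>u x - v R x\<bar> \<le> 2 * C * exp (- (\<epsilon> / 2 * R\<^sup>2)) * h x" if "0 \<le> R" for x R
  proof (cases "\<bar>x\<bar> \<le> R")
    case True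
    then show ?thesis
      using C0 by (auto simp: v_def h_def min_def max_def)
  next
    case False
    define s where "s = max (- R) (min R x)"
    have s: "\<bar>s\<bar> = R"
      using False that by (auto simp: s_def)
    have "\<bar>u x - v R x\<bar> \<le> \<bar>u x\<bar> + \<bar>u s\<bar>"
      by (simp add: v_def s_def)
    also have "\<dots> \<le> C * exp (\<epsilon> / 2 * x\<^sup>2) + C * exp (\<epsilon> / 2 * s\<^sup>2)"
      by (intro add_mono C)
    also have "\<dots> \<le> C * exp (- (\<epsilon> / 2 * R\<^sup>2)) * h x + C * exp (- (\<epsilon> / 2 * R\<^sup>2)) * h x"
      using False that s by (intro add_mono exp_large) auto
    finally show ?thesis
      by (simp add: mult_ac)
  qed
  have gap: "\<bar>(LINT x|P. u x) - (LINT x|P. v R x)\<bar> \<le> 2 * C * exp (- (\<epsilon> / 2 * R\<^sup>2)) * B'"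
    if P: "real_distribution P" "integrable P h" "(LINT x|P. h x) \<le> B'" and "0 \<le> R" for P R
  proof -
    interpret real_distribution P by (rule P(1))
    have v_int: "integrable P (v R)"
    proof (rule integrable_const_bound)
      show "v R \<in> borel_measurable P"
        using borel_measurable_continuous_onI[OF cv] by simp
      show "AE x in P. norm (v R x) \<le> C * exp (\<epsilon> / 2 * R\<^sup>2)"
        unfolding real_norm_def by (intro AE_I2 v_bound \<open>0 \<le> R\<close>)
    qed
    have u_int: "integrable P u"
    proof (rule Bochner_Integration.integrable_bound)
      show "integrable P (\<lambda>x. C * h x)"
        using P(2) by simp
      have "\<bar>u x\<bar> \<le> \<bar>C * h x\<bar>" for x
      proof -
        have "C * exp (\<epsilon> / 2 * x\<^sup>2) \<le> C * h x"
          unfolding h_def using C0 eps(1) by (intro mult_left_mono) auto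
        then show ?thesis
          using C[of x] by linarith
      qed
      then show "AE x in P. norm (u x) \<le> norm (C * h x)"
        by simp
    qed (use mu in simp)
    have "\<bar>(LINT x|P. u x) - (LINT x|P. v R x)\<bar> = \<bar>LINT x|P. u x - v R x\<bar>"
      using u_int v_int by simp
    also have "\<dots> \<le> (LINT x|P. \<bar>u x - v R x\<bar>)"
      by (rule integral_abs_bound)
    also have "\<dots> \<le> (LINT x|P. 2 * C * exp (- (\<epsilon> / 2 * R\<^sup>2)) * h x)"
      using u_int v_int P(2) uv[OF \<open>0 \<le> R\<close>] by (intro integral_mono) auto
    also have "\<dots> = 2 * C * exp (- (\<epsilon> / 2 * R\<^sup>2)) * (LINT x|P. h x)"
      by simp
    also have "\<dots> \<le> 2 * C * exp (- (\<epsilon> / 2 * R\<^sup>2)) * B'"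
      using C0 P(3) by (intro mult_left_mono) auto
    finally show ?thesis .
  qed
  have conv_v: "(\<lambda>n. LINT x|M n. v R x) \<longlonglongrightarrow> (LINT x|normal_distribution \<sigma>. v R x)" if "0 \<le> R" for R
  proof (rule weak_conv_imp_integral_bdd_continuous_conv[OF M real_distribution_normal[OF \<open>0 < \<sigma>\<close>] w])
    show "isCont (v R) x" for x
      using cv by (simp add: continuous_on_eq_continuous_at)
    show "norm (v R x) \<le> C * exp (\<epsilon> / 2 * R\<^sup>2)" for x
      using v_bound[OF that] by simp
  qed
  show ?thesis
  proof (rule LIMSEQ_I)
    fix r :: real assume "0 < r"
    have "((\<lambda>R. 2 * C * exp (- (\<epsilon> / 2 * R\<^sup>2)) * B') \<longlongrightarrow> 2 * C * 0 * B') at_top"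
    proof (intro tendsto_intros filterlim_compose[OF exp_at_bot])
      have "filterlim (\<lambda>R::real. \<epsilon> / 2 * R\<^sup>2) at_top at_top"
        using eps(1) by (intro filterlim_tendsto_pos_mult_at_top[OF tendsto_const] filterlim_pow_at_top filterlim_ident) auto
      then show "filterlim (\<lambda>R::real. - (\<epsilon> / 2 * R\<^sup>2)) at_bot at_top"
        by (simp add: filterlim_uminus_at_top)
    qed
    then have "\<forall>\<^sub>F R in at_top. 2 * C * exp (- (\<epsilon> / 2 * R\<^sup>2)) * B' < r / 3"
      using \<open>0 < r\<close> by (intro order_tendstoD(2)) auto
    then have "\<forall>\<^sub>F R in at_top. 2 * C * exp (- (\<epsilon> / 2 * R\<^sup>2)) * B' < r / 3 \<and> 0 \<le> R"
      using eventually_ge_at_top[of 0] by eventually_elim auto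
    then obtain R where R: "2 * C * exp (- (\<epsilon> / 2 * R\<^sup>2)) * B' < r / 3" "0 \<le> R"
      using eventually_happens[of _ "at_top :: real filter"] by (auto simp: trivial_limit_at_top_linorder)
    obtain n0 where n0: "\<And>n. n0 \<le> n \<Longrightarrow> \<bar>(LINT x|M n. v R x) - (LINT x|normal_distribution \<sigma>. v R x)\<bar> < r / 3"
      using LIMSEQ_D[OF conv_v[OF R(2)], of "r / 3"] \<open>0 < r\<close> by auto
    show "\<exists>no. \<forall>n\<ge>no. norm ((LINT x|M n. u x) - (LINT x|normal_distribution \<sigma>. u x)) < r"
    proof (intro exI allI impI)
      fix n assume "n0 \<le> n"
      from n0[OF this] gap[OF M h_int h_M R(2), of n]
        gap[OF real_distribution_normal[OF \<open>0 < \<sigma>\<close>] h_int' h_N R(2)] R(1)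
      show "norm ((LINT x|M n. u x) - (LINT x|normal_distribution \<sigma>. u x)) < r"
        unfolding real_norm_def by linarith
    qed
  qed
qed

text \<open>A discrete Gaussian average of exponentials dominates \<open>exp (\<delta> x\<^sup>2)\<close>.\<close>

lemma (in prob_space) exp_square_bound:
  fixes X :: "'a \<Rightarrow> real"
  assumes X: "X \<in> borel_measurable M" and m: "\<And>x. \<bar>X x\<bar> \<le> m"
    and mgf: "\<And>s. expectation (\<lambda>x. exp (s * X x)) \<le> Q * exp (s\<^sup>2 * b)"
    and "0 \<le> Q" "0 < \<delta>" "8 * \<delta> * b \<le> 1"
  shows "expectation (\<lambda>x. exp (\<delta> * (X x)\<^sup>2)) \<le> 2 * Q * exp \<delta> / (1 - exp (- \<delta> / 2))"
proof -
  note [measurable] = X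
  \<comment> \<open>Since \<open>X\<close> is bounded, finitely many terms suffice; the final bound
    does not depend on their number.\<close>
  define K where "K = nat \<lfloor>m\<rfloor>"
  have int: "integrable M (\<lambda>x. exp (s * X x))" for s
  proof (rule integrable_const_bound)
    have "s * X x \<le> \<bar>s\<bar> * m" for x
      using mult_left_mono[OF m[of x] abs_ge_zero[of s]] abs_ge_self[of "s * X x"] by (simp add: abs_mult)
    then show "AE x in M. norm (exp (s * X x)) \<le> exp (\<bar>s\<bar> * m)"
      by simp
  qed simp
  define T where "T k x = exp (- (\<delta> * (real (k::nat))\<^sup>2)) * (exp (2 * \<delta> * real k * X x) + exp (- (2 * \<delta> * real k) * X x))" for k x
  define G where "G x = (\<Sum>k\<le>K. T k x)" for x
  have int_term: "integrable M (T k)" for k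
    unfolding T_def by (intro integrable_mult_right Bochner_Integration.integrable_add int)
  have int_G: "integrable M G"
    unfolding G_def by (intro Bochner_Integration.integrable_sum int_term)
  have pointwise: "exp (\<delta> * (X x)\<^sup>2) \<le> exp \<delta> * G x" for x
  proof -
    \<comment> \<open>Round \<open>\<bar>X x\<bar>\<close> down to an integer \<open>k\<close> and
      expand \<open>(\<bar>X x\<bar> - k)\<^sup>2 \<le> 1\<close>: the square is bounded by an
      expression linear in \<open>\<bar>X x\<bar>\<close>. The two exponentials in
      \<open>T k\<close> cover both signs of \<open>X x\<close>.\<close>
    define k where "k = nat \<lfloor>\<bar>X x\<bar>\<rfloor>"
    have k: "real k \<le> \<bar>X x\<bar>" "\<bar>X x\<bar> \<le> real k + 1"
      unfolding k_def by linarith+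
    have "k \<le> K"
      unfolding k_def K_def using m[of x] by (intro nat_mono floor_mono)
    have "(\<bar>X x\<bar> - real k)\<^sup>2 \<le> 1"
      using k by (intro power_le_one) auto
    then have "(X x)\<^sup>2 \<le> 1 - (real k)\<^sup>2 + 2 * real k * \<bar>X x\<bar>"
      by (simp add: power2_diff algebra_simps)
    then have "\<delta> * (X x)\<^sup>2 \<le> \<delta> * (1 - (real k)\<^sup>2 + 2 * real k * \<bar>X x\<bar>)"
      using \<open>0 < \<delta>\<close> by (intro mult_left_mono) auto
    then have "exp (\<delta> * (X x)\<^sup>2) \<le> exp (\<delta> + (- (\<delta> * (real k)\<^sup>2) + 2 * \<delta> * real k * \<bar>X x\<bar>))"
      by (simp add: algebra_simps)
    also have "\<dots> = exp \<delta> * (exp (- (\<delta> * (real k)\<^sup>2)) * exp (2 * \<delta> * real k * \<bar>X x\<bar>))"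
      by (simp only: exp_add)
    also have "\<dots> \<le> exp \<delta> * T k x"
      unfolding T_def by (intro mult_left_mono) (auto simp: abs_if)
    also have "\<dots> \<le> exp \<delta> * G x"
      unfolding G_def using \<open>k \<le> K\<close>
      by (intro mult_left_mono member_le_sum[where f="\<lambda>k. T k x"])
         (auto simp: T_def)
    finally show ?thesis .
  qed
  have q: "exp (- \<delta> / 2) < 1" "0 < exp (- \<delta> / 2)"
    using \<open>0 < \<delta>\<close> by simp_all
  have summand: "expectation (T k)
      \<le> 2 * Q * exp (- \<delta> / 2) ^ k" for k
  proof -
    have "expectation (T k)
        = exp (- (\<delta> * (real k)\<^sup>2)) * (expectation (\<lambda>x. exp (2 * \<delta> * real k * X x)) + expectation (\<lambda>x. exp (- (2 * \<delta> * real k) * X x)))"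
      unfolding T_def using int by (simp only: integral_mult_right_zero Bochner_Integration.integral_add)
    also have "\<dots> \<le> exp (- (\<delta> * (real k)\<^sup>2)) * (Q * exp ((2 * \<delta> * real k)\<^sup>2 * b) + Q * exp ((- (2 * \<delta> * real k))\<^sup>2 * b))"
      by (intro mult_left_mono add_mono mgf) auto
    also have "\<dots> = 2 * Q * exp (- (\<delta> * (real k)\<^sup>2) + (2 * \<delta> * real k)\<^sup>2 * b)"
      unfolding exp_add by simp
    \<comment> \<open>The assumption \<open>8 * \<delta> * b \<le> 1\<close> lets the moment bound
      use up at most half of the decay \<open>\<delta> * k\<^sup>2\<close>; then
      \<open>k \<le> k\<^sup>2\<close> makes the series geometric.\<close>
    also have "\<dots> \<le> 2 * Q * exp (real k * (- \<delta> / 2))"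
    proof -
      have "(8 * \<delta> * b) * (\<delta> / 2 * (real k)\<^sup>2) \<le> 1 * (\<delta> / 2 * (real k)\<^sup>2)"
        using assms(5,6) by (intro mult_right_mono) auto
      then have "(2 * \<delta> * real k)\<^sup>2 * b \<le> \<delta> / 2 * (real k)\<^sup>2"
        by (simp add: power2_eq_square mult_ac)
      moreover have "real k \<le> (real k)\<^sup>2"
        by (cases k) (auto simp: power2_eq_square algebra_simps)
      then have "\<delta> / 2 * real k \<le> \<delta> / 2 * (real k)\<^sup>2"
        using \<open>0 < \<delta>\<close> by (intro mult_left_mono) auto
      ultimately have "- (\<delta> * (real k)\<^sup>2) + (2 * \<delta> * real k)\<^sup>2 * b \<le> real k * (- \<delta> / 2)"
        by (simp add: field_simps)
      then show ?thesis
        using \<open>0 \<le> Q\<close> by (intro mult_left_mono) auto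
    qed
    also have "\<dots> = 2 * Q * exp (- \<delta> / 2) ^ k"
      by (simp only: exp_of_nat_mult)
    finally show ?thesis .
  qed
  have "expectation (\<lambda>x. exp (\<delta> * (X x)\<^sup>2)) \<le> expectation (\<lambda>x. exp \<delta> * G x)"
  proof (rule integral_mono[OF _ _ pointwise])
    show "integrable M (\<lambda>x. exp \<delta> * G x)"
      by (intro integrable_mult_right int_G)
    then show "integrable M (\<lambda>x. exp (\<delta> * (X x)\<^sup>2))"
    proof (rule Bochner_Integration.integrable_bound)
      have "norm (exp (\<delta> * (X x)\<^sup>2)) \<le> norm (exp \<delta> * G x)" for x
        using order_trans[OF pointwise abs_ge_self, of x] by simp
      then show "AE x in M. norm (exp (\<delta> * (X x)\<^sup>2)) \<le> norm (exp \<delta> * G x)"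
        by (rule AE_I2)
    qed simp
  qed
  also have "\<dots> = exp \<delta> * (\<Sum>k\<le>K. expectation (T k))"
    unfolding integral_mult_right_zero G_def by (subst Bochner_Integration.integral_sum[OF int_term]) simp
  also have "\<dots> \<le> exp \<delta> * (\<Sum>k\<le>K. 2 * Q * exp (- \<delta> / 2) ^ k)"
    by (intro mult_left_mono sum_mono summand) auto
  also have "(\<Sum>k\<le>K. 2 * Q * exp (- \<delta> / 2) ^ k) \<le> (\<Sum>k. 2 * Q * exp (- \<delta> / 2) ^ k)"
    using q \<open>0 \<le> Q\<close> by (intro sum_le_suminf summable_mult summable_geometric) auto
  also have "(\<Sum>k. 2 * Q * exp (- \<delta> / 2) ^ k) = 2 * Q * (1 / (1 - exp (- \<delta> / 2)))"
    using q by (subst suminf_mult) (auto simp: suminf_geometric summable_geometric)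
  finally show ?thesis
    by (simp add: mult_ac)
qed

subsection \<open>The central limit theorem\<close>

text \<open>For \<open>x = t * \<psi> y\<close> the linear term is annihilated by \<open>L\<close>,
  and only the even factor survives.\<close>

lemma exp_le_add_exp_square: "exp x \<le> x + exp (x\<^sup>2)" for x :: real
proof -
  have sq: "1 + x\<^sup>2 \<le> exp (x\<^sup>2)"
    by (rule exp_ge_add_one_self)
  consider "1 \<le> x" | "0 \<le> x" "x \<le> 1" | "- 1 \<le> x" "x \<le> 0" | "x \<le> - 1"
    by linarith
  then show ?thesis
  proof cases
    case 1
    then have "exp x \<le> exp (x\<^sup>2)"
      by (simp add: power2_eq_square)
    then show ?thesis
      using 1 by linarith
  next
    case 2
    then show ?thesis
      using exp_bound[of x] sq by linarith
  next
    case 3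
    have "exp x = 1 / exp (- x)"
      by (simp add: exp_minus divide_inverse)
    also have "\<dots> \<le> 1 / (1 - x)"
      using exp_ge_add_one_self[of "- x"] 3 by (intro divide_left_mono) auto
    also have "\<dots> \<le> 1 + x + x\<^sup>2"
    proof -
      have "0 \<le> - (x ^ 3)"
        using 3 by (simp add: power3_eq_cube mult_nonneg_nonpos)
      then have "1 \<le> (1 + x + x\<^sup>2) * (1 - x)"
        by (simp add: algebra_simps power2_eq_square power3_eq_cube)
      then show ?thesis
        using 3 by (simp add: divide_le_eq)
    qed
    finally show ?thesis
      using sq by linarith
  next
    case 4
    then have "0 \<le> x * (x + 1)"
      by (intro mult_nonpos_nonpos) auto
    moreover have "exp x \<le> 1"
      using 4 by simp
    ultimately show ?thesis
      using sq unfolding ring_distribs power2_eq_square[symmetric] by linarith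
  qed
qed

lemma norm_iexp_diff_le: "norm (exp (\<i> * complex_of_real a) - exp (\<i> * complex_of_real b)) \<le> \<bar>a - b\<bar>"
proof -
  have "exp (\<i> * complex_of_real a) - exp (\<i> * complex_of_real b)
      = exp (\<i> * complex_of_real b) * (exp (\<i> * complex_of_real (a - b)) - 1)"
    by (simp add: algebra_simps flip: exp_add)
  then show ?thesis
    using iexp_approx1[of "a - b" 0] by (simp add: norm_mult norm_exp_eq_Re)
qed

lemma one_over_sqrt_tendsto_0: "(\<lambda>n. 1 / sqrt (real n)) \<longlonglongrightarrow> 0"
  using tendsto_inverse_0_at_top[OF filterlim_compose[OF sqrt_at_top filterlim_real_sequentially]]
  by (simp add: inverse_eq_divide)

context martingale_part
begin

definition S :: "nat \<Rightarrow> (nat \<Rightarrow> 'a) \<Rightarrow> real" where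
  "S n x = (\<Sum>j<n. \<psi> ((seq_shift ^^ j) x))"

lemma cont_shift_iterate: "cont (seq_shift ^^ j)"
proof (induction j)
  case (Suc j)
  then show ?case
    unfolding funpow.simps o_def by (rule continuous_on_compose2[OF continuous_seq_shift]) auto
qed (simp add: id_def)

lemma cont_S: "cont (S n)"
  unfolding S_def
  by (intro continuous_on_sum continuous_on_compose2[OF psi_cont cont_shift_iterate]) auto

lemma S_Suc: "S (Suc n) x = S n (seq_shift x) + \<psi> x"
  unfolding S_def by (subst sum.lessThan_Suc_shift) (simp add: funpow_Suc_right del: funpow.simps)

text \<open>Invariance of \<open>\<mu>\<close> inserts the operator, and the shifted part
  \<open>S n \<circ> T\<close> of the sum is pulled out of it.\<close>

lemma integral_exp_S_Suc:
  assumes "cont p"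
  shows "(LINT x|\<mu>. exp (z * of_real (S (Suc n) x)) * p x)
    = (LINT x|\<mu>. exp (z * of_real (S n x)) * Lc (\<lambda>y. exp (z * of_real (\<psi> y)) * p y) x)"
proof -
  have c: "cont (\<lambda>x. exp (z * of_real (S (Suc n) x)) * p x)"
    by (intro continuous_intros assms cont_S)
  have "(\<lambda>x. exp (z * of_real (S (Suc n) x)) * p x)
      = (\<lambda>x. exp (z * of_real (S n (seq_shift x))) * (exp (z * of_real (\<psi> x)) * p x))"
    by (simp add: S_Suc exp_add ring_distribs mult.assoc)
  then have "Lc (\<lambda>x. exp (z * of_real (S (Suc n) x)) * p x) x
      = exp (z * of_real (S n x)) * Lc (\<lambda>y. exp (z * of_real (\<psi> y)) * p y) x" for x
    using Lc_shift_mult[of "\<lambda>x. exp (z * of_real (S n x))"] by simp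
  then show ?thesis
    using integral_Lc[OF c] by simp
qed

text \<open>With the approximate eigenfunction \<open>w\<close> inserted, each step multiplies the
  integral by \<open>\<kappa>\<close> up to \<open>C * \<bar>t\<bar> ^ 3\<close>. The condition
  \<open>t\<^sup>2 * \<sigma>2 \<le> 2\<close> keeps \<open>\<kappa>\<close> between 0 and 1, so
  that errors only add up. Exchanging 1 for \<open>w\<close> at time \<open>n\<close> and at time 0
  costs a multiple of \<open>t\<^sup>2\<close>.\<close>

lemma char_bound:
  "\<exists>C. \<forall>t n. \<bar>t\<bar> \<le> 1 \<longrightarrow> t\<^sup>2 * \<sigma>2 \<le> 2 \<longrightarrow>
    norm ((LINT x|\<mu>. exp (\<i> * of_real (t * S n x))) - of_real ((1 - t\<^sup>2 * \<sigma>2 / 2) ^ n))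
      \<le> C * (t\<^sup>2 + real n * \<bar>t\<bar> ^ 3)"
proof -
  obtain C where C: "0 \<le> C" "\<And>z x. norm z \<le> 1 \<Longrightarrow>
    norm (Lc (\<lambda>y. exp (z * of_real (\<psi> y)) * (1 + z\<^sup>2 / 2 * of_real (q y))) x
      - (1 + z\<^sup>2 / 2 * of_real \<sigma>2) * (1 + z\<^sup>2 / 2 * of_real (q x))) \<le> C * norm z ^ 3"
    using perturbed_eigen by blast
  obtain Q where Q: "Q > 0" "\<And>x. \<bar>q x\<bar> \<le> Q"
    using cont_bounded_real[OF q_cont] by blast
  have "norm ((LINT x|\<mu>. exp (\<i> * of_real (t * S n x))) - of_real ((1 - t\<^sup>2 * \<sigma>2 / 2) ^ n))
      \<le> (C + Q) * (t\<^sup>2 + real n * \<bar>t\<bar> ^ 3)" if t: "\<bar>t\<bar> \<le> 1" "t\<^sup>2 * \<sigma>2 \<le> 2" for t n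
  proof -
    define z where "z = \<i> * complex_of_real t"
    define \<kappa> where "\<kappa> = 1 - t\<^sup>2 * \<sigma>2 / 2"
    define w where "w y = 1 + z\<^sup>2 / 2 * of_real (q y)" for y
    define I where "I n p = (LINT x|\<mu>. exp (z * of_real (S n x)) * p x)" for n and p :: "_ \<Rightarrow> complex"
    have nz: "norm z = \<bar>t\<bar>"
      by (simp add: z_def norm_mult)
    have z2: "z\<^sup>2 = - of_real (t\<^sup>2)"
      by (simp add: z_def power_mult_distrib)
    have kappa: "1 + z\<^sup>2 / 2 * of_real \<sigma>2 = of_real \<kappa>"
      by (simp add: \<kappa>_def z2)
    have k1: "0 \<le> \<kappa>" "\<kappa> \<le> 1"
      using t sigma2_nonneg by (auto simp: \<kappa>_def)
    have cw: "cont w"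
      unfolding w_def by (intro continuous_intros q_cont)
    have E1: "norm (exp (z * of_real (S n x))) = 1" for n x
      by (simp add: z_def norm_exp_eq_Re)
    have I_diff: "norm (I n p - I n r) \<le> e"
      if p: "cont p" and r: "cont r" and e: "\<And>x. norm (p x - r x) \<le> e" for n p r e
    proof -
      have int: "integrable \<mu> (\<lambda>x. exp (z * of_real (S n x)) * s x)" if "cont s" for s
        by (intro integrable_mu continuous_intros cont_S that)
      have "I n p - I n r = (LINT x|\<mu>. exp (z * of_real (S n x)) * (p x - r x))"
        unfolding I_def using int[OF p] int[OF r] by (simp add: right_diff_distrib)
      also have "norm \<dots> \<le> (LINT x|\<mu>. norm (exp (z * of_real (S n x)) * (p x - r x)))"
        by (rule integral_norm_bound)
      also have "\<dots> = (LINT x|\<mu>. norm (p x - r x))"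
        by (simp only: norm_mult E1 mult_1_left)
      also have "\<dots> \<le> e"
        using e by (intro mu.integral_le_const integrable_mu continuous_intros p r) auto
      finally show ?thesis .
    qed
    have step: "norm (I (Suc n) w - of_real \<kappa> * I n w) \<le> C * \<bar>t\<bar> ^ 3" for n
    proof -
      have "I (Suc n) w = I n (Lc (\<lambda>y. exp (z * of_real (\<psi> y)) * w y))"
        unfolding I_def by (rule integral_exp_S_Suc[OF cw])
      moreover have "of_real \<kappa> * I n w = I n (\<lambda>x. of_real \<kappa> * w x)"
        unfolding I_def by (simp add: mult.left_commute[of _ "of_real \<kappa>"])
      moreover have "norm (I n (Lc (\<lambda>y. exp (z * of_real (\<psi> y)) * w y)) - I n (\<lambda>x. of_real \<kappa> * w x)) \<le> C * \<bar>t\<bar> ^ 3"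
      proof (rule I_diff)
        show "cont (Lc (\<lambda>y. exp (z * of_real (\<psi> y)) * w y))"
          by (intro cont_Lc continuous_intros psi_cont cw)
        show "cont (\<lambda>x. of_real \<kappa> * w x)"
          by (intro continuous_intros cw)
        show "norm (Lc (\<lambda>y. exp (z * of_real (\<psi> y)) * w y) x - of_real \<kappa> * w x) \<le> C * \<bar>t\<bar> ^ 3" for x
          using C(2)[of z x] t(1) unfolding nz kappa w_def by simp
      qed
      ultimately show ?thesis
        by simp
    qed
    have pow: "norm (I n w - of_real (\<kappa> ^ n) * I 0 w) \<le> real n * (C * \<bar>t\<bar> ^ 3)" for n
    proof (induction n)
      case (Suc n)
      have "I (Suc n) w - of_real (\<kappa> ^ Suc n) * I 0 w
          = (I (Suc n) w - of_real \<kappa> * I n w) + of_real \<kappa> * (I n w - of_real (\<kappa> ^ n) * I 0 w)"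
        by (simp add: algebra_simps)
      also have "norm \<dots> \<le> C * \<bar>t\<bar> ^ 3 + \<kappa> * norm (I n w - of_real (\<kappa> ^ n) * I 0 w)"
        using k1 by (intro order_trans[OF norm_triangle_ineq] add_mono step) (simp add: norm_mult)
      also have "\<dots> \<le> C * \<bar>t\<bar> ^ 3 + 1 * norm (I n w - of_real (\<kappa> ^ n) * I 0 w)"
        using k1 by (intro add_left_mono mult_right_mono) auto
      also have "\<dots> \<le> C * \<bar>t\<bar> ^ 3 + 1 * (real n * (C * \<bar>t\<bar> ^ 3))"
        using Suc by (intro add_left_mono mult_left_mono) auto
      finally show ?case
        by (simp add: algebra_simps)
    qed simp
    have w1: "norm (1 - w x) \<le> t\<^sup>2 / 2 * Q" for x
      using mult_left_mono[OF Q(2)[of x], of "t\<^sup>2 / 2"] by (simp add: w_def z2 norm_mult norm_divide norm_power)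
    have I0: "I 0 (\<lambda>x. 1) = 1"
      using mu.prob_space by (simp add: I_def S_def)
    have A: "norm (I n (\<lambda>x. 1) - I n w) \<le> t\<^sup>2 / 2 * Q" for n
      by (intro I_diff cw w1 continuous_on_const)
    have "norm (of_real (\<kappa> ^ n) * I 0 w - of_real (\<kappa> ^ n)) = norm (of_real (\<kappa> ^ n) * (I 0 (\<lambda>x. 1) - I 0 w))"
      unfolding I0 by (simp add: norm_minus_commute right_diff_distrib)
    also have "\<dots> \<le> 1 * (t\<^sup>2 / 2 * Q)"
      unfolding norm_mult using k1 by (intro mult_mono A) (auto simp: norm_power power_le_one)
    finally have B: "norm (of_real (\<kappa> ^ n) * I 0 w - of_real (\<kappa> ^ n)) \<le> t\<^sup>2 / 2 * Q"
      by simp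
    have "norm (I n (\<lambda>x. 1) - of_real (\<kappa> ^ n)) \<le> t\<^sup>2 / 2 * Q + real n * (C * \<bar>t\<bar> ^ 3) + t\<^sup>2 / 2 * Q"
    proof -
      have "norm (I n (\<lambda>x. 1) - of_real (\<kappa> ^ n)) \<le> norm (I n (\<lambda>x. 1) - I n w) + norm (I n w - of_real (\<kappa> ^ n))"
        using norm_triangle_ineq[of "I n (\<lambda>x. 1) - I n w" "I n w - of_real (\<kappa> ^ n)"] by simp
      moreover have "norm (I n w - of_real (\<kappa> ^ n))
          \<le> norm (I n w - of_real (\<kappa> ^ n) * I 0 w) + norm (of_real (\<kappa> ^ n) * I 0 w - of_real (\<kappa> ^ n))"
        using norm_triangle_ineq[of "I n w - of_real (\<kappa> ^ n) * I 0 w" "of_real (\<kappa> ^ n) * I 0 w - of_real (\<kappa> ^ n)"]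
        by simp
      ultimately show ?thesis
        using A[of n] B pow[of n] by linarith
    qed
    also have "\<dots> \<le> (C + Q) * (t\<^sup>2 + real n * \<bar>t\<bar> ^ 3)"
      using C(1) Q(1) by (simp add: algebra_simps)
    also have "I n (\<lambda>x. 1) = (LINT x|\<mu>. exp (\<i> * of_real (t * S n x)))"
      by (simp add: I_def z_def mult.assoc)
    finally show ?thesis
      by (simp add: \<kappa>_def)
  qed
  then show ?thesis
    by blast
qed

lemma char_S_limit:
  "(\<lambda>n. LINT x|\<mu>. exp (\<i> * of_real (s * (1 / sqrt (real n) * S n x))))
    \<longlonglongrightarrow> of_real (exp (- (s\<^sup>2 * \<sigma>2) / 2))"
proof -
  obtain C where C: "\<And>t n. \<bar>t\<bar> \<le> 1 \<Longrightarrow> t\<^sup>2 * \<sigma>2 \<le> 2 \<Longrightarrow>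
    norm ((LINT x|\<mu>. exp (\<i> * of_real (t * S n x))) - of_real ((1 - t\<^sup>2 * \<sigma>2 / 2) ^ n))
      \<le> C * (t\<^sup>2 + real n * \<bar>t\<bar> ^ 3)"
    using char_bound by blast
  define a where "a n = (LINT x|\<mu>. exp (\<i> * of_real (s * (1 / sqrt (real n) * S n x))))" for n
  define b where "b n = (1 + (- (s\<^sup>2 * \<sigma>2) / 2) / real n) ^ n" for n
  have b: "b \<longlonglongrightarrow> exp (- (s\<^sup>2 * \<sigma>2) / 2)"
    unfolding b_def by (rule tendsto_exp_limit_sequentially)
  have inv: "(\<lambda>n. 1 / real n) \<longlonglongrightarrow> 0"
    by (rule lim_1_over_n)
  have "(\<lambda>n. a n - of_real (b n)) \<longlonglongrightarrow> 0"
  proof (rule Lim_null_comparison)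
    have "(\<lambda>n. C * (s\<^sup>2 * (1 / real n) + \<bar>s\<bar> ^ 3 * (1 / sqrt (real n)))) \<longlonglongrightarrow> C * (s\<^sup>2 * 0 + \<bar>s\<bar> ^ 3 * 0)"
      by (intro tendsto_intros inv one_over_sqrt_tendsto_0)
    then show "(\<lambda>n. C * (s\<^sup>2 * (1 / real n) + \<bar>s\<bar> ^ 3 * (1 / sqrt (real n)))) \<longlonglongrightarrow> 0"
      by simp
    have "\<forall>\<^sub>F n in sequentially. \<bar>s\<bar> * (1 / sqrt (real n)) < 1"
      using tendsto_mult_right_zero[OF one_over_sqrt_tendsto_0, of "\<bar>s\<bar>"] by (intro order_tendstoD(2)) auto
    moreover have "\<forall>\<^sub>F n in sequentially. (s\<^sup>2 * \<sigma>2) * (1 / real n) < 2"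
      using tendsto_mult_right_zero[OF inv, of "s\<^sup>2 * \<sigma>2"] by (intro order_tendstoD(2)) auto
    ultimately show "\<forall>\<^sub>F n in sequentially. norm (a n - of_real (b n)) \<le> C * (s\<^sup>2 * (1 / real n) + \<bar>s\<bar> ^ 3 * (1 / sqrt (real n)))"
      using eventually_gt_at_top[of 0]
    proof eventually_elim
      case (elim n)
      define t where "t = s / sqrt (real n)"
      have t2: "t\<^sup>2 = s\<^sup>2 * (1 / real n)"
        using elim(3) by (simp add: t_def power_divide)
      have ta: "\<bar>t\<bar> = \<bar>s\<bar> * (1 / sqrt (real n))"
        by (simp add: t_def)
      have t3: "real n * \<bar>t\<bar> ^ 3 = \<bar>s\<bar> ^ 3 * (1 / sqrt (real n))"
      proof -
        have "\<bar>t\<bar> ^ 3 = t\<^sup>2 * \<bar>t\<bar>"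
          by (simp add: power3_eq_cube power2_eq_square)
        also have "\<dots> = s\<^sup>2 * \<bar>s\<bar> * (1 / real n) * (1 / sqrt (real n))"
          unfolding t2 ta by simp
        finally show ?thesis
          using elim(3) by (simp add: power3_eq_cube power2_eq_square)
      qed
      have "norm ((LINT x|\<mu>. exp (\<i> * of_real (t * S n x))) - of_real ((1 - t\<^sup>2 * \<sigma>2 / 2) ^ n))
          \<le> C * (t\<^sup>2 + real n * \<bar>t\<bar> ^ 3)"
      proof (rule C)
        show "\<bar>t\<bar> \<le> 1"
          using elim(1) unfolding ta by simp
        show "t\<^sup>2 * \<sigma>2 \<le> 2"
          using elim(2) unfolding t2 by (simp add: mult_ac)
      qed
      moreover have "(LINT x|\<mu>. exp (\<i> * of_real (t * S n x))) = a n"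
        by (simp add: a_def t_def)
      moreover have "(1 - t\<^sup>2 * \<sigma>2 / 2) ^ n = b n"
        unfolding b_def t2 by (simp add: mult_ac)
      ultimately have "norm (a n - of_real (b n)) \<le> C * (t\<^sup>2 + real n * \<bar>t\<bar> ^ 3)"
        by (simp only:)
      then show ?case
        unfolding t3 t2 .
    qed
  qed
  from tendsto_add[OF this tendsto_of_real[OF b, where ?'a=complex]]
  show ?thesis
    by (simp add: a_def)
qed

text \<open>An Azuma-Hoeffding bound: peeling off one summand at a time, each costs the factor
  \<open>exp (t\<^sup>2 * B\<^sup>2)\<close> because \<open>L\<close> annihilates the linear
  term.\<close>

lemma exp_S_subgaussian:
  assumes B: "\<And>x. \<bar>\<psi> x\<bar> \<le> B"
  shows "(LINT x|\<mu>. exp (t * S n x)) \<le> exp (real n * (t\<^sup>2 * B\<^sup>2))"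
proof (induction n)
  case 0
  then show ?case
    using mu.prob_space by (simp add: S_def)
next
  case (Suc n)
  have c: "cont (\<lambda>x. exp (t * S (Suc n) x))" "cont (\<lambda>x. exp (t * S n x))" "cont (\<lambda>x. exp (t * \<psi> x))"
    by (intro continuous_intros cont_S psi_cont)+
  have L_exp: "L (\<lambda>y. exp (t * \<psi> y)) x \<le> exp (t\<^sup>2 * B\<^sup>2)" for x
  proof -
    have "L (\<lambda>y. exp (t * \<psi> y)) x \<le> L (\<lambda>y. t * \<psi> y + exp (t\<^sup>2 * B\<^sup>2)) x"
    proof (intro ruelle_mono f_cont c(3) continuous_intros psi_cont)
      fix y
      have "(\<psi> y)\<^sup>2 \<le> B\<^sup>2"
        using power_mono[OF B[of y], of 2] by simp
      then have "(t * \<psi> y)\<^sup>2 \<le> t\<^sup>2 * B\<^sup>2"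
        by (simp add: power_mult_distrib mult_left_mono)
      then have "exp ((t * \<psi> y)\<^sup>2) \<le> exp (t\<^sup>2 * B\<^sup>2)"
        by simp
      then show "exp (t * \<psi> y) \<le> t * \<psi> y + exp (t\<^sup>2 * B\<^sup>2)"
        using exp_le_add_exp_square[of "t * \<psi> y"] by linarith
    qed
    also have "\<dots> = exp (t\<^sup>2 * B\<^sup>2)"
      by (simp add: ruelle_add ruelle_scale ruelle_psi f_cont psi_cont continuous_on_mult)
    finally show ?thesis .
  qed
  have "(\<lambda>x. exp (t * S (Suc n) x)) = (\<lambda>x. exp (t * S n (seq_shift x)) * exp (t * \<psi> x))"
    by (simp add: S_Suc exp_add ring_distribs)
  then have "L (\<lambda>x. exp (t * S (Suc n) x)) x = exp (t * S n x) * L (\<lambda>y. exp (t * \<psi> y)) x" for x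
    using ruelle_shift_mult[of f "\<lambda>x. exp (t * S n x)"] by simp
  then have "(LINT x|\<mu>. exp (t * S (Suc n) x)) = (LINT x|\<mu>. exp (t * S n x) * L (\<lambda>y. exp (t * \<psi> y)) x)"
    using integral_ruelle[OF c(1)] by simp
  also have "\<dots> \<le> (LINT x|\<mu>. exp (t * S n x) * exp (t\<^sup>2 * B\<^sup>2))"
    by (intro integral_mono integrable_mu continuous_intros c cont_ruelle f_cont mult_left_mono L_exp) auto
  also have "\<dots> = (LINT x|\<mu>. exp (t * S n x)) * exp (t\<^sup>2 * B\<^sup>2)"
    by simp
  also have "\<dots> \<le> exp (real n * (t\<^sup>2 * B\<^sup>2)) * exp (t\<^sup>2 * B\<^sup>2)"
    by (intro mult_right_mono Suc) simp
  also have "\<dots> = exp (real (Suc n) * (t\<^sup>2 * B\<^sup>2))"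
    by (simp add: ring_distribs flip: exp_add)
  finally show ?case .
qed

text \<open>The coboundary telescopes to \<open>k \<circ> T\<^sup>n - k\<close>, which is bounded
  and disappears under the factor \<open>1 / sqrt n\<close>. Characteristic functions then give weak
  convergence, and an exponential square moment uniform in \<open>n\<close> admits unbounded test
  functions.\<close>

theorem central_limit:
  assumes k: "cont k" and g: "g = (\<lambda>x. \<alpha> + \<psi> x - k x + k (seq_shift x))" and "0 < \<sigma>2"
    and u: "simple_test_function u \<or> continuous_test_function u"
  shows "(\<lambda>n. LINT x|\<mu>. u (1 / sqrt (real n) * (\<Sum>j<n. g ((seq_shift ^^ j) x) - \<alpha>)))
    \<longlonglongrightarrow> (LINT t|normal_distribution (sqrt \<sigma>2). u t)"
proof -
  obtain B where B: "B > 0" "\<And>x. \<bar>\<psi> x\<bar> \<le> B"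
    using cont_bounded_real[OF psi_cont] by blast
  obtain H where H: "H > 0" "\<And>x. \<bar>k x\<bar> \<le> H"
    using cont_bounded_real[OF k] by blast
  define X where "X n x = 1 / sqrt (real n) * (\<Sum>j<n. g ((seq_shift ^^ j) x) - \<alpha>)" for n x
  have X_eq: "X n x = 1 / sqrt (real n) * (S n x + k ((seq_shift ^^ n) x) - k x)" for n x
  proof -
    have "(\<Sum>j<n. g ((seq_shift ^^ j) x) - \<alpha>) = S n x + (k ((seq_shift ^^ n) x) - k x)"
      by (induction n) (simp_all add: S_def g)
    then show ?thesis
      by (simp add: X_def)
  qed
  have cX: "cont (X n)" for n
    unfolding X_eq[abs_def]
    by (intro continuous_intros cont_S k continuous_on_compose2[OF k cont_shift_iterate]) auto
  have mX: "X n \<in> borel_measurable \<mu>" for n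
    using borel_measurable_continuous_onI[OF cX] measurable_cong_sets[OF sets_mu refl] by blast
  define M where "M n = distr \<mu> borel (X n)" for n
  have M: "real_distribution (M n)" for n
    unfolding M_def using mu.prob_space_distr[OF mX]
    by (simp add: real_distribution_def real_distribution_axioms_def)
  have sigma: "0 < sqrt \<sigma>2"
    using \<open>0 < \<sigma>2\<close> by simp
  have weak: "weak_conv_m M (normal_distribution (sqrt \<sigma>2))"
  proof (rule levy_continuity[OF M real_distribution_normal[OF sigma]])
    fix s
    define a where "a n x = s * (1 / sqrt (real n) * S n x)" for n x
    have char_M: "char (M n) s = (LINT x|\<mu>. exp (\<i> * of_real (s * X n x)))" for n
      unfolding char_def M_def using mX by (subst integral_distr) auto
    have ca: "cont (a n)" for n
      unfolding a_def by (intro continuous_intros cont_S)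
    have "(\<lambda>n. char (M n) s - (LINT x|\<mu>. exp (\<i> * of_real (a n x)))) \<longlonglongrightarrow> 0"
    proof (rule Lim_null_comparison)
      show "(\<lambda>n. (\<bar>s\<bar> * (2 * H)) * (1 / sqrt (real n))) \<longlonglongrightarrow> 0"
        by (rule tendsto_mult_right_zero[OF one_over_sqrt_tendsto_0])
      have "norm (char (M n) s - (LINT x|\<mu>. exp (\<i> * of_real (a n x)))) \<le> (\<bar>s\<bar> * (2 * H)) * (1 / sqrt (real n))" for n
      proof -
        have int: "integrable \<mu> (\<lambda>x. exp (\<i> * of_real (r x)))" if "cont r" for r :: "_ \<Rightarrow> real"
          by (intro integrable_mu continuous_intros that)
        have cXs: "cont (\<lambda>x. s * X n x)"
          by (intro continuous_intros cX)
        have "norm (exp (\<i> * of_real (s * X n x)) - exp (\<i> * of_real (a n x))) \<le> (\<bar>s\<bar> * (2 * H)) * (1 / sqrt (real n))" for x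
        proof -
          have "norm (exp (\<i> * of_real (s * X n x)) - exp (\<i> * of_real (a n x))) \<le> \<bar>s * X n x - a n x\<bar>"
            by (rule norm_iexp_diff_le)
          also have "s * X n x - a n x = s * (1 / sqrt (real n) * (k ((seq_shift ^^ n) x) - k x))"
            by (simp add: X_eq a_def algebra_simps)
          also have "\<bar>\<dots>\<bar> = \<bar>s\<bar> * (1 / sqrt (real n) * \<bar>k ((seq_shift ^^ n) x) - k x\<bar>)"
            by (simp add: abs_mult)
          also have "\<dots> \<le> \<bar>s\<bar> * (1 / sqrt (real n) * (2 * H))"
            using H(2)[of x] H(2)[of "(seq_shift ^^ n) x"] by (intro mult_left_mono) auto
          finally show ?thesis
            by (simp add: mult_ac)
        qed
        note le = this
        have "norm (char (M n) s - (LINT x|\<mu>. exp (\<i> * of_real (a n x))))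
            = norm (LINT x|\<mu>. exp (\<i> * of_real (s * X n x)) - exp (\<i> * of_real (a n x)))"
          unfolding char_M using int[OF cXs] int[OF ca] by simp
        also have "\<dots> \<le> (LINT x|\<mu>. norm (exp (\<i> * of_real (s * X n x)) - exp (\<i> * of_real (a n x))))"
          by (rule integral_norm_bound)
        also have "\<dots> \<le> (\<bar>s\<bar> * (2 * H)) * (1 / sqrt (real n))"
          using int[OF cXs] int[OF ca] le by (intro mu.integral_le_const AE_I2) auto
        finally show ?thesis .
      qed
      then show "\<forall>\<^sub>F n in sequentially. norm (char (M n) s - (LINT x|\<mu>. exp (\<i> * of_real (a n x)))) \<le> (\<bar>s\<bar> * (2 * H)) * (1 / sqrt (real n))"
        by (intro always_eventually allI)
    qed
    from tendsto_add[OF this char_S_limit[of s, folded a_def]]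
    show "(\<lambda>n. char (M n) s) \<longlonglongrightarrow> char (normal_distribution (sqrt \<sigma>2)) s"
      unfolding char_normal_distribution[OF sigma] using sigma2_nonneg by simp
  qed
  \<comment> \<open>\<open>B\<^sup>2\<close> is the sub-Gaussian rate of the martingale part; the
    additional 1 absorbs the coboundary, through
    \<open>2 * \<bar>t\<bar> * H \<le> H\<^sup>2 + t\<^sup>2\<close>.\<close>
  define b where "b = B\<^sup>2 + 1"
  have mgf: "(LINT x|\<mu>. exp (s * X n x)) \<le> exp (H\<^sup>2) * exp (s\<^sup>2 * b)" for s n
  \<comment> \<open>For \<open>n = 0\<close> the sum is empty and \<open>X 0 = 0\<close>, whereas
    the rescaling \<open>t = s / sqrt n\<close> is meaningful only for \<open>n > 0\<close>.\<close>
  proof (cases "n = 0")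
    case True
    then have "X n x = 0" for x
      by (simp add: X_def)
    then show ?thesis
      using mu.prob_space by (simp add: b_def flip: exp_add)
  next
    case False
    define t where "t = s / sqrt (real n)"
    have t2: "real n * t\<^sup>2 = s\<^sup>2"
      using False by (simp add: t_def power_divide)
    have "t\<^sup>2 \<le> s\<^sup>2"
      using False mult_right_mono[of 1 "real n" "t\<^sup>2"] t2 by simp
    have le: "s * X n x \<le> t * S n x + (H\<^sup>2 + s\<^sup>2)" for x
    proof -
      have "s * X n x = t * S n x + t * (k ((seq_shift ^^ n) x) - k x)"
        by (simp add: X_eq t_def algebra_simps)
      also have "t * (k ((seq_shift ^^ n) x) - k x) \<le> \<bar>t\<bar> * \<bar>k ((seq_shift ^^ n) x) - k x\<bar>"
        by (metis abs_ge_self abs_mult)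
      also have "\<dots> \<le> \<bar>t\<bar> * (2 * H)"
        using H(2)[of x] H(2)[of "(seq_shift ^^ n) x"] by (intro mult_left_mono) auto
      also have "\<dots> \<le> H\<^sup>2 + t\<^sup>2"
        using sum_squares_bound[of "\<bar>t\<bar>" H] by (simp add: mult_ac)
      also have "\<dots> \<le> H\<^sup>2 + s\<^sup>2"
        using \<open>t\<^sup>2 \<le> s\<^sup>2\<close> by simp
      finally show ?thesis by simp
    qed
    have "(LINT x|\<mu>. exp (s * X n x)) \<le> (LINT x|\<mu>. exp (t * S n x) * exp (H\<^sup>2 + s\<^sup>2))"
      using le by (intro integral_mono integrable_mu continuous_intros cX cont_S) (simp_all flip: exp_add)
    also have "\<dots> = (LINT x|\<mu>. exp (t * S n x)) * exp (H\<^sup>2 + s\<^sup>2)"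
      by simp
    also have "\<dots> \<le> exp (real n * (t\<^sup>2 * B\<^sup>2)) * exp (H\<^sup>2 + s\<^sup>2)"
      by (intro mult_right_mono exp_S_subgaussian B(2)) simp
    also have "real n * (t\<^sup>2 * B\<^sup>2) = s\<^sup>2 * B\<^sup>2"
      by (simp add: t2 flip: mult.assoc)
    also have "exp (s\<^sup>2 * B\<^sup>2) * exp (H\<^sup>2 + s\<^sup>2) = exp (H\<^sup>2) * exp (s\<^sup>2 * b)"
      by (simp add: b_def algebra_simps flip: exp_add)
    finally show ?thesis .
  qed
  \<comment> \<open>The largest rate that \<open>exp_square_bound\<close> admits for
    \<open>b\<close>.\<close>
  define \<delta> where "\<delta> = 1 / (8 * b)"
  have "0 < b"
    by (simp add: b_def add_nonneg_pos)
  then have delta: "0 < \<delta>" "8 * \<delta> * b \<le> 1"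
    by (simp_all add: \<delta>_def)
  have cXsq: "cont (\<lambda>x. exp (\<delta> * (X n x)\<^sup>2))" for n
    by (intro continuous_intros cX)
  have int_M: "integrable (M n) (\<lambda>x. exp (\<delta> * x\<^sup>2))" for n
    unfolding M_def using integrable_mu[OF cXsq] mX by (subst integrable_distr_eq) auto
  have bound_M: "(LINT x|M n. exp (\<delta> * x\<^sup>2)) \<le> 2 * exp (H\<^sup>2) * exp \<delta> / (1 - exp (- \<delta> / 2))" for n
  proof -
    \<comment> \<open>The bound \<open>m\<close> may depend on \<open>n\<close>; it does not enter
      the resulting estimate, which is therefore uniform.\<close>
    obtain m where "\<And>x. \<bar>X n x\<bar> \<le> m"
      using cont_bounded_real[OF cX, of n] by blast
    then have "(LINT x|\<mu>. exp (\<delta> * (X n x)\<^sup>2)) \<le> 2 * exp (H\<^sup>2) * exp \<delta> / (1 - exp (- \<delta> / 2))"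
      using delta by (intro mu.exp_square_bound[where b=b] mX mgf) auto
    then show ?thesis
      unfolding M_def using mX by (subst integral_distr) auto
  qed
  have "(\<lambda>n. LINT x|M n. u x) \<longlonglongrightarrow> (LINT x|normal_distribution (sqrt \<sigma>2). u x)"
    using u simple_test_function_convergence[OF M weak sigma]
      continuous_test_function_convergence[OF M weak sigma delta(1) int_M bound_M] by blast
  moreover have "u \<in> borel_measurable borel"
    by (rule test_function_measurable[OF u])
  then have "(LINT x|M n. u x) = (LINT x|\<mu>. u (X n x))" for n
    unfolding M_def using mX by (subst integral_distr) auto
  ultimately show ?thesis
    by (simp add: X_def)
qed

end

theorem theorem14:
  fixes \<nu> :: "'a::metric_space measure"
    and f g :: "(nat \<Rightarrow> 'a) \<Rightarrow> real"
    and \<beta> u :: "real \<Rightarrow> real"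
  assumes "compact (UNIV :: 'a set)"
    and "diameter (UNIV :: 'a set) = 1"
    and "a_priori_measure \<nu>"
    and "f \<in> Lip"
    and "g \<in> Lip"
    and "\<not> coboundary_to_constant g"
    and "\<And>t. \<beta> t = pressure \<nu> (\<lambda>x. f x + t * g x) - pressure \<nu> f"
    and "simple_test_function u \<or> continuous_test_function u"
  shows "deriv (deriv \<beta>) 0 > 0 \<and>
    (\<lambda>n. LINT x|gibbs_measure \<nu> f.
        u (1 / sqrt (real n) * (\<Sum>j<n. g ((seq_shift ^^ j) x) - deriv \<beta> 0)))
      \<longlonglongrightarrow> (LINT t|density lborel (normal_density 0 (sqrt (deriv (deriv \<beta>) 0))). u t)"
proof -
  interpret full_shift \<nu>
    using assms(1-3) by unfold_locales
  define \<alpha> where "\<alpha> = (LINT x|gibbs_measure \<nu> f. g x)"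
  obtain F \<psi> q k where P: "martingale_part \<nu> (normalization \<nu> f) F (gibbs_measure \<nu> f) \<psi> q"
    and k: "cont k" and dec: "g = (\<lambda>x. \<alpha> + \<psi> x - k x + k (seq_shift x))"
    using gibbs_decomposition[OF assms(4,5)] unfolding \<alpha>_def by blast
  interpret P: martingale_part \<nu> "normalization \<nu> f" F "gibbs_measure \<nu> f" \<psi> q
    by (rule P)
  have deriv1: "deriv \<beta> 0 = \<alpha>"
    by (rule pressure_derivatives(1)[OF assms(4,5) k P dec \<alpha>_def assms(7)])
  have deriv2: "deriv (deriv \<beta>) 0 = P.\<sigma>2"
    unfolding P.\<sigma>2_def by (rule pressure_derivatives(2)[OF assms(4,5) k P dec \<alpha>_def assms(7)])
  have "0 < P.\<sigma>2"
    unfolding P.\<sigma>2_def by (rule variance_pos[OF P k dec assms(6)])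
  then show ?thesis
    unfolding deriv1 deriv2 using P.central_limit[OF k dec _ assms(8)] by blast
qed

end
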